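(* Let $n\ge 2$, $m\ge 1$, $s\in\mathbb{R}$, $t>-\frac n2$, and let $f\in H^s_t(S^m(\mathbb{R}^n))$ be a symmetric $m$-tensor field. Then: (a) $\mathcal{L}^m_{\ell_1\dots\ell_{n-1}}f=0$ for all integers $\ell_1,\dots,\ell_{n-1}\ge 0$ with $\ell_1+\dots+\ell_{n-1}=m$ if and only if $f=\mathrm{d}v$ for some $v\in H^{s+1}_{t+1}(S^{m-1}(\mathbb{R}^n))$. (b) $\mathcal{T}^m f=0$ if and only if $f=\sum_{i=0}^{m-1}\mathrm{d}^i v_i$ for some $v_i\in H^{s+i}_{t+i}(S^{m-i}(\mathbb{R}^n))$, $0\le i\le m-1$, with each $v_i$ divergence-free, i.e. $\delta v_i=0$.
   Context: Spaces. $S^m(\mathbb{R}^n)$ denotes symmetric $m$-tensor fields on $\mathbb{R}^n$; $\mathcal{S}(S^m(\mathbb{R}^n))$ those with Schwartz components. For $s\in\mathbb{R}$, $t>-n/2$, $H^s_t(\mathbb{R}^n)$ is the completion of $\mathcal{S}(\mathbb{R}^n)$ in the norm $\|f\|^2_{H^s_t(\mathbb{R}^n)}=\int_{\mathbb{R}^n}|y|^{2t}(1+|y|^2)^{s-t}|\hat f(y)|^2\,dy$, where $\hat f$ is the Fourier transform; its elements are identified with the corresponding measurable $\hat f$. $H^s_t(S^m(\mathbb{R}^n))$ consists of symmetric $m$-tensor fields with components in $H^s_t(\mathbb{R}^n)$. Summation over repeated indices is used. Operators. Inner differentiation: $(\mathrm{d}u)_{i_1\dots i_{m+1}}=\sigma(i_1,\dots,i_{m+1})\,\partial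 u_{i_1\dots i_m}/\partial x^{i_{m+1}}$, where $\sigma$ is symmetrization (average over all permutations of the indices). Divergence: $(\delta u)_{i_1\dots i_{m-1}}=\partial u_{i_1\dots i_{m-1}i}/\partial x^i$. These are defined on Schwartz tensor fields and extended to the $H^s_t$ setting through the Fourier transform ($\partial/\partial x^j$ becomes multiplication of $\hat u(y)$ by $\sqrt{-1}\,y_j$). A field $u$ is solenoidal (divergence-free) if $\delta u=0$, i.e. $y^i\hat u_{i_1\dots i_{m-1}i}(y)=0$ for a.e. $y$. Transforms. For $\omega\in\mathbb{S}^{n-1}$ and $p\in\mathbb{R}$ let $H_{\omega,p}=\{x:\langle x,\omega\rangle=p\}$, and for each $\omega$ let $\omega_1,\dots,\omega_{n-1}$ be an orthonormal basis of $\omega^\perp$. $\odot$ is the symmetric tensor product, and $\langle f(x),\cdot\rangle$ is full contraction, e.g. $\langle f(x),\omega^{\odot m}\rangle=f_{i_1\dots i_m}(x)\omega^{i_1}\cdots\omega^{i_m}$. For $f\in\mathcal{S}(S^m(\mathbb{R}^n))$: - the transversal Radon transform is $\mathcal{T}^mf(\omega,p)=\int_{H_{\omega,p}}\langle f(x),\omega^{\odot m}\rangle\,dx$; - the longitudinal Radon transform is $\mathcal{L}^m_{\ell_1\dots\ell_{n-1}}f(\omega,p)=\int_{H_{\omega,p}}\langle f(x),\omega_1^{\odot\ell_1}\odot\dots\odot\omega_{n-1}^{\odot\ell_{n-1}}\rangle\,dx$, for integers $\ell_i\ge0$ with $\sum\ell_i=m$. Both are extended to $H^s_t(S^m(\mathbb{R}^n))$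 by density. Equivalently, one contracts the componentwise Radon transform of $f$ with the same tensors, where the Radon transform is the unique continuous extension $H^s_t(\mathbb{R}^n)\to H^{s+(n-1)/2}_{t+(n-1)/2}(\mathbb{S}^{n-1}\times\mathbb{R})$; here $H^{s}_{t}(\mathbb{S}^{n-1}\times\mathbb{R})$ (for $t>-1/2$) is the completion of the Schwartz space in the norm $\|\varphi\|^2=\frac{1}{2(2\pi)^{n-1}}\int_{\mathbb{S}^{n-1}}\int_{\mathbb{R}}|\sigma|^{2t}(1+|\sigma|^2)^{s-t}|\hat\varphi(\omega,\sigma)|^2\,d\sigma\,d\omega$, with $\hat\varphi$ the one-dimensional Fourier transform in $p$. *)

theory Defs
  imports "HOL-Analysis.Analysis" "HOL-Combinatorics.Permutations"
begin

section \<open>Schwartz functions and the Fourier transform\<close>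

definition partial :: "'n::finite \<Rightarrow> (real^'n \<Rightarrow> complex) \<Rightarrow> real^'n \<Rightarrow> complex" where
  "partial j \<phi> x = frechet_derivative \<phi> (at x) (axis j 1)"

text \<open>All iterated partial derivatives are differentiable (so the function is smooth) and decay
  faster than any power.\<close>

definition schwartz :: "(real^'n::finite \<Rightarrow> complex) \<Rightarrow> bool" where
  "schwartz \<phi> \<longleftrightarrow> (\<forall>js.
     (\<forall>x. foldr partial js \<phi> differentiable (at x)) \<and>
     (\<forall>k::nat. bounded (range (\<lambda>x. norm x ^ k *\<^sub>R foldr partial js \<phi> x))))"

text \<open>The unitary normalisation is the one for which the weights of the two norms below make the
  Radon transform isometric. It is used both on \<open>real^'n\<close> and, in the variable \<open>p\<close>, on \<open>real\<close>.\<close>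

definition fourier :: "('a::euclidean_space \<Rightarrow> complex) \<Rightarrow> 'a \<Rightarrow> complex" where
  "fourier \<phi> y = complex_of_real ((2 * pi) powr (- real DIM('a) / 2)) *
     (LINT x|lborel. cis (- (x \<bullet> y)) * \<phi> x)"

section \<open>The spaces \<open>H\<^sup>s\<^sub>t\<close>\<close>

text \<open>An element \<open>f\<close> of the completion is represented throughout by its Fourier transform, a
  measurable function \<open>g\<close> considered up to equality almost everywhere.
  The squared norm is a function of \<open>g\<close>.\<close>

definition sobolev_sqnorm :: "real \<Rightarrow> real \<Rightarrow> (real^'n::finite \<Rightarrow> complex) \<Rightarrow> ennreal" where
  "sobolev_sqnorm s t g =
     (\<integral>\<^sup>+ y. ennreal (norm y powr (2 * t) * (1 + (norm y)\<^sup>2) powr (s - t) * (cmod (g y))\<^sup>2) \<partial>lborel)"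

definition schwartz_approx ::
  "real \<Rightarrow> real \<Rightarrow> (nat \<Rightarrow> real^'n::finite \<Rightarrow> complex) \<Rightarrow> (real^'n \<Rightarrow> complex) \<Rightarrow> bool" where
  "schwartz_approx s t \<phi> g \<longleftrightarrow> (\<forall>k. schwartz (\<phi> k)) \<and>
     (\<lambda>k. sobolev_sqnorm s t (\<lambda>y. fourier (\<phi> k) y - g y)) \<longlonglongrightarrow> 0"

definition sobolev :: "real \<Rightarrow> real \<Rightarrow> (real^'n::finite \<Rightarrow> complex) set" where
  "sobolev s t = {g \<in> borel_measurable borel. \<exists>\<phi>. schwartz_approx s t \<phi> g}"

section \<open>Tensors and tensor fields\<close>

text \<open>A tensor of rank \<open>m\<close> is the family of its components, indexed by the lists of length \<open>m\<close>
  over the coordinate type \<open>'n\<close>; values at lists of other lengths are irrelevant.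
  A tensor field over \<open>H\<^sup>s\<^sub>t\<close> is the family of the Fourier transforms of its components.\<close>

type_synonym 'n tensor_field = "'n list \<Rightarrow> real^'n \<Rightarrow> complex"

definition symmetrize :: "('n list \<Rightarrow> 'a::real_vector) \<Rightarrow> 'n list \<Rightarrow> 'a" where
  "symmetrize T is =
     (1 / fact (length is)) *\<^sub>R (\<Sum>\<pi> | \<pi> permutes {..<length is}. T (permute_list \<pi> is))"

definition sobolev_tensor :: "nat \<Rightarrow> real \<Rightarrow> real \<Rightarrow> 'n::finite tensor_field set" where
  "sobolev_tensor m s t = {u.
     (\<forall>is. length is = m \<longrightarrow> u is \<in> sobolev s t) \<and>
     (\<forall>is \<pi>. length is = m \<longrightarrow> \<pi> permutes {..<m} \<longrightarrow>
        (AE y in lborel. u (permute_list \<pi> is) y = u is y))}"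

definition tensor_field_eq :: "nat \<Rightarrow> 'n::finite tensor_field \<Rightarrow> 'n tensor_field \<Rightarrow> bool" where
  "tensor_field_eq m u v \<longleftrightarrow> (\<forall>is. length is = m \<longrightarrow> (AE y in lborel. u is y = v is y))"

text \<open>Inner differentiation and divergence on the Fourier side, where the \<open>j\<close>-th partial
  derivative is multiplication by \<open>\<i> y\<^sub>j\<close>.\<close>

definition inner_diff :: "'n::finite tensor_field \<Rightarrow> 'n tensor_field" where
  "inner_diff u is y =
     symmetrize (\<lambda>js. \<i> * complex_of_real (y $ last js) * u (butlast js) y) is"

definition divergence :: "'n::finite tensor_field \<Rightarrow> 'n tensor_field" where
  "divergence u is y = (\<Sum>j\<in>UNIV. \<i> * complex_of_real (y $ j) * u (is @ [j]) y)"

text \<open>The symmetric tensor product of a list of vectors.\<close>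

definition sym_product :: "(real^'n::finite) list \<Rightarrow> 'n list \<Rightarrow> real" where
  "sym_product vs = symmetrize (\<lambda>is. \<Prod>k<length vs. (vs ! k) $ (is ! k))"

definition contract :: "nat \<Rightarrow> ('n::finite list \<Rightarrow> complex) \<Rightarrow> ('n list \<Rightarrow> real) \<Rightarrow> complex" where
  "contract m F T = (\<Sum>is | length is = m. F is * complex_of_real (T is))"

section \<open>The Radon transform\<close>

text \<open>For a unit vector \<open>\<omega>\<close>, the \<open>(n-1)\<close>-dimensional Lebesgue measure on the hyperplane
  \<open>{x. x \<bullet> \<omega> = p}\<close>: the measure of \<open>A\<close> is the \<open>n\<close>-dimensional Lebesgue measure of the right
  cylinder of height 1 with base \<open>A\<close>, that is, one takes the image of Lebesgue measure on the slab
  \<open>{x. 0 \<le> x \<bullet> \<omega> \<le> 1}\<close> under the orthogonal projection to the hyperplane.\<close>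

definition hyperplane_measure :: "real^'n::finite \<Rightarrow> real \<Rightarrow> (real^'n) measure" where
  "hyperplane_measure \<omega> p =
     distr (density lborel (indicator {x. 0 \<le> x \<bullet> \<omega> \<and> x \<bullet> \<omega> \<le> 1})) borel
       (\<lambda>x. x + (p - x \<bullet> \<omega>) *\<^sub>R \<omega>)"

definition radon :: "(real^'n::finite \<Rightarrow> complex) \<Rightarrow> real^'n \<Rightarrow> real \<Rightarrow> complex" where
  "radon \<phi> \<omega> p = (LINT x|hyperplane_measure \<omega> p. \<phi> x)"

text \<open>The surface measure of the unit sphere as the cone measure
  \<open>A \<mapsto> n \<cdot> vol {r \<omega> | 0 < r < 1, \<omega> \<in> A}\<close>. It is a measure on the ambient space that is
  concentrated on the sphere; \<open>sgn x\<close> is \<open>x\<close> divided by its norm.\<close>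

definition sphere_measure :: "(real^'n::finite) measure" where
  "sphere_measure =
     distr (density lborel (\<lambda>x. of_nat CARD('n) * indicator (ball 0 1 - {0}) x)) borel sgn"

text \<open>The squared norm of \<open>H\<^sup>s\<^sub>t\<close> over the product of the sphere and the line, as a function of the
  one-dimensional Fourier transform \<open>\<psi>\<close> in \<open>p\<close>. Again this \<open>\<psi>\<close> represents the element.\<close>

definition cylinder_sqnorm :: "real \<Rightarrow> real \<Rightarrow> ((real^'n::finite) \<times> real \<Rightarrow> complex) \<Rightarrow> ennreal" where
  "cylinder_sqnorm s t \<psi> =
     ennreal (1 / (2 * (2 * pi) ^ (CARD('n) - 1))) *
     (\<integral>\<^sup>+ (\<omega>, \<sigma>). ennreal (\<bar>\<sigma>\<bar> powr (2 * t) * (1 + \<bar>\<sigma>\<bar>\<^sup>2) powr (s - t) * (cmod (\<psi> (\<omega>, \<sigma>)))\<^sup>2)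
        \<partial>(sphere_measure \<Otimes>\<^sub>M lborel))"

text \<open>\<open>\<psi>\<close> represents the value of the extended Radon transform at the element represented by \<open>g\<close>:
  the limit of the Radon transforms of every approximating sequence of Schwartz functions.
  Such a \<open>\<psi>\<close> is unique up to equality almost everywhere.\<close>

definition is_radon_ext ::
  "real \<Rightarrow> real \<Rightarrow> (real^'n::finite \<Rightarrow> complex) \<Rightarrow> ((real^'n) \<times> real \<Rightarrow> complex) \<Rightarrow> bool" where
  "is_radon_ext s t g \<psi> \<longleftrightarrow>
     \<psi> \<in> borel_measurable (sphere_measure \<Otimes>\<^sub>M lborel) \<and>
     (\<forall>\<phi>. schwartz_approx s t \<phi> g \<longrightarrow>
        (\<lambda>k. cylinder_sqnorm (s + (real CARD('n) - 1) / 2) (t + (real CARD('n) - 1) / 2)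
                (\<lambda>(\<omega>, \<sigma>). fourier (radon (\<phi> k) \<omega>) \<sigma> - \<psi> (\<omega>, \<sigma>))) \<longlonglongrightarrow> 0)"

definition radon_ext ::
  "real \<Rightarrow> real \<Rightarrow> (real^'n::finite \<Rightarrow> complex) \<Rightarrow> (real^'n) \<times> real \<Rightarrow> complex" where
  "radon_ext s t g = (SOME \<psi>. is_radon_ext s t g \<psi>)"

section \<open>Transversal and longitudinal transforms\<close>

definition orthonormal_basis_perp :: "real^'n::finite \<Rightarrow> (nat \<Rightarrow> real^'n) \<Rightarrow> bool" where
  "orthonormal_basis_perp \<omega> b \<longleftrightarrow>
     (\<forall>i\<in>{1..<CARD('n)}. \<forall>j\<in>{1..<CARD('n)}. b i \<bullet> b j = (if i = j then 1 else 0)) \<and>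
     span (b ` {1..<CARD('n)}) = {x. x \<bullet> \<omega> = 0}"

text \<open>Both transforms contract the componentwise Radon transform with a tensor depending on \<open>\<omega>\<close>
  only, so the contraction commutes with the Fourier transform in \<open>p\<close>, which represents the value
  here as well. An orthonormal frame \<open>e \<omega> 1, ..., e \<omega> (n-1)\<close> need not depend measurably on
  \<open>\<omega>\<close>, and then neither does the longitudinal transform.\<close>

definition transversal ::
  "nat \<Rightarrow> real \<Rightarrow> real \<Rightarrow> 'n::finite tensor_field \<Rightarrow> real^'n \<Rightarrow> real \<Rightarrow> complex" where
  "transversal m s t f \<omega> \<sigma> =
     contract m (\<lambda>is. radon_ext s t (f is) (\<omega>, \<sigma>)) (sym_product (replicate m \<omega>))"

definition longitudinal ::
  "(real^'n \<Rightarrow> nat \<Rightarrow> real^'n) \<Rightarrow> nat \<Rightarrow> (nat \<Rightarrow> nat) \<Rightarrow> real \<Rightarrow> real \<Rightarrow> 'n::finite tensor_field \<Rightarrow>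
     real^'n \<Rightarrow> real \<Rightarrow> complex" where
  "longitudinal e m l s t f \<omega> \<sigma> =
     contract m (\<lambda>is. radon_ext s t (f is) (\<omega>, \<sigma>))
       (sym_product (concat (map (\<lambda>i. replicate (l i) (e \<omega> i)) [1..<CARD('n)])))"

definition zero_on_cylinder :: "(real^'n::finite \<Rightarrow> real \<Rightarrow> complex) \<Rightarrow> bool" where
  "zero_on_cylinder F \<longleftrightarrow> (AE (\<omega>, \<sigma>) in sphere_measure \<Otimes>\<^sub>M lborel. F \<omega> \<sigma> = 0)"

end

theory Submission
  imports Defs "HOL-Probability.Characteristic_Functions"
begin

text \<open>By the slice theorem, the one-dimensional Fourier transform in \<open>p\<close> of the Radon transform of
  \<open>f\<close> at \<open>(\<omega>, \<sigma>)\<close> is a constant times \<open>f^(\<sigma>\<omega>)\<close>. Hence both kernels are described by conditions on the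
  symmetric tensor \<open>f^(y)\<close> for almost every \<open>y\<close>. Split the identity as \<open>P + \<omega>\<omega>\<^sup>T\<close> with \<open>\<omega> = y/|y|\<close>, in one
  index of \<open>f^(y)\<close> after the other. This gives \<open>f^ = P f^ + (d v)^\<close>, where \<open>P f^\<close> is projected in every index,
  and \<open>v^\<close> is linear in \<open>f^\<close> with coefficients bounded by a multiple of \<open>1/|y|\<close>, which accounts for the shift
  of \<open>s\<close> and \<open>t\<close>. The longitudinal transforms of \<open>f\<close> vanish iff \<open>P f^ = 0\<close>, which is (a). Iterating
  the splitting on \<open>v\<close> gives \<open>f = v\<^sub>0 + d v\<^sub>1 + ... + d\<^sup>m v\<^sub>m\<close> with solenoidal \<open>v\<^sub>0, ..., v\<^sub>m\<^sub>-\<^sub>1\<close> and a scalar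
  \<open>v\<^sub>m\<close>, and the transversal transform only sees \<open>v\<^sub>m\<close>, which is (b).

  That these fields lie in the spaces \<open>H\<^sup>s\<^sub>t\<close> follows from the fact that the completion consists of all measurable
  functions of finite norm. For this, the transforms of linear combinations of translated Gaussians are
  the products of \<open>exp(-|y|\<^sup>2/2)\<close> with trigonometric polynomials, and these are dense by the
  Stone-Weierstrass theorem and a monotone class argument.\<close>

section \<open>Symmetric tensors\<close>

text \<open>\<open>radon_ext\<close> is only a choice among functions with a limit property, so
  everything about it is read off from its values almost everywhere, and each condition passes
  between the cylinder and the space through null sets in polar coordinates. A frame need not be
  measurable in \<omega>; hence the contraction formula is proved for all lists of vectors off one
  null set, and the frame is inserted afterwards.

  The bound t > -n/2 makes the weight integrable at the origin, so that transforms of Schwartz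
  functions have finite norm. Gaussians suit the density argument because their transforms are
  explicit and translations become multiplications by characters, whose combinations form an
  algebra. The Gaussian factor in addition turns bounded pointwise convergence into convergence in
  the norm.

  In (b) a solenoidal part is invisible because its contraction with powers of \<omega> contains a
  contraction with a multiple of y. The remainder d^m v_m contributes (i \<sigma>)^m times the
  scalar transform, which for \<sigma> different from 0 vanishes only together with it.\<close>

definition symmetric_tensor :: "nat \<Rightarrow> ('n list \<Rightarrow> 'a) \<Rightarrow> bool" where
  "symmetric_tensor m T \<longleftrightarrow>
     (\<forall>is \<pi>. length is = m \<longrightarrow> \<pi> permutes {..<m} \<longrightarrow> T (permute_list \<pi> is) = T is)"

lemma symmetric_tensorD:
  "symmetric_tensor m T \<Longrightarrow> length is = m \<Longrightarrow> \<pi> permutes {..<m} \<Longrightarrow> T (permute_list \<pi> is) = T is"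
  by (auto simp: symmetric_tensor_def)

lemma symmetric_symmetrize: "symmetric_tensor m (symmetrize T)"
  unfolding symmetric_tensor_def
proof safe
  fix xs :: "'a list" and \<rho> assume m: "m = length xs" and \<rho>: "\<rho> permutes {..<length xs}"
  have "(\<Sum>\<pi> | \<pi> permutes {..<length xs}. T (permute_list \<pi> (permute_list \<rho> xs)))
      = (\<Sum>\<pi> | \<pi> permutes {..<length xs}. T (permute_list (\<rho> \<circ> \<pi>) xs))"
    by (intro sum.cong refl) (auto simp: permute_list_compose)
  also have "\<dots> = (\<Sum>\<pi> | \<pi> permutes {..<length xs}. T (permute_list \<pi> xs))"
    by (rule setum_permutations_compose_left[OF \<rho>, symmetric])
  finally show "symmetrize T (permute_list \<rho> xs) = symmetrize T xs"
    by (simp add: symmetrize_def)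
qed

lemma symmetrize_permute:
  assumes \<rho>: "\<rho> permutes {..<length xs}"
  shows "symmetrize (\<lambda>js. T (permute_list \<rho> js)) xs = symmetrize T xs"
proof -
  have "(\<Sum>\<pi> | \<pi> permutes {..<length xs}. T (permute_list \<rho> (permute_list \<pi> xs)))
      = (\<Sum>\<pi> | \<pi> permutes {..<length xs}. T (permute_list (\<pi> \<circ> \<rho>) xs))"
    using \<rho> by (intro sum.cong refl) (auto simp: permute_list_compose)
  also have "\<dots> = (\<Sum>\<pi> | \<pi> permutes {..<length xs}. T (permute_list \<pi> xs))"
    by (rule sum_permutations_compose_right[OF \<rho>, symmetric])
  finally show ?thesis by (simp add: symmetrize_def)
qed

lemma symmetrize_eq_self:
  fixes T :: "'n list \<Rightarrow> 'a::real_vector"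
  assumes "symmetric_tensor (length xs) T"
  shows "symmetrize T xs = T xs"
proof -
  have "symmetrize T xs = (1 / fact (length xs)) *\<^sub>R (\<Sum>\<pi> | \<pi> permutes {..<length xs}. T xs)"
    unfolding symmetrize_def
    by (intro arg_cong[where f = "scaleR _"] sum.cong refl) (auto intro: symmetric_tensorD[OF assms])
  also have "\<dots> = T xs"
    by (simp add: card_permutations[OF refl] sum_constant_scaleR del: sum_constant)
  finally show ?thesis .
qed

lemma symmetrize_cong:
  assumes "\<And>js. length js = length xs \<Longrightarrow> T js = U js"
  shows "symmetrize T xs = symmetrize U xs"
  unfolding symmetrize_def by (intro arg_cong[where f = "scaleR _"] sum.cong refl) (auto intro: assms)

lemma symmetrize_add: "symmetrize (\<lambda>js. T js + U js) xs = symmetrize T xs + symmetrize U xs"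
  by (simp add: symmetrize_def sum.distrib scaleR_add_right)

lemma symmetrize_sum:
  "symmetrize (\<lambda>js. \<Sum>k\<in>K. T k js) xs = (\<Sum>k\<in>K. symmetrize (T k) xs)"
  unfolding symmetrize_def by (subst sum.swap) (simp add: scaleR_sum_right)

text \<open>A permutation of the first m positions extends to all m + 1 positions by fixing the
  last, and the outer average absorbs it. This lets \<open>decomposition\<close> replace an
  unsymmetrized potential by its symmetrization.\<close>

lemma symmetrize_butlast_symmetrize:
  fixes a :: "'n \<Rightarrow> 'a::real_algebra"
  assumes "length xs = Suc m"
  shows "symmetrize (\<lambda>js. a (last js) * symmetrize T (butlast js)) xs =
         symmetrize (\<lambda>js. a (last js) * T (butlast js)) xs"
proof -
  let ?P = "{\<pi>. \<pi> permutes {..<m}}"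
  have "symmetrize (\<lambda>js. a (last js) * symmetrize T (butlast js)) xs =
      symmetrize (\<lambda>js. (1 / fact m) *\<^sub>R (\<Sum>\<pi>\<in>?P. a (last js) * T (permute_list \<pi> (butlast js)))) xs"
    using assms by (intro symmetrize_cong) (simp add: symmetrize_def sum_distrib_left)
  also have "\<dots> = (1 / fact m) *\<^sub>R
      (\<Sum>\<pi>\<in>?P. symmetrize (\<lambda>js. a (last js) * T (permute_list \<pi> (butlast js))) xs)"
    by (simp add: symmetrize_def sum.swap[of _ ?P] scaleR_sum_right mult.commute)
  also have "(\<Sum>\<pi>\<in>?P. symmetrize (\<lambda>js. a (last js) * T (permute_list \<pi> (butlast js))) xs)
      = (\<Sum>\<pi>\<in>?P. symmetrize (\<lambda>js. a (last js) * T (butlast js)) xs)"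
  proof (intro sum.cong refl)
    fix \<pi> assume "\<pi> \<in> ?P"
    then have p: "\<pi> permutes {..<m}" by simp
    then have q: "\<pi> permutes {..<length xs}"
      by (rule permutes_subset) (auto simp: assms)
    \<comment> \<open>\<pi> fixes position m, so it only moves entries of
      \<open>butlast js\<close>.\<close>
    have split: "permute_list \<pi> js = permute_list \<pi> (butlast js) @ [last js]" if "length js = length xs" for js
    proof (rule nth_equalityI)
      fix i assume "i < length (permute_list \<pi> js)"
      then have i: "i < Suc m" using that assms by simp
      have "js \<noteq> []" using that assms by auto
      then show "permute_list \<pi> js ! i = (permute_list \<pi> (butlast js) @ [last js]) ! i"
        using i that assms permutes_in_image[OF p, of i] permutes_not_in[OF p, of m]
        by (cases "i = m")
           (auto simp: permute_list_def nth_append nth_butlast last_conv_nth)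
    qed (use that assms in simp)
    have "symmetrize (\<lambda>js. a (last js) * T (permute_list \<pi> (butlast js))) xs
      = symmetrize (\<lambda>js. (\<lambda>ks. a (last ks) * T (butlast ks)) (permute_list \<pi> js)) xs"
      by (intro symmetrize_cong) (simp add: split)
    also have "\<dots> = symmetrize (\<lambda>js. a (last js) * T (butlast js)) xs"
      by (rule symmetrize_permute[OF q])
    finally show "symmetrize (\<lambda>js. a (last js) * T (permute_list \<pi> (butlast js))) xs
      = symmetrize (\<lambda>js. a (last js) * T (butlast js)) xs" .
  qed
  also have "(1 / fact m) *\<^sub>R \<dots> = symmetrize (\<lambda>js. a (last js) * T (butlast js)) xs"
    by (simp add: card_permutations[OF refl] sum_constant_scaleR del: sum_constant)
  finally show ?thesis .
qed

text \<open>The two sides differ by the cycle that carries position k to the end and closes the gap,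
  and symmetrization ignores it.\<close>

lemma symmetrize_move_to_end:
  assumes "k \<le> m" and "length xs = Suc m"
  shows "symmetrize (\<lambda>js. T ((take k js @ drop (Suc k) js) @ [js ! k])) xs = symmetrize T xs"
proof -
  \<comment> \<open>\<open>permute_list \<rho> js\<close> reads \<open>js ! \<rho> i\<close> at
    position i: the last position reads entry k, and the positions from k on read their
    successors.\<close>
  define \<rho> where "\<rho> i = (if i = m then k else if k \<le> i \<and> i < m then Suc i else i)" for i
  have "inj_on \<rho> {..<Suc m}"
    using assms(1) by (auto simp: inj_on_def \<rho>_def split: if_splits)
  moreover have "\<rho> ` {..<Suc m} \<subseteq> {..<Suc m}"
    using assms(1) by (auto simp: \<rho>_def)
  ultimately have "bij_betw \<rho> {..<Suc m} {..<Suc m}"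
    unfolding bij_betw_def using endo_inj_surj[of "{..<Suc m}" \<rho>] by blast
  then have \<rho>: "\<rho> permutes {..<length xs}"
    unfolding assms(2) by (rule bij_imp_permutes) (auto simp: \<rho>_def)
  have "(take k js @ drop (Suc k) js) @ [js ! k] = permute_list \<rho> js" if "length js = length xs" for js
    using that assms by (intro nth_equalityI) (auto simp: permute_list_def nth_append \<rho>_def)
  then have "symmetrize (\<lambda>js. T ((take k js @ drop (Suc k) js) @ [js ! k])) xs
      = symmetrize (\<lambda>js. T (permute_list \<rho> js)) xs"
    by (intro symmetrize_cong arg_cong[where f = T])
  then show ?thesis using symmetrize_permute[OF \<rho>] by simp
qed

section \<open>Tensors as multilinear forms on real vectors\<close>

primrec mform :: "(real^'n::finite) list \<Rightarrow> ('n list \<Rightarrow> complex) \<Rightarrow> complex" where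
  "mform [] F = F []"
| "mform (v # vs) F = (\<Sum>j\<in>UNIV. complex_of_real (v $ j) * mform vs (\<lambda>js. F (j # js)))"

lemma mform_cong: "(\<And>js. length js = length vs \<Longrightarrow> F js = G js) \<Longrightarrow> mform vs F = mform vs G"
proof (induction vs arbitrary: F G)
  case (Cons v vs)
  have "mform vs (\<lambda>js. F (j # js)) = mform vs (\<lambda>js. G (j # js))" for j
    by (rule Cons.IH) (simp add: Cons.prems)
  then show ?case by simp
qed simp

lemma mform_add: "mform vs (\<lambda>js. F js + G js) = mform vs F + mform vs G"
  by (induction vs arbitrary: F G) (simp_all add: sum.distrib algebra_simps)

lemma mform_mult_left: "mform vs (\<lambda>js. c * F js) = c * mform vs F"
  by (induction vs arbitrary: F) (simp_all add: sum_distrib_left mult.left_commute)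

lemma mform_zero [simp]: "mform vs (\<lambda>js. 0) = 0"
  by (induction vs) simp_all

lemma mform_sum: "mform vs (\<lambda>js. \<Sum>k\<in>K. F k js) = (\<Sum>k\<in>K. mform vs (F k))"
  by (induction K rule: infinite_finite_induct) (simp_all add: mform_add)

text \<open>The recursion takes arguments from the front, so a block of them can be isolated.
  Applied to \<open>us @ v # vs\<close>, this gives linearity in any single slot.\<close>

lemma mform_append: "mform (us @ vs) F = mform us (\<lambda>is. mform vs (\<lambda>js. F (is @ js)))"
  by (induction us arbitrary: F) simp_all

lemma mform_axis: "mform (map (\<lambda>i. axis i 1) is) F = F is"
  by (induction "is" arbitrary: F)
     (simp_all add: axis_def if_distrib if_distribR sum.delta cong: if_cong)

lemma mform_eq_contract:
  "mform vs F = contract (length vs) F (\<lambda>is. \<Prod>k<length vs. (vs ! k) $ (is ! k))"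
proof (induction vs arbitrary: F)
  case Nil
  then show ?case by (simp add: contract_def)
next
  case (Cons v vs)
  let ?A = "{is :: 'a list. length is = length vs}"
  have *: "{is :: 'a list. length is = length (v # vs)} = (\<lambda>(j, is). j # is) ` (UNIV \<times> ?A)"
    by (auto simp: length_Suc_conv)
  have inj: "inj_on (\<lambda>(j, is). j # is) (UNIV \<times> ?A)"
    by (auto simp: inj_on_def)
  have fin: "finite ?A"
    using finite_lists_length_eq[of "UNIV :: 'a set" "length vs"] by simp
  have "contract (length (v # vs)) F (\<lambda>is. \<Prod>k<length (v # vs). ((v # vs) ! k) $ (is ! k))
     = (\<Sum>(j, is)\<in>UNIV \<times> ?A. F (j # is) * complex_of_real (v $ j * (\<Prod>k<length vs. (vs ! k) $ (is ! k))))"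
    unfolding contract_def * by (subst sum.reindex[OF inj]) (simp add: prod.lessThan_Suc_shift case_prod_unfold del: prod.lessThan_Suc)
  also have "\<dots> = (\<Sum>j\<in>UNIV. \<Sum>is\<in>?A. F (j # is) * complex_of_real (v $ j * (\<Prod>k<length vs. (vs ! k) $ (is ! k))))"
    using fin by (simp add: sum.cartesian_product)
  also have "\<dots> = mform (v # vs) F"
    by (simp add: Cons.IH contract_def sum_distrib_left mult_ac)
  finally show ?case by simp
qed

lemma bij_permute_lists:
  assumes "\<pi> permutes {..<m}"
  shows "bij_betw (permute_list \<pi>) {is. length is = m} {is. length is = m}"
proof (rule bij_betwI[where g = "permute_list (inv \<pi>)"])
  have i: "inv \<pi> permutes {..<m}" using permutes_inv[OF assms] .
  show "permute_list (inv \<pi>) (permute_list \<pi> x) = x" if "x \<in> {is. length is = m}" for x :: "'a list"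
    using that permute_list_compose[of "inv \<pi>" x \<pi>] i permutes_inv_o(1)[OF assms] by simp
  show "permute_list \<pi> (permute_list (inv \<pi>) x) = x" if "x \<in> {is. length is = m}" for x :: "'a list"
    using that permute_list_compose[of \<pi> x "inv \<pi>"] assms permutes_inv_o(2)[OF assms] by simp
qed auto

lemma mform_permute:
  assumes \<pi>: "\<pi> permutes {..<length vs}"
  shows "mform (permute_list \<pi> vs) F = mform vs (\<lambda>is. F (permute_list \<pi> is))"
proof -
  let ?m = "length vs"
  have "mform vs (\<lambda>is. F (permute_list \<pi> is))
    = (\<Sum>is | length is = ?m. F (permute_list \<pi> is) *
         complex_of_real (\<Prod>k<?m. (permute_list \<pi> vs ! k) $ (permute_list \<pi> is ! k)))"
    unfolding mform_eq_contract contract_def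
  proof (intro sum.cong refl arg_cong2[where f = "(*)"] arg_cong[where f = complex_of_real])
    fix "is" :: "'a list" assume "is \<in> {is. length is = ?m}"
    then have "(\<Prod>k<?m. (permute_list \<pi> vs ! k) $ (permute_list \<pi> is ! k)) =
        (\<Prod>k<?m. (vs ! \<pi> k) $ (is ! \<pi> k))"
      by (intro prod.cong) (auto simp: permute_list_def)
    then show "(\<Prod>k<?m. (vs ! k) $ (is ! k)) = (\<Prod>k<?m. (permute_list \<pi> vs ! k) $ (permute_list \<pi> is ! k))"
      using prod.permute[OF \<pi>, of "\<lambda>k. (vs ! k) $ (is ! k)"] by (simp add: o_def)
  qed
  also have "\<dots> = (\<Sum>is | length is = ?m. F is * complex_of_real (\<Prod>k<?m. (permute_list \<pi> vs ! k) $ (is ! k)))"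
    by (rule sum.reindex_bij_betw[OF bij_permute_lists[OF \<pi>]])
  also have "\<dots> = mform (permute_list \<pi> vs) F"
    unfolding mform_eq_contract contract_def by simp
  finally show ?thesis by simp
qed

lemma mform_permute_symmetric:
  assumes "symmetric_tensor (length vs) F" "\<pi> permutes {..<length vs}"
  shows "mform (permute_list \<pi> vs) F = mform vs F"
  unfolding mform_permute[OF assms(2)]
  by (rule mform_cong) (use assms in \<open>auto intro: symmetric_tensorD\<close>)

lemma mform_symmetrize:
  "mform vs (symmetrize F) =
     (1 / fact (length vs)) *\<^sub>R (\<Sum>\<pi> | \<pi> permutes {..<length vs}. mform (permute_list \<pi> vs) F)"
proof -
  have "mform vs (symmetrize F) = mform vs (\<lambda>is. complex_of_real (1 / fact (length vs)) *
           (\<Sum>\<pi> | \<pi> permutes {..<length vs}. F (permute_list \<pi> is)))"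
    by (rule mform_cong) (simp add: symmetrize_def scaleR_conv_of_real)
  also have "\<dots> = complex_of_real (1 / fact (length vs)) *
      (\<Sum>\<pi> | \<pi> permutes {..<length vs}. mform vs (\<lambda>is. F (permute_list \<pi> is)))"
    by (simp only: mform_mult_left mform_sum)
  also have "\<dots> = complex_of_real (1 / fact (length vs)) *
      (\<Sum>\<pi> | \<pi> permutes {..<length vs}. mform (permute_list \<pi> vs) F)"
    by (intro arg_cong2[where f = "(*)"] sum.cong refl) (simp add: mform_permute)
  finally show ?thesis by (simp only: scaleR_conv_of_real)
qed

text \<open>Symmetrization is self-adjoint for the contraction, so it moves from the product of
  vectors to the tensor. Permuting the indices by \<pi> amounts to permuting the vectors by the
  inverse of \<pi>.\<close>

lemma contract_sym_product:
  assumes "length vs = m"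
  shows "contract m F (sym_product vs) = mform vs (symmetrize F)"
proof -
  let ?L = "{is :: 'a list. length is = m}" and ?P = "{\<pi>. \<pi> permutes {..<m}}"
  have "contract m F (sym_product vs) = (\<Sum>is\<in>?L. \<Sum>\<pi>\<in>?P. (1 / fact m) *\<^sub>R
      (F is * complex_of_real (\<Prod>k<m. (vs ! k) $ (permute_list \<pi> is ! k))))"
    unfolding contract_def sym_product_def symmetrize_def
    by (intro sum.cong refl) (simp add: assms sum_distrib_left scaleR_conv_of_real mult_ac sum_divide_distrib)
  also have "\<dots> = (1 / fact m) *\<^sub>R (\<Sum>\<pi>\<in>?P. \<Sum>is\<in>?L.
      F is * complex_of_real (\<Prod>k<m. (vs ! k) $ (permute_list \<pi> is ! k)))"
    by (subst sum.swap) (simp add: scaleR_sum_right)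
  also have "(\<Sum>\<pi>\<in>?P. \<Sum>is\<in>?L. F is * complex_of_real (\<Prod>k<m. (vs ! k) $ (permute_list \<pi> is ! k)))
      = (\<Sum>\<pi>\<in>?P. mform (permute_list (inv \<pi>) vs) F)"
  proof (intro sum.cong refl)
    fix \<pi> assume "\<pi> \<in> ?P"
    then have \<pi>: "\<pi> permutes {..<m}" by simp
    have i: "inv \<pi> permutes {..<length vs}" using permutes_inv[OF \<pi>] assms by simp
    have "(\<Prod>k<m. (vs ! k) $ (permute_list \<pi> is ! k)) = (\<Prod>k<m. (permute_list (inv \<pi>) vs ! k) $ (is ! k))"
      if l: "length is = m" for "is" :: "'a list"
    proof -
      have "(\<Prod>k<m. (vs ! k) $ (permute_list \<pi> is ! k)) = (\<Prod>k<m. (vs ! k) $ (is ! \<pi> k))"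
        using l by (intro prod.cong) (auto simp: permute_list_def)
      also have "\<dots> = (\<Prod>k<m. (vs ! inv \<pi> k) $ (is ! \<pi> (inv \<pi> k)))"
        using prod.permute[OF permutes_inv[OF \<pi>], of "\<lambda>k. (vs ! k) $ (is ! \<pi> k)"] by (simp add: o_def)
      also have "\<dots> = (\<Prod>k<m. (permute_list (inv \<pi>) vs ! k) $ (is ! k))"
        using assms permutes_inverses(1)[OF \<pi>] by (intro prod.cong) (auto simp: permute_list_def)
      finally show ?thesis .
    qed
    then show "(\<Sum>is\<in>?L. F is * complex_of_real (\<Prod>k<m. (vs ! k) $ (permute_list \<pi> is ! k)))
       = mform (permute_list (inv \<pi>) vs) F"
      unfolding mform_eq_contract contract_def using assms by (intro sum.cong) auto
  qed
  also have "\<dots> = (\<Sum>\<pi>\<in>?P. mform (permute_list \<pi> vs) F)"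
    by (rule sum_permutations_inverse[symmetric])
  finally show ?thesis by (simp add: mform_symmetrize assms)
qed

lemma contract_sym_product_symmetric:
  assumes "length vs = m" "symmetric_tensor m F"
  shows "contract m F (sym_product vs) = mform vs F"
  unfolding contract_sym_product[OF assms(1)]
  by (rule mform_cong) (use assms symmetrize_eq_self in auto)

lemma mform_linear_span:
  assumes "\<And>b. b \<in> B \<Longrightarrow> mform (us @ b # vs) F = 0" and "v \<in> span B"
  shows "mform (us @ v # vs) F = 0"
  using assms(2)
proof (induction rule: span_induct_alt)
  case base
  then show ?case by (simp add: mform_append)
next
  case (step c x y)
  have "mform (us @ (c *\<^sub>R x + y) # vs) F = c * mform (us @ x # vs) F + mform (us @ y # vs) F"
    by (simp add: mform_append sum.distrib distrib_right mform_add mult.assoc mform_mult_left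
        flip: sum_distrib_left)
  then show ?case using step assms(1) by simp
qed

text \<open>By multilinearity the vectors of the span are expanded one after the other;
  \<open>us\<close> collects the elements of B that have already been substituted.\<close>

lemma mform_span:
  assumes "\<And>vs. set vs \<subseteq> B \<Longrightarrow> length vs = m \<Longrightarrow> mform vs F = 0"
    and "set us \<subseteq> B" "set vs \<subseteq> span B" "length us + length vs = m"
  shows "mform (us @ vs) F = 0"
  using assms(2-)
proof (induction vs arbitrary: us)
  case Nil
  then show ?case using assms(1) by simp
next
  case (Cons v vs)
  show ?case
  proof (rule mform_linear_span)
    show "mform (us @ b # vs) F = 0" if "b \<in> B" for b
      using Cons.IH[of "us @ [b]"] Cons.prems that by simp
  qed (use Cons.prems in simp)
qed

section \<open>The splitting of a tensor by the projection orthogonal to a frequency\<close>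

definition perp_axis :: "real^'n::finite \<Rightarrow> 'n \<Rightarrow> real^'n" where
  "perp_axis y i = axis i 1 - (sgn y $ i) *\<^sub>R sgn y"

lemma perp_axis_orthogonal:
  assumes "y \<noteq> 0"
  shows "perp_axis y i \<bullet> y = 0"
proof -
  have "sgn y $ i * (sgn y \<bullet> y) = y $ i"
    using assms by (simp add: sgn_div_norm dot_square_norm power2_eq_square field_simps)
  then show ?thesis
    by (simp add: perp_axis_def inner_diff_left inner_axis' )
qed

lemma norm_perp_axis_le: "norm (perp_axis y i) \<le> 2"
proof -
  have "norm (perp_axis y i) \<le> norm (axis i (1::real)) + norm ((sgn y $ i) *\<^sub>R sgn y)"
    unfolding perp_axis_def by (rule norm_triangle_ineq4)
  also have "norm ((sgn y $ i) *\<^sub>R sgn y) \<le> 1 * 1"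
    unfolding norm_scaleR using component_le_norm_cart[of "sgn y" i]
    by (intro mult_mono) (auto simp: norm_sgn split: if_splits)
  finally show ?thesis by simp
qed

text \<open>This is P y = 0, expanded by the columns of P.\<close>

lemma sum_perp_axis:
  assumes "y \<noteq> 0"
  shows "(\<Sum>j\<in>UNIV. y $ j *\<^sub>R perp_axis y j) = 0"
proof -
  have "(\<Sum>j\<in>UNIV. y $ j *\<^sub>R axis j 1) = y"
    using basis_expansion[of y] by (simp add: scalar_mult_eq_scaleR)
  moreover have "(\<Sum>j\<in>UNIV. y $ j * (sgn y $ j)) = norm y"
    using dot_square_norm[of y] inner_real_def
    by (simp add: sgn_div_norm inner_vec_def power2_eq_square field_simps flip: sum_divide_distrib)
  then have "(\<Sum>j\<in>UNIV. y $ j *\<^sub>R (sgn y $ j *\<^sub>R sgn y)) = norm y *\<^sub>R sgn y"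
    by (simp only: scaleR_scaleR flip: scaleR_sum_left)
  moreover have "norm y *\<^sub>R sgn y = y"
    using assms by (simp add: sgn_div_norm)
  ultimately show ?thesis
    by (simp add: perp_axis_def scaleR_diff_right sum_subtractf)
qed

text \<open>\<open>perp_axis y i\<close> is the i-th column of P. As P is a symmetric matrix,
  applying it in every index means evaluating the form at these columns.\<close>

definition proj_perp :: "real^'n::finite \<Rightarrow> ('n list \<Rightarrow> complex) \<Rightarrow> 'n list \<Rightarrow> complex" where
  "proj_perp y F is = mform (map (perp_axis y) is) F"

text \<open>The symbol of \<open>inner_diff\<close> at one frequency. Fixing y keeps the algebra of
  the splitting apart from the statements about almost every y.\<close>

definition sym_mult :: "real^'n::finite \<Rightarrow> ('n list \<Rightarrow> complex) \<Rightarrow> 'n list \<Rightarrow> complex" where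
  "sym_mult y T = symmetrize (\<lambda>js. \<i> * complex_of_real (y $ last js) * T (butlast js))"

text \<open>In the summand for k the first k indices are projected, \<omega> is inserted in the next
  slot of F, and the other indices are untouched. The factor is 1 / (i |y|), the inverse of what
  \<open>sym_mult\<close> contributes along \<omega>. A list of length m has m + 1 places for the
  inserted slot, whence k runs up to \<open>length js\<close>.\<close>

definition potential :: "real^'n::finite \<Rightarrow> ('n list \<Rightarrow> complex) \<Rightarrow> 'n list \<Rightarrow> complex" where
  "potential y F = symmetrize (\<lambda>js. \<Sum>k\<le>length js. - \<i> * complex_of_real (inverse (norm y)) *
     mform (map (perp_axis y) (take k js) @ sgn y # map (\<lambda>i. axis i 1) (drop k js)) F)"

lemma symmetric_potential: "symmetric_tensor m (potential y F)"
  unfolding potential_def by (rule symmetric_symmetrize)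

lemma symmetric_proj_perp:
  assumes "symmetric_tensor m F"
  shows "symmetric_tensor m (proj_perp y F)"
  using mform_permute_symmetric[of "map (perp_axis y) _" F] assms
  unfolding symmetric_tensor_def proj_perp_def
  by (simp flip: permute_list_map)

text \<open>Contracting the last index with y puts P y, which is 0, in the last slot.\<close>

lemma proj_perp_solenoidal:
  assumes "y \<noteq> 0"
  shows "(\<Sum>j\<in>UNIV. \<i> * complex_of_real (y $ j) * proj_perp y F (is @ [j])) = 0"
proof -
  have "(\<Sum>j\<in>UNIV. \<i> * complex_of_real (y $ j) * proj_perp y F (is @ [j]))
     = \<i> * mform (map (perp_axis y) is) (\<lambda>js. \<Sum>j\<in>UNIV. complex_of_real (y $ j) *
          mform [perp_axis y j] (\<lambda>ks. F (js @ ks)))"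
    by (simp only: proj_perp_def mform_append map_append list.map mform_sum mform_mult_left
        sum_distrib_left mult.assoc)
  also have "(\<lambda>js. \<Sum>j\<in>UNIV. complex_of_real (y $ j) * mform [perp_axis y j] (\<lambda>ks. F (js @ ks)))
     = (\<lambda>js. 0)"
  proof
    fix js
    have "(\<Sum>j\<in>UNIV. complex_of_real (y $ j) * mform [perp_axis y j] (\<lambda>ks. F (js @ ks)))
       = (\<Sum>k\<in>UNIV. complex_of_real ((\<Sum>j\<in>UNIV. y $ j *\<^sub>R perp_axis y j) $ k) * F (js @ [k]))"
      by (simp add: sum_distrib_left sum_distrib_right mult.assoc) (rule sum.swap)
    then show "(\<Sum>j\<in>UNIV. complex_of_real (y $ j) * mform [perp_axis y j] (\<lambda>ks. F (js @ ks))) = 0"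
      by (simp add: sum_perp_axis[OF assms])
  qed
  finally show ?thesis by simp
qed

text \<open>Replacing the identity by \<open>P + \<omega> \<omega>\<^sup>T\<close>, \<open>P\<close> the projection to the complement of
  \<open>\<omega> = y / |y|\<close>, in one index after the other gives a telescoping sum. Each of its terms has the
  factor \<open>\<omega>\<close> in one index.\<close>

lemma decomposition:
  assumes sym: "symmetric_tensor (Suc m) F" and y: "y \<noteq> 0" and len: "length is = Suc m"
  shows "F is = proj_perp y F is + sym_mult y (potential y F) is"
proof -
  \<comment> \<open>\<open>E k\<close> has P in its first k indices: \<open>E 0\<close> is F itself
    and \<open>E (Suc m)\<close> is \<open>proj_perp y F\<close>. Consecutive ones differ by a
    component of \<omega> times an \<open>R k\<close>.\<close>
  define E where "E k is = mform (map (perp_axis y) (take k is) @ map (\<lambda>i. axis i 1) (drop k is)) F" for k "is"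
  define R where "R k js = mform (map (perp_axis y) (take k js) @ sgn y # map (\<lambda>i. axis i 1) (drop k js)) F" for k js
  let ?c = "- \<i> * complex_of_real (inverse (norm y))"
  let ?T = "\<lambda>js. \<Sum>k\<le>m. ?c * R k js"
  have step: "E k js - E (Suc k) js = complex_of_real (sgn y $ (js ! k)) * R k (take k js @ drop (Suc k) js)"
    if k: "k < Suc m" and l: "length js = Suc m" for k js
  proof -
    \<comment> \<open>Linearity in one slot, applied to e_i = P e_i + \<omega>_i \<omega>.\<close>
    have "mform (us @ axis i 1 # vs) F = mform (us @ perp_axis y i # vs) F
        + complex_of_real (sgn y $ i) * mform (us @ sgn y # vs) F" for us vs and i
    proof -
      have "mform (axis i 1 # vs) G = mform (perp_axis y i # vs) G
        + complex_of_real (sgn y $ i) * mform (sgn y # vs) G" for G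
        by (simp add: perp_axis_def sum_distrib_left algebra_simps flip: sum.distrib)
      then show ?thesis
        by (simp only: mform_append mform_add mform_mult_left)
    qed
    from this[of "map (perp_axis y) (take k js)" "js ! k" "map (\<lambda>i. axis i 1) (drop (Suc k) js)"]
    show ?thesis
      using k l by (simp add: E_def R_def take_Suc_conv_app_nth Cons_nth_drop_Suc[symmetric] min_def)
  qed
  have telescope: "F js = proj_perp y F js +
      (\<Sum>k\<le>m. \<i> * complex_of_real (y $ (js ! k)) * (?c * R k (take k js @ drop (Suc k) js)))"
    if l: "length js = Suc m" for js
  proof -
    have "E 0 js - E (Suc m) js = (\<Sum>k<Suc m. E k js - E (Suc k) js)"
      by (rule sum_lessThan_telescope'[symmetric])
    \<comment> \<open>The factor i y_j and the constant \<open>?c\<close> multiply to the component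
      of \<omega> = y / |y|.\<close>
    also have "\<dots> = (\<Sum>k\<le>m. \<i> * complex_of_real (y $ (js ! k)) * (?c * R k (take k js @ drop (Suc k) js)))"
      unfolding lessThan_Suc_atMost
      by (intro sum.cong refl) (simp add: step l sgn_div_norm divide_inverse mult_ac less_Suc_eq_le)
    finally show ?thesis
      using l by (simp add: E_def proj_perp_def mform_axis algebra_simps)
  qed
  have "F is = symmetrize F is"
    using symmetrize_eq_self sym len by metis
  also have "\<dots> = symmetrize (proj_perp y F) is + (\<Sum>k\<le>m. symmetrize
      (\<lambda>js. \<i> * complex_of_real (y $ (js ! k)) * (?c * R k (take k js @ drop (Suc k) js))) is)"
    using telescope len by (subst symmetrize_cong[of _ F, OF telescope]) (simp_all add: symmetrize_add symmetrize_sum)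
  also have "symmetrize (proj_perp y F) is = proj_perp y F is"
    using symmetrize_eq_self symmetric_proj_perp[OF sym] len by metis
  \<comment> \<open>The k-th term carries y in index k. Under symmetrization this index may be
    counted as the last, which is the shape of \<open>sym_mult\<close>.\<close>
  also have "(\<Sum>k\<le>m. symmetrize
      (\<lambda>js. \<i> * complex_of_real (y $ (js ! k)) * (?c * R k (take k js @ drop (Suc k) js))) is)
    = (\<Sum>k\<le>m. symmetrize (\<lambda>js. \<i> * complex_of_real (y $ last js) * (?c * R k (butlast js))) is)"
  proof (intro sum.cong refl)
    fix k assume "k \<in> {..m}"
    then have "k \<le> m" by simp
    from symmetrize_move_to_end[OF this len, of "\<lambda>js. \<i> * complex_of_real (y $ last js) * (?c * R k (butlast js))"]
    show "symmetrize (\<lambda>js. \<i> * complex_of_real (y $ (js ! k)) * (?c * R k (take k js @ drop (Suc k) js))) is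
      = symmetrize (\<lambda>js. \<i> * complex_of_real (y $ last js) * (?c * R k (butlast js))) is"
      by (simp only: last_snoc butlast_snoc)
  qed
  also have "\<dots> = symmetrize (\<lambda>js. \<i> * complex_of_real (y $ last js) * ?T (butlast js)) is"
    by (simp only: symmetrize_sum sum_distrib_left)
  also have "\<dots> = symmetrize (\<lambda>js. \<i> * complex_of_real (y $ last js) * symmetrize ?T (butlast js)) is"
    by (rule symmetrize_butlast_symmetrize[OF len, symmetric])
  also have "\<dots> = sym_mult y (potential y F) is"
    unfolding sym_mult_def potential_def using len
    by (intro symmetrize_cong arg_cong2[where f = "(*)"] refl) (simp add: R_def)
  finally show ?thesis .
qed

lemma mform_butlast:
  "mform (us @ [w]) (\<lambda>js. \<i> * complex_of_real (y $ last js) * T (butlast js))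
     = \<i> * complex_of_real (y \<bullet> w) * mform us T"
proof -
  have "mform (us @ [w]) (\<lambda>js. \<i> * complex_of_real (y $ last js) * T (butlast js))
     = mform us (\<lambda>is. (\<i> * complex_of_real (y \<bullet> w)) * T is)"
    by (simp add: mform_append inner_vec_def sum_distrib_left sum_distrib_right mult_ac)
  then show ?thesis by (simp add: mform_mult_left)
qed

text \<open>Every permuted term pairs y with one of the arguments, so each term vanishes by itself.
  This gives the sufficiency in the longitudinal case.\<close>

lemma mform_sym_mult_perp:
  assumes "\<And>v. v \<in> set vs \<Longrightarrow> y \<bullet> v = 0" and "vs \<noteq> []"
  shows "mform vs (sym_mult y T) = 0"
proof -
  have "mform (permute_list \<pi> vs) (\<lambda>js. \<i> * complex_of_real (y $ last js) * T (butlast js)) = 0"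
    if \<pi>: "\<pi> permutes {..<length vs}" for \<pi>
  proof -
    have ne: "permute_list \<pi> vs \<noteq> []" using assms(2) length_permute_list[of \<pi> vs] by (metis length_0_conv)
    then have "last (permute_list \<pi> vs) \<in> set vs"
      using set_permute_list[OF \<pi>] last_in_set by metis
    then show ?thesis
      using mform_butlast[of "butlast (permute_list \<pi> vs)" "last (permute_list \<pi> vs)" y T] assms(1) ne by simp
  qed
  then show ?thesis by (simp add: sym_mult_def mform_symmetrize)
qed

text \<open>With equal arguments all permuted terms coincide, so the average disappears and one
  factor \<open>y \<bullet> w\<close> splits off.\<close>

lemma mform_sym_mult_replicate:
  "mform (replicate (Suc m) w) (sym_mult y T) = \<i> * complex_of_real (y \<bullet> w) * mform (replicate m w) T"
proof -
  have "permute_list \<pi> (replicate (Suc m) w) = replicate m w @ [w]" if "\<pi> permutes {..<Suc m}" for \<pi>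
    using that permutes_in_image[OF that]
    by (intro nth_equalityI) (auto simp: permute_list_def nth_append simp del: replicate_Suc)
  then have "mform (replicate (Suc m) w) (sym_mult y T) = (1 / fact (Suc m)) *\<^sub>R
      (\<Sum>\<pi> | \<pi> permutes {..<Suc m}. \<i> * complex_of_real (y \<bullet> w) * mform (replicate m w) T)"
    unfolding sym_mult_def mform_symmetrize
    by (intro arg_cong2[where f = scaleR] sum.cong) (simp_all add: mform_butlast del: replicate_Suc)
  then show ?thesis
    by (simp add: card_permutations[OF refl] sum_constant_scaleR del: sum_constant fact_Suc)
qed

section \<open>Polar coordinates\<close>

lemma nn_integral_lborel_scaleR:
  fixes h :: "'a::euclidean_space \<Rightarrow> ennreal"
  assumes [measurable]: "h \<in> borel_measurable borel" and c: "c \<noteq> 0"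
  shows "(\<integral>\<^sup>+x. h x \<partial>lborel) = ennreal (\<bar>c\<bar> ^ DIM('a)) * (\<integral>\<^sup>+x. h (c *\<^sub>R x) \<partial>lborel)"
proof -
  have "(\<integral>\<^sup>+x. h x \<partial>lborel) = (\<integral>\<^sup>+x. h x \<partial>density (distr lborel borel (\<lambda>x. 0 + c *\<^sub>R x)) (\<lambda>_. \<bar>c ^ DIM('a)\<bar>))"
    by (subst lborel_affine[OF c, of 0]) (simp add: power_abs)
  also have "\<dots> = ennreal (\<bar>c\<bar> ^ DIM('a)) * (\<integral>\<^sup>+x. h (c *\<^sub>R x) \<partial>lborel)"
    by (simp add: nn_integral_density nn_integral_distr power_abs nn_integral_cmult)
  finally show ?thesis .
qed

lemma nn_integral_lborel_uminus:
  fixes h :: "'a::euclidean_space \<Rightarrow> ennreal"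
  assumes "h \<in> borel_measurable borel"
  shows "(\<integral>\<^sup>+x. h (- x) \<partial>lborel) = (\<integral>\<^sup>+x. h x \<partial>lborel)"
  using nn_integral_lborel_scaleR[OF assms, of "-1"] by simp

lemma nn_integral_lborel_translate:
  fixes h :: "'a::euclidean_space \<Rightarrow> ennreal"
  assumes [measurable]: "h \<in> borel_measurable borel"
  shows "(\<integral>\<^sup>+x. h (c + x) \<partial>lborel) = (\<integral>\<^sup>+x. h x \<partial>lborel)"
  by (subst (2) lborel_distr_plus[of c, symmetric]) (simp add: nn_integral_distr)

lemma nn_integral_powr_from_0:
  assumes "a > -1" "0 \<le> c"
  shows "(\<integral>\<^sup>+r. ennreal (r powr a) * indicator {0..c} r \<partial>lborel) = ennreal (c powr (a + 1) / (a + 1))"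
proof -
  have "((\<lambda>r. r powr a * indicator {0..c} r) has_integral (c powr (a + 1) / (a + 1))) UNIV"
    using has_integral_powr_from_0[OF assms] 
    by (subst (asm) has_integral_restrict_UNIV[symmetric])
       (simp add: indicator_def if_distrib of_bool_def cong: if_cong)
  then have "(\<integral>\<^sup>+r. ennreal (r powr a * indicator {0..c} r) \<partial>lborel) = ennreal (c powr (a + 1) / (a + 1))"
    by (intro nn_integral_has_integral_lborel) auto
  then show ?thesis by (simp add: ennreal_mult' ennreal_indicator)
qed

lemma nn_integral_powr_to_inf:
  assumes "e < -1" "0 < c"
  shows "(\<integral>\<^sup>+r. ennreal (r powr e) * indicator {c..} r \<partial>lborel) = ennreal (- (c powr (e + 1)) / (e + 1))"
proof -
  have "((\<lambda>r. r powr e * indicator {c..} r) has_integral (- (c powr (e + 1)) / (e + 1))) UNIV"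
    using has_integral_powr_to_inf[OF assms] 
    by (subst (asm) has_integral_restrict_UNIV[symmetric])
       (simp add: indicator_def if_distrib of_bool_def cong: if_cong)
  then have "(\<integral>\<^sup>+r. ennreal (r powr e * indicator {c..} r) \<partial>lborel) = ennreal (- (c powr (e + 1)) / (e + 1))"
    by (intro nn_integral_has_integral_lborel) auto
  then show ?thesis by (simp add: ennreal_mult' ennreal_indicator)
qed

section \<open>The sphere measure and integration in polar coordinates\<close>

lemma sets_sphere_measure [simp, measurable_cong]: "sets sphere_measure = sets borel"
  by (simp add: sphere_measure_def)

lemma space_sphere_measure [simp]: "space sphere_measure = UNIV"
  by (simp add: sphere_measure_def)

lemma borel_measurable_sgn_euclidean [measurable]:
  "sgn \<in> (borel :: 'a::euclidean_space measure) \<rightarrow>\<^sub>M borel"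
  unfolding sgn_div_norm[abs_def] by measurable

lemma borel_measurable_vec_nth_compose [measurable (raw)]:
  fixes f :: "'a \<Rightarrow> real^'n::finite"
  assumes [measurable]: "f \<in> borel_measurable M"
  shows "(\<lambda>x. f x $ j) \<in> borel_measurable M"
proof -
  have "(\<lambda>x. f x \<bullet> axis j 1) \<in> borel_measurable M" by measurable
  then show ?thesis by (simp add: inner_axis)
qed

lemma nn_integral_sphere_measure:
  fixes h :: "real^'n::finite \<Rightarrow> ennreal"
  assumes [measurable]: "h \<in> borel_measurable borel"
  shows "(\<integral>\<^sup>+\<omega>. h \<omega> \<partial>sphere_measure) =
    of_nat CARD('n) * (\<integral>\<^sup>+x. h (sgn x) * indicator (ball 0 1 - {0}) x \<partial>lborel)"
proof -
  have [measurable]: "ball 0 1 - {0 :: real^'n} \<in> sets borel" by (intro sets.Diff) auto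
  have "(\<integral>\<^sup>+\<omega>. h \<omega> \<partial>sphere_measure) =
      (\<integral>\<^sup>+x. of_nat CARD('n) * indicator (ball 0 1 - {0}) x * h (sgn x) \<partial>lborel)"
    unfolding sphere_measure_def by (simp add: nn_integral_distr) (subst nn_integral_density, measurable)
  also have "\<dots> = (\<integral>\<^sup>+x. of_nat CARD('n) * (h (sgn x) * indicator (ball 0 1 - {0}) x) \<partial>lborel)"
    by (simp add: mult_ac)
  also have "\<dots> = of_nat CARD('n) * (\<integral>\<^sup>+x. h (sgn x) * indicator (ball 0 1 - {0}) x \<partial>lborel)"
    by (rule nn_integral_cmult) measurable
  finally show ?thesis .
qed

lemma emeasure_sphere_measure_finite: "emeasure (sphere_measure :: (real^'n::finite) measure) UNIV < \<infinity>"
proof -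
  have eq: "emeasure (sphere_measure :: (real^'n) measure) UNIV = of_nat CARD('n) * emeasure lborel (ball 0 1 - {0} :: (real^'n) set)"
    using nn_integral_sphere_measure[of "\<lambda>_ :: real^'n. 1"] by simp
  have "emeasure lborel (ball 0 1 - {0} :: (real^'n) set) \<le> emeasure lborel (ball 0 1 :: (real^'n) set)"
    by (rule emeasure_mono) auto
  also have "\<dots> < \<infinity>" by (rule emeasure_bounded_finite) simp
  finally have "emeasure lborel (ball 0 1 - {0} :: (real^'n) set) < \<infinity>" .
  with eq show ?thesis by (simp add: ennreal_mult_less_top ennreal_of_nat_eq_real_of_nat)
qed

interpretation sphere: finite_measure "sphere_measure :: (real^'n::finite) measure"
  by standard (simp add: emeasure_sphere_measure_finite[THEN less_imp_neq, simplified])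

interpretation sphere_line: pair_sigma_finite "sphere_measure :: (real^'n::finite) measure" "lborel :: real measure" ..

lemma AE_sphere_measure_norm: "AE \<omega> in sphere_measure. norm \<omega> = 1"
proof -
  have "AE x in density lborel (\<lambda>x. of_nat CARD('n) * indicator (ball 0 1 - {0}) x). norm (sgn x :: real^'n) = 1"
    by (subst AE_density) (auto simp: norm_sgn indicator_def)
  then show ?thesis
    unfolding sphere_measure_def by (subst AE_distr_iff) auto
qed

text \<open>In \<open>n \<integral>\<^sub>B \<integral> r^(n-1) h(r x / |x|) dr dx\<close> substitute \<open>r = \<rho> |x|\<close> and then \<open>x = z / \<rho>\<close>; the integral over
  \<open>\<rho> > |z|\<close> that remains is \<open>\<integral> \<rho>^(-n-1) d\<rho> = |z|^(-n) / n\<close>.\<close>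

lemma nn_integral_polar:
  fixes h :: "real^'n::finite \<Rightarrow> ennreal"
  assumes [measurable]: "h \<in> borel_measurable borel"
  shows "(\<integral>\<^sup>+\<omega>. \<integral>\<^sup>+r. ennreal (r ^ (CARD('n) - 1)) * indicator {0<..} r * h (r *\<^sub>R \<omega>) \<partial>lborel \<partial>sphere_measure)
     = (\<integral>\<^sup>+x. h x \<partial>lborel)"
proof -
  let ?n = "CARD('n)"
  let ?B = "ball 0 1 - {0} :: (real^'n) set"
  let ?a = "\<lambda>\<rho> x. ennreal (\<rho> ^ (?n - 1)) * indicator {0<..} \<rho> * ennreal (norm x ^ ?n) * h (\<rho> *\<^sub>R x) * indicator ?B x"
  let ?b = "\<lambda>\<rho> z. ennreal (\<rho> powr (- real ?n - 1)) * indicator {norm z<..} \<rho> * (ennreal (norm z ^ ?n) * h z)"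
  have n: "?n > 0" by simp
  have [measurable]: "?B \<in> sets borel" by (intro sets.Diff) auto
  obtain k where k: "?n = Suc k" using n gr0_conv_Suc by blast
  have meas: "(\<lambda>\<omega>. \<integral>\<^sup>+r. ennreal (r ^ (?n - 1)) * indicator {0<..} r * h (r *\<^sub>R \<omega>) \<partial>lborel) \<in> borel_measurable borel"
    by measurable
  have A: "(\<integral>\<^sup>+r. ennreal (r ^ (?n - 1)) * indicator {0<..} r * h (r *\<^sub>R sgn x) \<partial>lborel) * indicator ?B x
     = (\<integral>\<^sup>+\<rho>. ?a \<rho> x \<partial>lborel)" for x
  proof (cases "x = 0")
    case False
    then have nx: "norm x > 0" by simp
    have "(\<integral>\<^sup>+r. ennreal (r ^ (?n - 1)) * indicator {0<..} r * h (r *\<^sub>R sgn x) \<partial>lborel)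
       = ennreal (norm x) * (\<integral>\<^sup>+\<rho>. ennreal ((norm x *\<^sub>R \<rho>) ^ (?n - 1)) * indicator {0<..} (norm x *\<^sub>R \<rho>) * h ((norm x *\<^sub>R \<rho>) *\<^sub>R sgn x) \<partial>lborel)"
      using nn_integral_lborel_scaleR[of "\<lambda>r. ennreal (r ^ (?n - 1)) * indicator {0<..} r * h (r *\<^sub>R sgn x)" "norm x"] nx by simp
    also have "\<dots> = (\<integral>\<^sup>+\<rho>. ennreal (norm x) * (ennreal ((norm x *\<^sub>R \<rho>) ^ (?n - 1)) * indicator {0<..} (norm x *\<^sub>R \<rho>) * h ((norm x *\<^sub>R \<rho>) *\<^sub>R sgn x)) \<partial>lborel)"
      by (simp add: nn_integral_cmult)
    also have "\<dots> = (\<integral>\<^sup>+\<rho>. ennreal (\<rho> ^ (?n - 1)) * indicator {0<..} \<rho> * ennreal (norm x ^ ?n) * h (\<rho> *\<^sub>R x) \<partial>lborel)"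
    proof (intro nn_integral_cong)
      fix \<rho> :: real
      have e: "norm x * (norm x * \<rho>) ^ (?n - 1) = \<rho> ^ (?n - 1) * norm x ^ ?n"
        by (simp add: k power_mult_distrib)
      have v: "(norm x *\<^sub>R \<rho>) *\<^sub>R sgn x = \<rho> *\<^sub>R x"
        using nx by (simp add: sgn_div_norm)
      show "ennreal (norm x) * (ennreal ((norm x *\<^sub>R \<rho>) ^ (?n - 1)) * indicator {0<..} (norm x *\<^sub>R \<rho>) * h ((norm x *\<^sub>R \<rho>) *\<^sub>R sgn x))
         = ennreal (\<rho> ^ (?n - 1)) * indicator {0<..} \<rho> * ennreal (norm x ^ ?n) * h (\<rho> *\<^sub>R x)"
      proof (cases "\<rho> > 0")
        case True
        have "ennreal (norm x) * ennreal ((norm x * \<rho>) ^ (?n - 1)) = ennreal (norm x * (norm x * \<rho>) ^ (?n - 1))"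
          using True by (intro ennreal_mult[symmetric]) auto
        also have "\<dots> = ennreal (\<rho> ^ (?n - 1)) * ennreal (norm x ^ ?n)"
          unfolding e using True by (intro ennreal_mult) auto
        finally show ?thesis
          using True nx v by (simp add: mult.assoc[symmetric] del: One_nat_def)
      qed (use nx in \<open>simp add: zero_less_mult_iff\<close>)
    qed
    finally show ?thesis by (simp add: nn_integral_multc)
  qed simp
  have B: "(\<integral>\<^sup>+x. ?a \<rho> x \<partial>lborel)
     = (\<integral>\<^sup>+z. ?b \<rho> z \<partial>lborel)" for \<rho> :: real
  proof (cases "\<rho> > 0")
    case True
    have "(\<integral>\<^sup>+x. ?a \<rho> x \<partial>lborel)
       = ennreal (inverse \<rho> ^ ?n) * (\<integral>\<^sup>+z. ennreal (\<rho> ^ (?n - 1)) * indicator {0<..} \<rho> * ennreal (norm (inverse \<rho> *\<^sub>R z) ^ ?n) * h (\<rho> *\<^sub>R (inverse \<rho> *\<^sub>R z)) * indicator ?B (inverse \<rho> *\<^sub>R z) \<partial>lborel)"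
      using nn_integral_lborel_scaleR[of "\<lambda>x. ?a \<rho> x" "inverse \<rho>"] True
      by simp
    also have "\<dots> = (\<integral>\<^sup>+z. ennreal (inverse \<rho> ^ ?n) * (ennreal (\<rho> ^ (?n - 1)) * indicator {0<..} \<rho> * ennreal (norm (inverse \<rho> *\<^sub>R z) ^ ?n) * h (\<rho> *\<^sub>R (inverse \<rho> *\<^sub>R z)) * indicator ?B (inverse \<rho> *\<^sub>R z)) \<partial>lborel)"
      by (simp add: nn_integral_cmult)
    also have "\<dots> = (\<integral>\<^sup>+z. ?b \<rho> z \<partial>lborel)"
    proof (intro nn_integral_cong)
      fix z :: "real^'n"
      \<comment> \<open>Exponents of \<rho>: n - 1 from the radial density, -n from the Jacobian of
        x = z / \<rho> and -n from |x|^n, together -n - 1.\<close>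
      have e: "inverse \<rho> ^ ?n * (\<rho> ^ (?n - 1) * norm (inverse \<rho> *\<^sub>R z) ^ ?n) = \<rho> powr (- real ?n - 1) * norm z ^ ?n"
      proof -
        have "\<rho> ^ ?n = \<rho> ^ (?n - 1) * \<rho>" by (simp add: k)
        then have "\<rho> ^ (?n - 1) * inverse \<rho> ^ ?n = inverse \<rho>" 
          using True by (simp add: power_inverse field_simps)
        moreover have "\<rho> powr (- real ?n - 1) = inverse \<rho> ^ ?n * inverse \<rho>"
          using True by (simp add: powr_diff powr_minus powr_realpow power_inverse divide_inverse)
        ultimately show ?thesis
          using True by (simp add: power_mult_distrib mult_ac)
      qed
      \<comment> \<open>The condition |x| < 1 turns into |z| < \<rho>, the lower limit of the
        remaining integral.\<close>
      have i: "indicator ?B (inverse \<rho> *\<^sub>R z) = (if z = 0 then 0 else indicator {norm z<..} \<rho> :: ennreal)"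
        using True by (auto simp: indicator_def field_simps)
      show "ennreal (inverse \<rho> ^ ?n) * (ennreal (\<rho> ^ (?n - 1)) * indicator {0<..} \<rho> * ennreal (norm (inverse \<rho> *\<^sub>R z) ^ ?n) * h (\<rho> *\<^sub>R (inverse \<rho> *\<^sub>R z)) * indicator ?B (inverse \<rho> *\<^sub>R z))
        = ?b \<rho> z"
      proof (cases "z = 0")
        case False
        have "ennreal (inverse \<rho> ^ ?n) * (ennreal (\<rho> ^ (?n - 1)) * ennreal (norm (inverse \<rho> *\<^sub>R z) ^ ?n))
            = ennreal (inverse \<rho> ^ ?n * (\<rho> ^ (?n - 1) * norm (inverse \<rho> *\<^sub>R z) ^ ?n))"
          using True by (simp add: ennreal_mult del: norm_scaleR One_nat_def)
        also have "\<dots> = ennreal (\<rho> powr (- real ?n - 1)) * ennreal (norm z ^ ?n)"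
          unfolding e by (intro ennreal_mult) auto
        finally have "ennreal (inverse \<rho> ^ ?n) * (ennreal (\<rho> ^ (?n - 1)) * ennreal (norm (inverse \<rho> *\<^sub>R z) ^ ?n))
            = ennreal (\<rho> powr (- real ?n - 1)) * ennreal (norm z ^ ?n)" .
        moreover have "ennreal (inverse \<rho> ^ ?n) * (ennreal (\<rho> ^ (?n - 1)) * indicator {0<..} \<rho> * ennreal (norm (inverse \<rho> *\<^sub>R z) ^ ?n) * h (\<rho> *\<^sub>R (inverse \<rho> *\<^sub>R z)) * indicator ?B (inverse \<rho> *\<^sub>R z))
          = (ennreal (inverse \<rho> ^ ?n) * (ennreal (\<rho> ^ (?n - 1)) * ennreal (norm (inverse \<rho> *\<^sub>R z) ^ ?n))) * (h z * indicator {norm z<..} \<rho>)"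
          using True False unfolding i by (simp add: mult.assoc del: norm_scaleR)
        ultimately show ?thesis
          by (simp only: mult_ac)
      qed (use i in simp)
    qed
    finally show ?thesis .
  next
    case False
    then have "indicator {norm z<..} \<rho> = (0::ennreal)" for z :: "real^'n"
      using norm_ge_zero[of z] by (auto simp: indicator_def simp del: norm_ge_zero)
    then show ?thesis using False by simp
  qed
  have C: "(\<integral>\<^sup>+\<rho>. ?b \<rho> z \<partial>lborel)
     = ennreal (1 / real ?n) * h z" if "z \<noteq> 0" for z :: "real^'n"
  proof -
    have nz: "norm z > 0" using that by simp
    have "(\<integral>\<^sup>+\<rho>. ennreal (\<rho> powr (- real ?n - 1)) * indicator {norm z<..} \<rho> \<partial>lborel)
       = (\<integral>\<^sup>+\<rho>. ennreal (\<rho> powr (- real ?n - 1)) * indicator {norm z..} \<rho> \<partial>lborel)"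
      by (intro nn_integral_cong_AE, use AE_lborel_singleton[of "norm z"] in eventually_elim)
         (auto simp: indicator_def)
    also have "\<dots> = ennreal (norm z powr (- real ?n) / real ?n)"
      using nn_integral_powr_to_inf[of "- real ?n - 1" "norm z"] n nz by (simp add: field_simps)
    finally have eq: "(\<integral>\<^sup>+\<rho>. ennreal (\<rho> powr (- real ?n - 1)) * indicator {norm z<..} \<rho> \<partial>lborel) = ennreal (norm z powr (- real ?n) / real ?n)" .
    have "(\<integral>\<^sup>+\<rho>. ?b \<rho> z \<partial>lborel)
       = ennreal (norm z powr (- real ?n) / real ?n) * ennreal (norm z ^ ?n) * h z"
      by (subst nn_integral_multc) (simp_all only: eq mult.assoc, measurable)
    also have "ennreal (norm z powr (- real ?n) / real ?n) * ennreal (norm z ^ ?n) = ennreal (1 / real ?n)"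
      using nz by (subst ennreal_mult[symmetric]) (simp_all add: powr_minus powr_realpow)
    finally show ?thesis .
  qed
  have "(\<integral>\<^sup>+\<omega>. \<integral>\<^sup>+r. ennreal (r ^ (?n - 1)) * indicator {0<..} r * h (r *\<^sub>R \<omega>) \<partial>lborel \<partial>sphere_measure)
    = of_nat ?n * (\<integral>\<^sup>+x. \<integral>\<^sup>+\<rho>. ?a \<rho> x \<partial>lborel \<partial>lborel)"
    by (simp only: nn_integral_sphere_measure[OF meas] A)
  also have "(\<integral>\<^sup>+x. \<integral>\<^sup>+\<rho>. ?a \<rho> x \<partial>lborel \<partial>lborel)
    = (\<integral>\<^sup>+\<rho>. \<integral>\<^sup>+x. ?a \<rho> x \<partial>lborel \<partial>lborel)"
    by (rule lborel_pair.Fubini') measurable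
  also have "\<dots> = (\<integral>\<^sup>+\<rho>. \<integral>\<^sup>+z. ?b \<rho> z \<partial>lborel \<partial>lborel)"
    by (simp only: B)
  also have "\<dots> = (\<integral>\<^sup>+z. \<integral>\<^sup>+\<rho>. ?b \<rho> z \<partial>lborel \<partial>lborel)"
    unfolding indicator_def greaterThan_iff by (rule lborel_pair.Fubini') measurable
  also have "\<dots> = (\<integral>\<^sup>+z. ennreal (1 / real ?n) * h z \<partial>lborel)"
    by (intro nn_integral_cong_AE, use AE_lborel_singleton[of 0] in eventually_elim) (rule C)
  \<comment> \<open>The factor n of the cone measure cancels the 1 / n of the radial
    integral.\<close>
  also have "of_nat ?n * \<dots> = (\<integral>\<^sup>+z. h z \<partial>lborel)"
  proof -
    have "of_nat ?n * ennreal (1 / real ?n) = 1"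
      unfolding ennreal_of_nat_eq_real_of_nat using n by (subst ennreal_mult[symmetric]) simp_all
    then show ?thesis by (simp add: nn_integral_cmult mult.assoc[symmetric])
  qed
  finally show ?thesis .
qed

text \<open>The factor 2 arises since (\<omega>, \<sigma>) and (-\<omega>, -\<sigma>) give the same
  point. The half-line \<sigma> < 0 contributes the integral of the reflected function, which equals
  that of h.\<close>

lemma nn_integral_polar_line:
  fixes h :: "real^'n::finite \<Rightarrow> ennreal"
  assumes [measurable]: "h \<in> borel_measurable borel"
  shows "(\<integral>\<^sup>+(\<omega>, \<sigma>). ennreal (\<bar>\<sigma>\<bar> ^ (CARD('n) - 1)) * h (\<sigma> *\<^sub>R \<omega>) \<partial>(sphere_measure \<Otimes>\<^sub>M lborel))
     = 2 * (\<integral>\<^sup>+x. h x \<partial>lborel)"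
proof -
  let ?k = "CARD('n) - 1"
  have "(\<integral>\<^sup>+\<sigma>. ennreal (\<bar>\<sigma>\<bar> ^ ?k) * h (\<sigma> *\<^sub>R \<omega>) \<partial>lborel) =
     (\<integral>\<^sup>+r. ennreal (r ^ ?k) * indicator {0<..} r * h (r *\<^sub>R \<omega>) \<partial>lborel) +
     (\<integral>\<^sup>+r. ennreal (r ^ ?k) * indicator {0<..} r * h (- (r *\<^sub>R \<omega>)) \<partial>lborel)" for \<omega>
  proof -
    have "(\<integral>\<^sup>+r. ennreal (r ^ ?k) * indicator {0<..} r * h (- (r *\<^sub>R \<omega>)) \<partial>lborel)
      = (\<integral>\<^sup>+r. ennreal ((- r) ^ ?k) * indicator {0<..} (- r) * h (r *\<^sub>R \<omega>) \<partial>lborel)"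
      using nn_integral_lborel_uminus[of "\<lambda>r. ennreal ((- r) ^ ?k) * indicator {0<..} (- r) * h (r *\<^sub>R \<omega>)"]
      by simp
    moreover have "(\<integral>\<^sup>+\<sigma>. ennreal (\<bar>\<sigma>\<bar> ^ ?k) * h (\<sigma> *\<^sub>R \<omega>) \<partial>lborel) =
       (\<integral>\<^sup>+r. ennreal (r ^ ?k) * indicator {0<..} r * h (r *\<^sub>R \<omega>) +
          ennreal ((- r) ^ ?k) * indicator {0<..} (- r) * h (r *\<^sub>R \<omega>) \<partial>lborel)"
      by (intro nn_integral_cong_AE, use AE_lborel_singleton[of 0] in eventually_elim)
         (auto simp: indicator_def abs_if)
    ultimately show ?thesis by (simp add: nn_integral_add)
  qed
  then have "(\<integral>\<^sup>+\<omega>. \<integral>\<^sup>+\<sigma>. ennreal (\<bar>\<sigma>\<bar> ^ ?k) * h (\<sigma> *\<^sub>R \<omega>) \<partial>lborel \<partial>sphere_measure) =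
     (\<integral>\<^sup>+x. h x \<partial>lborel) + (\<integral>\<^sup>+x. h (- x) \<partial>lborel)"
    using nn_integral_polar[of h] nn_integral_polar[of "\<lambda>x. h (- x)"] by (simp add: nn_integral_add)
  also have "\<dots> = 2 * (\<integral>\<^sup>+x. h x \<partial>lborel)"
    by (simp add: nn_integral_lborel_uminus mult_2)
  finally show ?thesis
    by (subst lborel.nn_integral_fst[symmetric]) (simp_all add: case_prod_unfold)
qed

text \<open>The preimage of a null set has integral 0 against |\<sigma>|^(n-1), and this density
  vanishes only on the null set \<sigma> = 0.\<close>

lemma AE_cylinder_of_AE:
  fixes P :: "real^'n::finite \<Rightarrow> bool"
  assumes n: "CARD('n) \<ge> 2" and "AE y in lborel. P y"
  shows "AE (\<omega>, \<sigma>) in sphere_measure \<Otimes>\<^sub>M lborel. P (\<sigma> *\<^sub>R \<omega>)"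
proof -
  obtain N where N: "{y. \<not> P y} \<subseteq> N" "emeasure lborel N = 0" "N \<in> sets lborel"
    using assms(2) by (auto elim: AE_E)
  have [measurable]: "N \<in> sets borel" using N by simp
  have "(\<integral>\<^sup>+(\<omega>, \<sigma>). ennreal (\<bar>\<sigma>\<bar> ^ (CARD('n) - 1)) * indicator N (\<sigma> *\<^sub>R \<omega>) \<partial>(sphere_measure \<Otimes>\<^sub>M lborel)) = 0"
    using nn_integral_polar_line[of "indicator N"] N by simp
  then have ae: "AE (\<omega>, \<sigma>) in sphere_measure \<Otimes>\<^sub>M lborel. ennreal (\<bar>\<sigma>\<bar> ^ (CARD('n) - 1)) * indicator N (\<sigma> *\<^sub>R \<omega>) = 0"
    by (subst (asm) nn_integral_0_iff_AE) (auto simp: case_prod_unfold)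
  have "AE (\<omega>, \<sigma>) in sphere_measure \<Otimes>\<^sub>M lborel. \<sigma> \<noteq> (0::real)"
  proof -
    have "{x \<in> space (sphere_measure \<Otimes>\<^sub>M lborel). snd x \<noteq> (0::real)} \<in> sets (sphere_measure \<Otimes>\<^sub>M lborel)"
      by measurable
    then show ?thesis
      unfolding case_prod_unfold by (rule sphere_line.AE_pair_measure) (simp add: AE_lborel_singleton)
  qed
  with ae show ?thesis
  proof eventually_elim
    case (elim x)
    then show ?case using N(1) n by (auto simp: case_prod_unfold indicator_def split: if_splits)
  qed
qed

text \<open>Here the half-line \<sigma> > 0 suffices: on it (\<omega>, \<sigma>) is recovered from y
  = \<sigma>\<omega> as (sgn y, |y|), so the exceptional set on the cylinder pulls back to a set in
  the space.\<close>

lemma AE_of_AE_cylinder: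
  fixes P :: "real^'n::finite \<Rightarrow> bool"
  assumes "AE (\<omega>, \<sigma>) in sphere_measure \<Otimes>\<^sub>M lborel. P (\<sigma> *\<^sub>R \<omega>)"
  shows "AE y in lborel. P y"
proof -
  obtain N where N: "{x. \<not> P (snd x *\<^sub>R fst x)} \<subseteq> N" "emeasure (sphere_measure \<Otimes>\<^sub>M lborel) N = 0"
      "N \<in> sets (sphere_measure \<Otimes>\<^sub>M lborel)"
    using assms by (auto elim!: AE_E simp: case_prod_unfold space_pair_measure)
  have [measurable]: "N \<in> sets (borel \<Otimes>\<^sub>M borel)" 
    using N(3) by (simp cong: sets_pair_measure_cong)
  define h :: "real^'n \<Rightarrow> ennreal" where "h y = indicator N (sgn y, norm y)" for y
  have [measurable]: "h \<in> borel_measurable borel" unfolding h_def by measurable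
  have "AE x in sphere_measure \<Otimes>\<^sub>M lborel. x \<notin> N"
    using N(2,3) by (intro AE_not_in) auto
  then have ae: "AE \<omega> in sphere_measure. AE r in lborel. (\<omega>, r) \<notin> N"
    by (rule sphere_line.AE_pair)
  have "(\<integral>\<^sup>+x. h x \<partial>lborel) = (\<integral>\<^sup>+\<omega>. \<integral>\<^sup>+r. ennreal (r ^ (CARD('n) - 1)) * indicator {0<..} r * h (r *\<^sub>R \<omega>) \<partial>lborel \<partial>sphere_measure)"
    by (rule nn_integral_polar[symmetric]) measurable
  also have "\<dots> = (\<integral>\<^sup>+\<omega>. 0 \<partial>(sphere_measure :: (real^'n) measure))"
  proof (intro nn_integral_cong_AE, use ae AE_sphere_measure_norm in eventually_elim)
    case (elim \<omega>)
    have "(\<integral>\<^sup>+r. ennreal (r ^ (CARD('n) - 1)) * indicator {0<..} r * h (r *\<^sub>R \<omega>) \<partial>lborel) = (\<integral>\<^sup>+r. 0 \<partial>(lborel :: real measure))"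
    proof (intro nn_integral_cong_AE, use elim(1) in eventually_elim)
      case (elim r)
      then show ?case
        using \<open>norm \<omega> = 1\<close> by (auto simp: h_def indicator_def sgn_div_norm)
    qed
    then show ?case by simp
  qed
  finally have "(\<integral>\<^sup>+x. h x \<partial>lborel) = 0" by simp
  then have "AE x in lborel. h x = 0"
    by (subst (asm) nn_integral_0_iff_AE) auto
  with AE_lborel_singleton[of "0 :: real^'n"] show ?thesis
  proof eventually_elim
    case (elim y)
    show ?case
    proof (rule ccontr)
      assume "\<not> P y"
      moreover have "norm y *\<^sub>R sgn y = y" using elim by (simp add: sgn_div_norm)
      ultimately have "(sgn y, norm y) \<in> N" using N(1) by auto
      then show False using elim by (simp add: h_def)
    qed
  qed
qed

section \<open>Schwartz functions\<close>

text \<open>Split at |y| = 1. The radial integrand is bounded by a multiple of r^(2t + n - 1) near 0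
  and by r^(2s + n - 1) at infinity; the two hypotheses say that these are integrable at the
  respective ends.\<close>

lemma nn_integral_sobolev_weight_finite:
  assumes "t > - real CARD('n::finite) / 2" and "2 * (s - t) + 2 * t + real CARD('n) < 0"
  shows "(\<integral>\<^sup>+y. ennreal (norm (y::real^'n) powr (2 * t) * (1 + (norm y)\<^sup>2) powr (s - t)) \<partial>lborel) < \<infinity>"
proof -
  let ?n = "real CARD('n)"
  let ?k = "CARD('n) - 1"
  have n: "real ?k = ?n - 1" by (simp add: of_nat_diff)
  define I where "I = (\<integral>\<^sup>+r. ennreal (r ^ ?k) * indicator {0<..} r * ennreal (r powr (2 * t) * (1 + r\<^sup>2) powr (s - t)) \<partial>lborel)"
  \<comment> \<open>A bound for \<open>(1 + r\<^sup>2) powr (s - t)\<close> on the unit interval,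
    where the base lies between 1 and 2.\<close>
  define c where "c = max 1 (2 powr (s - t))"
  have bound: "ennreal (r ^ ?k) * indicator {0<..} r * ennreal (r powr (2 * t) * (1 + r\<^sup>2) powr (s - t))
     \<le> ennreal c * (ennreal (r powr (2 * t + (?n - 1))) * indicator {0..1} r) +
       ennreal (r powr (2 * s + (?n - 1))) * indicator {1..} r" for r :: real
  proof (cases "r > 0")
    case True
    then have e: "ennreal (r ^ ?k) * ennreal (r powr (2 * t) * (1 + r\<^sup>2) powr (s - t))
        = ennreal (r powr (2 * t + (?n - 1)) * (1 + r\<^sup>2) powr (s - t))"
      by (subst ennreal_mult[symmetric]) (simp_all add: powr_add n[symmetric] powr_realpow mult_ac del: One_nat_def)
    show ?thesis
    proof (cases "r \<ge> 1")
      case True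
      have "s < t" using assms by simp
      have "(1 + r\<^sup>2) powr (s - t) \<le> (r\<^sup>2) powr (s - t)"
        using \<open>s < t\<close> True by (intro powr_mono2') auto
      also have "\<dots> = r powr (2 * (s - t))"
        using True by (simp add: powr_powr flip: powr_numeral)
      finally have "r powr (2 * t + (?n - 1)) * (1 + r\<^sup>2) powr (s - t) \<le> r powr (2 * t + (?n - 1)) * r powr (2 * (s - t))"
        by (intro mult_left_mono) auto
      also have "\<dots> = r powr (2 * s + (?n - 1))"
        by (simp add: algebra_simps flip: powr_add)
      finally have "ennreal (r powr (2 * t + (?n - 1)) * (1 + r\<^sup>2) powr (s - t)) \<le> ennreal (r powr (2 * s + (?n - 1)))"
        by (rule ennreal_leI)
      then show ?thesis
        using True e by (auto simp: indicator_def intro: add_increasing)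
    next
      case False
      have "(1 + r\<^sup>2) powr (s - t) \<le> c"
      proof (cases "s \<ge> t")
        case True
        have "r\<^sup>2 \<le> 1" using False \<open>r > 0\<close> by (simp add: power_le_one)
        then have "(1 + r\<^sup>2) powr (s - t) \<le> 2 powr (s - t)"
          using True by (intro powr_mono2) auto
        then show ?thesis by (simp add: c_def)
      next
        case False
        then have "(1 + r\<^sup>2) powr (s - t) \<le> 1 powr (s - t)"
          by (intro powr_mono2') auto
        then show ?thesis by (simp add: c_def)
      qed
      then have "ennreal (r powr (2 * t + (?n - 1)) * (1 + r\<^sup>2) powr (s - t)) \<le> ennreal (r powr (2 * t + (?n - 1)) * c)"
        by (intro ennreal_leI mult_left_mono) auto
      also have "\<dots> = ennreal c * ennreal (r powr (2 * t + (?n - 1)))"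
        by (subst mult.commute, rule ennreal_mult) (auto simp: c_def)
      finally show ?thesis using False True e by (simp add: indicator_def)
    qed
  qed (simp add: indicator_def)
  have "I \<le> (\<integral>\<^sup>+r. ennreal c * (ennreal (r powr (2 * t + (?n - 1))) * indicator {0..1} r) +
       ennreal (r powr (2 * s + (?n - 1))) * indicator {1..} r \<partial>lborel)"
    unfolding I_def by (intro nn_integral_mono) (rule bound)
  also have "\<dots> = ennreal c * (\<integral>\<^sup>+r. ennreal (r powr (2 * t + (?n - 1))) * indicator {0..1} r \<partial>lborel)
      + (\<integral>\<^sup>+r. ennreal (r powr (2 * s + (?n - 1))) * indicator {1..} r \<partial>lborel)"
    by (simp add: nn_integral_add nn_integral_cmult)
  also have "\<dots> < \<infinity>"
    using assms by (subst nn_integral_powr_from_0, simp_all, subst nn_integral_powr_to_inf)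
      (simp_all add: ennreal_mult_less_top)
  finally have I: "I < \<infinity>" .
  have "(\<integral>\<^sup>+y. ennreal (norm (y::real^'n) powr (2 * t) * (1 + (norm y)\<^sup>2) powr (s - t)) \<partial>lborel)
     = (\<integral>\<^sup>+\<omega>. \<integral>\<^sup>+r. ennreal (r ^ ?k) * indicator {0<..} r * ennreal (norm (r *\<^sub>R \<omega> :: real^'n) powr (2 * t) * (1 + (norm (r *\<^sub>R \<omega>))\<^sup>2) powr (s - t)) \<partial>lborel \<partial>sphere_measure)"
    by (rule nn_integral_polar[symmetric]) measurable
  also have "\<dots> = (\<integral>\<^sup>+\<omega>. I \<partial>(sphere_measure :: (real^'n) measure))"
    unfolding I_def
    by (intro nn_integral_cong_AE, use AE_sphere_measure_norm in eventually_elim)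
       (auto intro!: nn_integral_cong simp: indicator_def)
  also have "\<dots> < \<infinity>"
    using I emeasure_sphere_measure_finite[where 'n='n] by (simp add: ennreal_mult_less_top)
  finally show ?thesis .
qed

section \<open>Integrability of Schwartz functions and decay of their transforms\<close>

lemma differentiable_imp_borel_measurable:
  fixes \<phi> :: "real^'n::finite \<Rightarrow> complex"
  assumes "\<And>x. \<phi> differentiable (at x)"
  shows "\<phi> \<in> borel_measurable borel"
proof -
  have "continuous_on UNIV \<phi>"
    using assms by (simp add: continuous_on_eq_continuous_at differentiable_imp_continuous_within)
  then show ?thesis by (rule borel_measurable_continuous_onI)
qed

lemma schwartz_foldr_partial: "schwartz \<phi> \<Longrightarrow> schwartz (foldr partial js \<phi>)"
  unfolding schwartz_def by (metis foldr_append comp_apply)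

lemma schwartz_partial: "schwartz \<phi> \<Longrightarrow> schwartz (partial j \<phi>)"
  using schwartz_foldr_partial[of \<phi> "[j]"] by simp

lemma schwartz_differentiable: "schwartz \<phi> \<Longrightarrow> \<phi> differentiable (at x)"
  unfolding schwartz_def by (metis foldr_Nil id_apply)

lemma schwartz_measurable [measurable_dest]: "schwartz \<phi> \<Longrightarrow> \<phi> \<in> borel_measurable borel"
  by (rule differentiable_imp_borel_measurable) (rule schwartz_differentiable)

lemma schwartz_bound:
  assumes "schwartz \<phi>"
  obtains C where "C \<ge> 0" "\<And>x. norm x ^ k * norm (\<phi> x) \<le> C"
proof -
  have "bounded (range (\<lambda>x. norm x ^ k *\<^sub>R foldr partial [] \<phi> x))"
    using assms unfolding schwartz_def by blast
  then obtain C where "\<And>x. norm (norm x ^ k *\<^sub>R \<phi> x) \<le> C"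
    unfolding bounded_iff by auto
  then have "norm x ^ k * norm (\<phi> x) \<le> max C 0" for x
    by (simp add: le_max_iff_disj)
  then show ?thesis using that[of "max C 0"] by simp
qed

lemma schwartz_integrable:
  fixes \<phi> :: "real^'n::finite \<Rightarrow> complex"
  assumes \<phi>: "schwartz \<phi>"
  shows "integrable lborel \<phi>"
proof (rule integrableI_bounded)
  \<comment> \<open>(1 + |x|^2)^(-N) is the weight with t = 0 and s = -N, and for N = n + 1 it
    satisfies 2s + n < 0, so it is integrable.\<close>
  let ?N = "CARD('n) + 1"
  obtain A where A: "A \<ge> 0" "\<And>x. norm x ^ 0 * norm (\<phi> x) \<le> A" using schwartz_bound[OF \<phi>, where k = 0] by blast
  obtain B where B: "B \<ge> 0" "\<And>x. norm x ^ (2 * ?N) * norm (\<phi> x) \<le> B" using schwartz_bound[OF \<phi>, where k = "2 * ?N"] by blast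
  define C where "C = 2 ^ ?N * (A + B)"
  have C: "C \<ge> 0" using A B by (simp add: C_def)
  have bound: "norm (\<phi> x) \<le> C * (norm x powr (2 * 0) * (1 + (norm x)\<^sup>2) powr (- real ?N - 0))" if "x \<noteq> 0" for x
  proof -
    have "(1 + (norm x)\<^sup>2) ^ ?N \<le> 2 ^ ?N * (1 + norm x ^ (2 * ?N))"
    proof (cases "norm x \<le> 1")
      case True
      then have "(1 + (norm x)\<^sup>2) ^ ?N \<le> 2 ^ ?N"
        by (intro power_mono) (auto simp: power_le_one)
      also have "\<dots> \<le> 2 ^ ?N * (1 + norm x ^ (2 * ?N))" by simp
      finally show ?thesis .
    next
      case False
      then have "(1 + (norm x)\<^sup>2) ^ ?N \<le> (2 * (norm x)\<^sup>2) ^ ?N"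
        by (intro power_mono) auto
      also have "\<dots> = 2 ^ ?N * norm x ^ (2 * ?N)" by (simp only: power_mult_distrib power_mult)
      also have "\<dots> \<le> 2 ^ ?N * (1 + norm x ^ (2 * ?N))" by simp
      finally show ?thesis .
    qed
    then have "(1 + (norm x)\<^sup>2) ^ ?N * norm (\<phi> x) \<le> 2 ^ ?N * (1 + norm x ^ (2 * ?N)) * norm (\<phi> x)"
      by (rule mult_right_mono) simp
    also have "\<dots> = 2 ^ ?N * (norm (\<phi> x) + norm x ^ (2 * ?N) * norm (\<phi> x))"
      by (simp only: ring_distribs mult.assoc mult_1)
    also have "\<dots> \<le> C"
      unfolding C_def using A(2)[of x] B(2)[of x] by (intro mult_left_mono add_mono) auto
    finally have le: "(1 + (norm x)\<^sup>2) ^ ?N * norm (\<phi> x) \<le> C" .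
    have p: "1 + (norm x)\<^sup>2 > 0" by (simp add: add_pos_nonneg)
    then have "norm (\<phi> x) \<le> C * inverse ((1 + (norm x)\<^sup>2) ^ ?N)"
      using le by (simp add: divide_inverse[symmetric] pos_le_divide_eq mult.commute del: power_Suc)
    also have "inverse ((1 + (norm x)\<^sup>2) ^ ?N) = (1 + (norm x)\<^sup>2) powr (- real ?N)"
      using p by (subst powr_minus, subst powr_realpow) auto
    finally show ?thesis using that by simp
  qed
  have "(\<integral>\<^sup>+x. norm (\<phi> x) \<partial>lborel) \<le> (\<integral>\<^sup>+x. ennreal C * ennreal (norm (x::real^'n) powr (2 * 0) * (1 + (norm x)\<^sup>2) powr (- real ?N - 0)) \<partial>lborel)"
  proof (intro nn_integral_mono_AE, use AE_lborel_singleton[of "0::real^'n"] in eventually_elim)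
    case (elim x)
    show ?case
      using ennreal_leI[OF bound[OF elim]] C by (subst (asm) ennreal_mult) auto
  qed
  also have "\<dots> = ennreal C * (\<integral>\<^sup>+x. ennreal (norm (x::real^'n) powr (2 * 0) * (1 + (norm x)\<^sup>2) powr (- real ?N - 0)) \<partial>lborel)"
    by (rule nn_integral_cmult) measurable
  also have "\<dots> < \<infinity>"
    using nn_integral_sobolev_weight_finite[where 'n='n, of 0 "- real ?N"] by (simp add: ennreal_mult_less_top)
  finally show "(\<integral>\<^sup>+x. norm (\<phi> x) \<partial>lborel) < \<infinity>" .
qed (use \<phi> in measurable)

lemma has_vector_derivative_line:
  fixes \<psi> :: "real^'n::finite \<Rightarrow> complex"
  assumes "\<psi> differentiable (at (x + s *\<^sub>R axis j 1))"
  shows "((\<lambda>s. \<psi> (x + s *\<^sub>R axis j 1)) has_vector_derivative partial j \<psi> (x + s *\<^sub>R axis j 1)) (at s within S)"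
proof -
  have "(\<psi> has_derivative frechet_derivative \<psi> (at (x + s *\<^sub>R axis j 1))) (at (x + s *\<^sub>R axis j 1))"
    using assms by (simp add: frechet_derivative_works)
  then have "((\<lambda>s. \<psi> (x + s *\<^sub>R axis j 1)) has_derivative
      (\<lambda>h. frechet_derivative \<psi> (at (x + s *\<^sub>R axis j 1)) (h *\<^sub>R axis j 1))) (at s within S)"
    by (intro has_derivative_compose[where g = \<psi>, of "\<lambda>s. x + s *\<^sub>R axis j 1" "\<lambda>h. h *\<^sub>R axis j 1"])
       (auto intro!: derivative_eq_intros)
  moreover have "linear (frechet_derivative \<psi> (at (x + s *\<^sub>R axis j 1)))"
    using assms by (rule linear_frechet_derivative)
  ultimately show ?thesis
    by (simp add: has_vector_derivative_def partial_def linear_scale)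
qed

text \<open>\<open>\<psi>(x + e\<^sub>j) - \<psi>(x) = \<integral>\<^sub>0\<^sup>1 \<partial>\<^sub>j\<psi>(x + s e\<^sub>j) ds\<close>; the integral over \<open>x\<close> of the left side is zero, that
  of the right side is \<open>\<integral> \<partial>\<^sub>j\<psi>\<close>.\<close>

lemma integral_partial_eq_0:
  fixes \<psi> :: "real^'n::finite \<Rightarrow> complex"
  assumes diff: "\<And>x. \<psi> differentiable (at x)" and cont: "continuous_on UNIV (partial j \<psi>)"
    and int: "integrable lborel \<psi>" and int': "integrable lborel (partial j \<psi>)"
  shows "(LINT x|lborel. partial j \<psi> x) = 0"
proof -
  let ?e = "axis j 1 :: real^'n"
  let ?d = "partial j \<psi>"
  have [measurable]: "?d \<in> borel_measurable borel" by (rule borel_measurable_continuous_onI[OF cont])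
  have ftc: "\<psi> (x + ?e) - \<psi> x = (LINT s|lborel. indicator {0..1} s *\<^sub>R ?d (x + s *\<^sub>R ?e))" for x
  proof -
    have "((\<lambda>s. ?d (x + s *\<^sub>R ?e)) has_integral (\<psi> (x + 1 *\<^sub>R ?e) - \<psi> (x + 0 *\<^sub>R ?e))) {0..1}"
      by (rule fundamental_theorem_of_calculus) (auto intro!: has_vector_derivative_line diff)
    moreover have c: "continuous_on {0..1} (\<lambda>s. ?d (x + s *\<^sub>R ?e))"
      by (intro continuous_on_compose2[OF cont] continuous_intros) auto
    have "set_integrable lborel {0..1} (\<lambda>s. ?d (x + s *\<^sub>R ?e))"
      by (rule borel_integrable_atLeastAtMost') (rule c)
    then have "(LINT s:{0..1}|lborel. ?d (x + s *\<^sub>R ?e)) = integral {0..1} (\<lambda>s. ?d (x + s *\<^sub>R ?e))"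
      by (rule set_borel_integral_eq_integral)
    ultimately show ?thesis
      by (simp add: set_lebesgue_integral_def integral_unique)
  qed
  have trans: "(LINT x|lborel. g (x + c)) = (LINT x|lborel. g x)" if "g \<in> borel_measurable borel" for g :: "real^'n \<Rightarrow> complex" and c
    by (subst (2) lborel_distr_plus[of c, symmetric], subst integral_distr)
       (use that in \<open>auto simp: add.commute\<close>)
  have trans_int: "integrable lborel (\<lambda>x. g (x + c))" if "integrable lborel g" for g :: "real^'n \<Rightarrow> complex" and c
    using that by (subst (asm) lborel_distr_plus[of c, symmetric], subst (asm) integrable_distr_eq)
      (auto simp: add.commute)
  let ?F = "\<lambda>(x, s). indicator {0..1} s *\<^sub>R ?d (x + s *\<^sub>R ?e)"
  \<comment> \<open>Translation preserves the integral of the norm of \<open>?d\<close>, and s runs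
    over an interval of length 1; so the double integral is finite and Fubini applies.\<close>
  have F: "integrable (lborel \<Otimes>\<^sub>M lborel) ?F"
  proof (rule integrableI_bounded)
    show "?F \<in> borel_measurable (lborel \<Otimes>\<^sub>M lborel)" by measurable
    have "(\<integral>\<^sup>+z. norm (?F z) \<partial>(lborel \<Otimes>\<^sub>M lborel))
        = (\<integral>\<^sup>+s. \<integral>\<^sup>+x. norm (?F (x, s)) \<partial>lborel \<partial>lborel)"
      by (rule lborel_pair.nn_integral_snd[symmetric]) measurable
    also have "\<dots> = (\<integral>\<^sup>+s. indicator {0..1} s * (\<integral>\<^sup>+x. norm (?d x) \<partial>lborel) \<partial>(lborel::real measure))"
    proof (rule nn_integral_cong)
      fix s :: real
      have "(\<integral>\<^sup>+x. norm (?F (x, s)) \<partial>lborel) = indicator {0..1} s * (\<integral>\<^sup>+x. norm (?d (s *\<^sub>R ?e + x)) \<partial>lborel)"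
        by (subst nn_integral_cmult[symmetric]) (auto simp: indicator_def add.commute intro!: nn_integral_cong)
      then show "(\<integral>\<^sup>+x. norm (?F (x, s)) \<partial>lborel) = indicator {0..1} s * (\<integral>\<^sup>+x. norm (?d x) \<partial>lborel)"
        using nn_integral_lborel_translate[of "\<lambda>x. ennreal (norm (?d x))" "s *\<^sub>R ?e"] by simp
    qed
    also have "\<dots> = (\<integral>\<^sup>+x. norm (?d x) \<partial>lborel)"
      by (simp add: nn_integral_multc)
    also have "\<dots> < \<infinity>" using int' by (simp add: integrable_iff_bounded)
    finally show "(\<integral>\<^sup>+z. norm (?F z) \<partial>(lborel \<Otimes>\<^sub>M lborel)) < \<infinity>" .
  qed
  have "0 = (LINT x|lborel. \<psi> (x + ?e) - \<psi> x)"
    using trans[of \<psi> ?e] trans_int[OF int, of ?e] int by simp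
  also have "\<dots> = (LINT x|lborel. LINT s|lborel. ?F (x, s))"
    by (simp add: ftc)
  also have "\<dots> = (LINT s|lborel. LINT x|lborel. ?F (x, s))"
    using lborel_pair.Fubini_integral[of "\<lambda>x s. ?F (x, s)"] F by simp
  also have "\<dots> = (LINT s|lborel. indicator {0..1::real} s *\<^sub>R (LINT x|lborel. ?d x))"
    by (simp add: trans)
  also have "\<dots> = (LINT x|lborel. ?d x)"
    by simp
  finally show ?thesis by simp
qed

lemma fourier_integrable:
  fixes \<phi> :: "'a::euclidean_space \<Rightarrow> complex"
  assumes "integrable lborel \<phi>"
  shows "integrable lborel (\<lambda>x. cis (- (x \<bullet> y)) * \<phi> x)"
proof (rule Bochner_Integration.integrable_bound[OF assms])
  have "continuous_on UNIV (\<lambda>x. cis (- (x \<bullet> y)))"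
    by (intro continuous_intros)
  then have [measurable]: "(\<lambda>x. cis (- (x \<bullet> y))) \<in> borel_measurable borel"
    by (rule borel_measurable_continuous_onI)
  have [measurable]: "\<phi> \<in> borel_measurable borel" using assms by simp
  show "(\<lambda>x. cis (- (x \<bullet> y)) * \<phi> x) \<in> borel_measurable lborel" by measurable
qed (simp add: norm_mult)

text \<open>Integration by parts: the derivative of \<psi>, the product of the character and \<phi>,
  integrates to 0, and the product rule splits it into the two transforms.\<close>

lemma fourier_partial:
  fixes \<phi> :: "real^'n::finite \<Rightarrow> complex"
  assumes \<phi>: "schwartz \<phi>"
  shows "fourier (partial j \<phi>) y = \<i> * complex_of_real (y $ j) * fourier \<phi> y"
proof -
  define \<psi> where "\<psi> x = cis (- (x \<bullet> y)) * \<phi> x" for x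
  have d: "partial j \<psi> x = cis (- (x \<bullet> y)) * partial j \<phi> x - \<i> * complex_of_real (y $ j) * \<psi> x"
    and diff: "\<psi> differentiable (at x)" for x
  proof -
    have f: "(\<phi> has_derivative frechet_derivative \<phi> (at x)) (at x)"
      using schwartz_differentiable[OF \<phi>] by (simp add: frechet_derivative_works)
    have c: "((\<lambda>x. cis (- (x \<bullet> y))) has_derivative (\<lambda>h. - (h \<bullet> y) *\<^sub>R (\<i> * cis (- (x \<bullet> y))))) (at x)"
    proof -
      have "((\<lambda>r. cis r) has_vector_derivative (\<i> * cis r)) (at r)" for r
        unfolding cis_conv_exp
        by (rule has_vector_derivative_real_field[of "\<lambda>z. exp (\<i> * z)"], auto intro!: derivative_eq_intros)
      then have "(cis has_derivative (\<lambda>h. h *\<^sub>R (\<i> * cis (- (x \<bullet> y))))) (at (- (x \<bullet> y)))"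
        by (simp add: has_vector_derivative_def)
      then show ?thesis
        by (rule has_derivative_compose[rotated]) (auto intro!: derivative_eq_intros)
    qed
    have "(\<psi> has_derivative (\<lambda>h. cis (- (x \<bullet> y)) * frechet_derivative \<phi> (at x) h + (- (h \<bullet> y) *\<^sub>R (\<i> * cis (- (x \<bullet> y)))) * \<phi> x)) (at x)"
      unfolding \<psi>_def by (rule has_derivative_mult[OF c f])
    then show "partial j \<psi> x = cis (- (x \<bullet> y)) * partial j \<phi> x - \<i> * complex_of_real (y $ j) * \<psi> x"
        "\<psi> differentiable (at x)"
      by (auto simp: partial_def frechet_derivative_at[symmetric] inner_axis' \<psi>_def scaleR_conv_of_real
            differentiable_def mult_ac)
  qed
  have i: "integrable lborel \<psi>"
    unfolding \<psi>_def by (rule fourier_integrable[OF schwartz_integrable[OF \<phi>]])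
  have i2: "integrable lborel (\<lambda>x. cis (- (x \<bullet> y)) * partial j \<phi> x)"
    by (rule fourier_integrable[OF schwartz_integrable[OF schwartz_partial[OF \<phi>]]])
  have "continuous_on UNIV (partial j \<phi>)" "continuous_on UNIV \<psi>"
    using schwartz_differentiable[OF schwartz_partial[OF \<phi>]] diff
    by (simp_all add: continuous_on_eq_continuous_at differentiable_imp_continuous_within)
  then have "continuous_on UNIV (partial j \<psi>)"
    unfolding d[abs_def] by (intro continuous_intros) auto
  then have "(LINT x|lborel. partial j \<psi> x) = 0"
    using diff i i2 by (intro integral_partial_eq_0) (auto simp: d[abs_def])
  moreover have "(LINT x|lborel. partial j \<psi> x) = (LINT x|lborel. cis (- (x \<bullet> y)) * partial j \<phi> x) -
      \<i> * complex_of_real (y $ j) * (LINT x|lborel. \<psi> x)"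
    unfolding d[abs_def] using i i2 by simp
  ultimately show ?thesis by (simp add: fourier_def \<psi>_def)
qed

lemma norm_fourier_le:
  fixes \<phi> :: "'a::euclidean_space \<Rightarrow> complex"
  shows "norm (fourier \<phi> y) \<le> (2 * pi) powr (- real DIM('a) / 2) * (LINT x|lborel. norm (\<phi> x))"
  unfolding fourier_def norm_mult
  by (intro mult_mono order_trans[OF integral_norm_bound]) (auto simp: norm_mult)

text \<open>1 + |y|^2 is the symbol of 1 minus the Laplacian, so each power costs two derivatives of
  \<phi>, which stay in the Schwartz class.\<close>

lemma fourier_decay:
  fixes \<phi> :: "real^'n::finite \<Rightarrow> complex"
  assumes "schwartz \<phi>"
  shows "\<exists>C. \<forall>y. (1 + (norm y)\<^sup>2) ^ N * norm (fourier \<phi> y) \<le> C"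
  using assms
proof (induction N arbitrary: \<phi>)
  case 0
  then show ?case using norm_fourier_le[of \<phi>] by auto
next
  case (Suc N)
  let ?\<phi> = "\<lambda>j. partial j (partial j \<phi>)"
  have "\<exists>C. \<forall>y. (1 + (norm y)\<^sup>2) ^ N * norm (fourier (?\<phi> j) y) \<le> C" for j
    using Suc by (intro Suc.IH schwartz_partial)
  then obtain D where D: "\<And>j y. (1 + (norm y)\<^sup>2) ^ N * norm (fourier (?\<phi> j) y) \<le> D j"
    by metis
  obtain C where C: "\<And>y. (1 + (norm y)\<^sup>2) ^ N * norm (fourier \<phi> y) \<le> C"
    using Suc by blast
  have "(1 + (norm y)\<^sup>2) ^ Suc N * norm (fourier \<phi> y) \<le> C + (\<Sum>j\<in>UNIV. D j)" for y
  proof -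
    have "norm (fourier (?\<phi> j) y) = (y $ j)\<^sup>2 * norm (fourier \<phi> y)" for j
      using Suc.prems by (simp add: fourier_partial schwartz_partial norm_mult power2_eq_square)
    moreover have "(norm y)\<^sup>2 = (\<Sum>j\<in>UNIV. (y $ j)\<^sup>2)"
      by (simp add: norm_vec_def L2_set_def sum_nonneg)
    ultimately have "(1 + (norm y)\<^sup>2) * norm (fourier \<phi> y) = norm (fourier \<phi> y) + (\<Sum>j\<in>UNIV. norm (fourier (?\<phi> j) y))"
      by (simp add: distrib_right sum_distrib_right)
    then have "(1 + (norm y)\<^sup>2) ^ Suc N * norm (fourier \<phi> y) =
        (1 + (norm y)\<^sup>2) ^ N * norm (fourier \<phi> y) + (\<Sum>j\<in>UNIV. (1 + (norm y)\<^sup>2) ^ N * norm (fourier (?\<phi> j) y))"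
      by (simp add: mult.assoc mult.left_commute[of "1 + (norm y)\<^sup>2"] distrib_left sum_distrib_left)
    also have "\<dots> \<le> C + (\<Sum>j\<in>UNIV. D j)"
      by (intro add_mono sum_mono C D)
    finally show ?thesis .
  qed
  then show ?case by blast
qed

lemma fourier_measurable [measurable]:
  fixes \<phi> :: "'a::euclidean_space \<Rightarrow> complex"
  assumes [measurable]: "\<phi> \<in> borel_measurable borel"
  shows "fourier \<phi> \<in> borel_measurable borel"
proof -
  have "continuous_on UNIV (\<lambda>z :: 'a \<times> 'a. cis (- (snd z \<bullet> fst z)))"
    by (intro continuous_intros)
  then have [measurable]: "(\<lambda>(y, x). cis (- (x \<bullet> y))) \<in> borel_measurable (borel \<Otimes>\<^sub>M (borel :: 'a measure))"
    unfolding borel_prod by (subst case_prod_unfold) (rule borel_measurable_continuous_onI)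
  show ?thesis
    unfolding fourier_def[abs_def] by measurable
qed

lemma sobolev_sqnorm_fourier_finite:
  fixes \<phi> :: "real^'n::finite \<Rightarrow> complex"
  assumes t: "t > - real CARD('n) / 2" and \<phi>: "schwartz \<phi>"
  shows "sobolev_sqnorm s t (fourier \<phi>) < \<infinity>"
proof -
  \<comment> \<open>Squaring the decay bound of order N replaces s by s - 2N in the weight; as N
    exceeds |s| + n, the condition 2 (s - 2N) + n < 0 holds.\<close>
  define N where "N = nat \<lceil>\<bar>s\<bar>\<rceil> + CARD('n) + 1"
  obtain C where C: "\<And>y. (1 + (norm y)\<^sup>2) ^ N * norm (fourier \<phi> y) \<le> C"
    using fourier_decay[OF \<phi>] by blast
  have C0: "C \<ge> 0" using order_trans[OF _ C[of 0]] by simp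
  have N: "real N \<ge> \<bar>s\<bar> + real CARD('n)" "real N \<ge> \<bar>s\<bar> + 1"
    unfolding N_def by (simp_all add: add_increasing add_increasing2)
  let ?w = "\<lambda>y :: real^'n. norm y powr (2 * t) * (1 + (norm y)\<^sup>2) powr (s - 2 * real N - t)"
  have bound: "norm y powr (2 * t) * (1 + (norm y)\<^sup>2) powr (s - t) * (norm (fourier \<phi> y))\<^sup>2 \<le> C\<^sup>2 * ?w y" for y
  proof -
    have p: "1 + (norm y)\<^sup>2 > 0" by (simp add: add_pos_nonneg)
    have "norm (fourier \<phi> y) \<le> C * (1 + (norm y)\<^sup>2) powr (- real N)"
      using C[of y] p by (simp add: powr_minus powr_realpow field_simps)
    then have "(norm (fourier \<phi> y))\<^sup>2 \<le> (C * (1 + (norm y)\<^sup>2) powr (- real N))\<^sup>2"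
      by (intro power_mono) auto
    also have "\<dots> = C\<^sup>2 * (1 + (norm y)\<^sup>2) powr (- 2 * real N)"
      using p by (simp add: power_mult_distrib power2_eq_square flip: powr_add)
    finally have "norm y powr (2 * t) * (1 + (norm y)\<^sup>2) powr (s - t) * (norm (fourier \<phi> y))\<^sup>2
       \<le> norm y powr (2 * t) * (1 + (norm y)\<^sup>2) powr (s - t) * (C\<^sup>2 * (1 + (norm y)\<^sup>2) powr (- 2 * real N))"
      by (intro mult_left_mono) auto
    also have "\<dots> = C\<^sup>2 * (norm y powr (2 * t) * ((1 + (norm y)\<^sup>2) powr (s - t) * (1 + (norm y)\<^sup>2) powr (- 2 * real N)))"
      by (simp only: mult_ac)
    also have "(1 + (norm y)\<^sup>2) powr (s - t) * (1 + (norm y)\<^sup>2) powr (- 2 * real N) = (1 + (norm y)\<^sup>2) powr (s - 2 * real N - t)"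
      by (simp add: algebra_simps flip: powr_add)
    finally show ?thesis .
  qed
  have "sobolev_sqnorm s t (fourier \<phi>) \<le> (\<integral>\<^sup>+y. ennreal (C\<^sup>2) * ennreal (?w y) \<partial>lborel)"
    unfolding sobolev_sqnorm_def
    by (intro nn_integral_mono) (auto simp flip: ennreal_mult intro!: ennreal_leI bound)
  also have "\<dots> = ennreal (C\<^sup>2) * (\<integral>\<^sup>+y. ennreal (?w y) \<partial>lborel)"
    by (rule nn_integral_cmult) measurable
  also have "\<dots> < \<infinity>"
  proof -
    have "2 * (s - 2 * real N - t) + 2 * t + real CARD('n) < 0"
      using N by argo
    then show ?thesis
      using nn_integral_sobolev_weight_finite[OF t, of "s - 2 * real N"] by (simp add: ennreal_mult_less_top)
  qed
  finally show ?thesis .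
qed

section \<open>The Radon transform on the Fourier side\<close>

text \<open>Fubini for parallel hyperplanes: the measures
  \<open>hyperplane_measure \<omega> p\<close>, integrated over p, give Lebesgue measure. Shift p by
  \<open>x \<bullet> \<omega>\<close> and then translate x to the image point z; for fixed z the
  slab condition leaves an interval of parameters q of length 1.\<close>

lemma distr_slab:
  fixes \<omega> :: "real^'n::finite"
  assumes \<omega>: "norm \<omega> = 1"
  defines "S \<equiv> {x. 0 \<le> x \<bullet> \<omega> \<and> x \<bullet> \<omega> \<le> 1}"
  shows "distr (density (lborel \<Otimes>\<^sub>M lborel) (\<lambda>(p, x). indicator S x)) borel (\<lambda>(p, x). x + (p - x \<bullet> \<omega>) *\<^sub>R \<omega>) = lborel"
proof (rule measure_eqI)
  let ?D = "distr (density (lborel \<Otimes>\<^sub>M lborel) (\<lambda>(p, x). indicator S x)) borel (\<lambda>(p, x). x + (p - x \<bullet> \<omega>) *\<^sub>R \<omega>)"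
  have [measurable]: "S \<in> sets borel" unfolding S_def by measurable
  fix A assume "A \<in> sets ?D"
  then have [measurable]: "A \<in> sets borel" by simp
  have "emeasure ?D A
     = (\<integral>\<^sup>+z. indicator A z \<partial>?D)"
    by simp
  also have "\<dots> = (\<integral>\<^sup>+(p, x). indicator S x * indicator A (x + (p - x \<bullet> \<omega>) *\<^sub>R \<omega>) \<partial>(lborel \<Otimes>\<^sub>M lborel))"
    by (subst nn_integral_distr, measurable, subst nn_integral_density) (measurable, simp add: case_prod_unfold)
  also have "\<dots> = (\<integral>\<^sup>+x. \<integral>\<^sup>+p. indicator S x * indicator A (x + (p - x \<bullet> \<omega>) *\<^sub>R \<omega>) \<partial>lborel \<partial>lborel)"
    by (subst lborel_pair.nn_integral_snd[symmetric]) (simp_all add: case_prod_unfold)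
  also have "\<dots> = (\<integral>\<^sup>+x. \<integral>\<^sup>+q. indicator S x * indicator A (x + q *\<^sub>R \<omega>) \<partial>lborel \<partial>lborel)"
  proof (rule nn_integral_cong)
    fix x :: "real^'n"
    show "(\<integral>\<^sup>+p. indicator S x * indicator A (x + (p - x \<bullet> \<omega>) *\<^sub>R \<omega>) \<partial>lborel) = (\<integral>\<^sup>+q. indicator S x * indicator A (x + q *\<^sub>R \<omega>) \<partial>lborel)"
      using nn_integral_lborel_translate[of "\<lambda>q. indicator S x * indicator A (x + q *\<^sub>R \<omega>)" "- (x \<bullet> \<omega>)"] by simp
  qed
  also have "\<dots> = (\<integral>\<^sup>+q. \<integral>\<^sup>+x. indicator S x * indicator A (x + q *\<^sub>R \<omega>) \<partial>lborel \<partial>lborel)"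
    by (rule lborel_pair.Fubini'[symmetric]) measurable
  also have "\<dots> = (\<integral>\<^sup>+q. \<integral>\<^sup>+z. indicator S (z - q *\<^sub>R \<omega>) * indicator A z \<partial>lborel \<partial>lborel)"
  proof (rule nn_integral_cong)
    fix q :: real
    show "(\<integral>\<^sup>+x. indicator S x * indicator A (x + q *\<^sub>R \<omega>) \<partial>lborel) = (\<integral>\<^sup>+z. indicator S (z - q *\<^sub>R \<omega>) * indicator A z \<partial>lborel)"
      using nn_integral_lborel_translate[of "\<lambda>z. indicator S (z - q *\<^sub>R \<omega>) * indicator A z" "q *\<^sub>R \<omega>"] by (simp add: add.commute)
  qed
  also have "\<dots> = (\<integral>\<^sup>+z. \<integral>\<^sup>+q. indicator S (z - q *\<^sub>R \<omega>) * indicator A z \<partial>lborel \<partial>lborel)"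
    by (rule lborel_pair.Fubini') measurable
  also have "\<dots> = (\<integral>\<^sup>+z. indicator A z \<partial>lborel)"
  proof (rule nn_integral_cong)
    fix z :: "real^'n"
    have "\<omega> \<bullet> \<omega> = 1" using \<omega> by (simp add: norm_eq_1)
    then have "indicator S (z - q *\<^sub>R \<omega>) = (indicator {z \<bullet> \<omega> - 1 .. z \<bullet> \<omega>} q :: ennreal)" for q
      by (auto simp: S_def indicator_def inner_diff_left)
    then show "(\<integral>\<^sup>+q. indicator S (z - q *\<^sub>R \<omega>) * indicator A z \<partial>lborel) = indicator A z"
      by (simp add: nn_integral_multc)
  qed
  finally show "emeasure ?D A = emeasure lborel A"
    by simp
qed simp

text \<open>The phase at frequency \<sigma>\<omega> is constant on each hyperplane, so the integral
  over p and the one over the hyperplane combine to a single integral by \<open>distr_slab\<close>.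
  The constant is the quotient of the normalizations (2 pi)^(-1/2) and (2 pi)^(-n/2).\<close>

lemma fourier_slice:
  fixes \<phi> :: "real^'n::finite \<Rightarrow> complex"
  assumes \<omega>: "norm \<omega> = 1" and \<phi>: "integrable lborel \<phi>"
  shows "fourier (radon \<phi> \<omega>) \<sigma> = complex_of_real ((2 * pi) powr ((real CARD('n) - 1) / 2)) * fourier \<phi> (\<sigma> *\<^sub>R \<omega>)"
proof -
  define S where "S = {x. 0 \<le> x \<bullet> \<omega> \<and> x \<bullet> \<omega> \<le> 1}"
  let ?M = "density (lborel \<Otimes>\<^sub>M lborel) (\<lambda>z. ennreal (indicator S (snd z)))"
  define \<Phi> where "\<Phi> = (\<lambda>(p, x). x + (p - x \<bullet> \<omega>) *\<^sub>R \<omega>)"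
  define G where "G z = cis (- (z \<bullet> (\<sigma> *\<^sub>R \<omega>))) * \<phi> z" for z
  have [measurable]: "S \<in> sets borel" unfolding S_def by measurable
  have [measurable]: "\<Phi> \<in> borel_measurable (lborel \<Otimes>\<^sub>M lborel)" unfolding \<Phi>_def by measurable
  have [measurable]: "\<phi> \<in> borel_measurable borel" using \<phi> by simp
  have G: "integrable lborel G" unfolding G_def by (rule fourier_integrable[OF \<phi>])
  then have [measurable]: "G \<in> borel_measurable borel" by simp
  have dens: "density (lborel \<Otimes>\<^sub>M lborel) (\<lambda>(p, x). indicator S x) = ?M"
    by (simp add: case_prod_unfold ennreal_indicator)
  have distr: "distr ?M borel \<Phi> = lborel"
    using distr_slab[OF \<omega>] unfolding S_def[symmetric] \<Phi>_def[symmetric] dens .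
  have int: "integrable (lborel \<Otimes>\<^sub>M lborel) (\<lambda>z. indicator S (snd z) *\<^sub>R G (\<Phi> z))"
  proof -
    have "integrable (distr ?M borel \<Phi>) G"
      unfolding distr by (rule G)
    then show ?thesis
      by (subst (asm) integrable_distr_eq, measurable, subst (asm) integrable_density) auto
  qed
  have rad: "radon \<phi> \<omega> p = (LINT x|lborel. indicator S x *\<^sub>R \<phi> (\<Phi> (p, x)))" for p
  proof -
    have "density lborel (indicator S) = density lborel (\<lambda>x. ennreal (indicator S x))"
      by (simp add: ennreal_indicator)
    then have "radon \<phi> \<omega> p = (LINT x|distr (density lborel (\<lambda>x. ennreal (indicator S x))) borel (\<lambda>x. x + (p - x \<bullet> \<omega>) *\<^sub>R \<omega>). \<phi> x)"
      unfolding radon_def hyperplane_measure_def S_def[symmetric] by simp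
    also have "\<dots> = (LINT x|lborel. indicator S x *\<^sub>R \<phi> (\<Phi> (p, x)))"
      by (subst integral_distr, measurable, subst integral_density) (auto simp: \<Phi>_def)
    finally show ?thesis .
  qed
  have "(LINT p|lborel. cis (- (p \<bullet> \<sigma>)) * radon \<phi> \<omega> p) = (LINT p|lborel. LINT x|lborel. indicator S x *\<^sub>R G (\<Phi> (p, x)))"
  proof (rule Bochner_Integration.integral_cong[OF refl])
    fix p :: real
    have "\<omega> \<bullet> \<omega> = 1" using \<omega> by (simp add: norm_eq_1)
    then have ip: "\<Phi> (p, x) \<bullet> (\<sigma> *\<^sub>R \<omega>) = p * \<sigma>" for x
      by (simp add: \<Phi>_def inner_add_left mult.commute)
    have "cis (- (p \<bullet> \<sigma>)) * (indicator S x *\<^sub>R \<phi> (\<Phi> (p, x))) = indicator S x *\<^sub>R G (\<Phi> (p, x))" for x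
      unfolding G_def ip by simp
    note eq = this
    show "cis (- (p \<bullet> \<sigma>)) * radon \<phi> \<omega> p = (LINT x|lborel. indicator S x *\<^sub>R G (\<Phi> (p, x)))"
      unfolding rad eq[symmetric] by (rule integral_mult_right_zero[symmetric])
  qed
  also have "\<dots> = (LINT z|(lborel \<Otimes>\<^sub>M lborel). indicator S (snd z) *\<^sub>R G (\<Phi> z))"
    using lborel_pair.integral_fst'[OF int] by simp
  also have "\<dots> = (LINT z|distr ?M borel \<Phi>. G z)"
    by (subst integral_distr, measurable, subst integral_density) auto
  also have "\<dots> = (LINT z|lborel. G z)"
    unfolding distr ..
  finally have eq: "(LINT p|lborel. cis (- (p \<bullet> \<sigma>)) * radon \<phi> \<omega> p) = (LINT z|lborel. G z)" .
  have "(2 * pi) powr ((real CARD('n) - 1) / 2) * (2 * pi) powr (- real CARD('n) / 2) = (2 * pi) powr (- 1 / 2)"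
    by (simp add: field_simps flip: powr_add)
  then show ?thesis
    unfolding fourier_def eq G_def by (simp add: mult.assoc[symmetric] flip: of_real_mult)
qed

section \<open>The norm on the cylinder and the extended Radon transform\<close>

lemma AE_cylinder_norm: "AE x in sphere_measure \<Otimes>\<^sub>M (lborel :: real measure). norm (fst x) = 1"
proof -
  have "{x \<in> space (sphere_measure \<Otimes>\<^sub>M (lborel :: real measure)). norm (fst x) = 1} \<in> sets (sphere_measure \<Otimes>\<^sub>M lborel)"
    by measurable
  then show ?thesis
    by (rule sphere_line.AE_pair_measure) (use AE_sphere_measure_norm in \<open>auto elim: eventually_mono\<close>)
qed

lemma cylinder_sqnorm_cong:
  assumes "AE x in sphere_measure \<Otimes>\<^sub>M lborel. F x = G x"
  shows "cylinder_sqnorm s t F = cylinder_sqnorm s t G"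
  unfolding cylinder_sqnorm_def
  by (intro arg_cong2[where f = "(*)"] refl nn_integral_cong_AE, use assms in eventually_elim)
     (auto simp: case_prod_unfold)

text \<open>A weighted form of (a + b)^2 <= 2 a^2 + 2 b^2. It takes the place of the triangle
  inequality, as the norms occur only as squares in \<open>ennreal\<close>.\<close>

lemma ennreal_mult_norm_diff_sq_le:
  fixes a b c :: "'a::real_normed_vector"
  assumes "w \<ge> 0"
  shows "ennreal (w * (norm (a - b))\<^sup>2) \<le> 2 * ennreal (w * (norm (c - a))\<^sup>2) + 2 * ennreal (w * (norm (c - b))\<^sup>2)"
proof -
  have "(norm (a - b))\<^sup>2 \<le> (norm (c - a) + norm (c - b))\<^sup>2"
    using norm_triangle_ineq4[of "c - b" "c - a"] by (intro power_mono) (auto simp: add.commute)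
  also have "\<dots> \<le> 2 * (norm (c - a))\<^sup>2 + 2 * (norm (c - b))\<^sup>2"
    using sum_squares_bound[of "norm (c - a)" "norm (c - b)"] by (simp add: power2_sum)
  finally have "w * (norm (a - b))\<^sup>2 \<le> w * (2 * (norm (c - a))\<^sup>2 + 2 * (norm (c - b))\<^sup>2)"
    by (rule mult_left_mono) (rule assms)
  then have "ennreal (w * (norm (a - b))\<^sup>2) \<le> ennreal (2 * (w * (norm (c - a))\<^sup>2) + 2 * (w * (norm (c - b))\<^sup>2))"
    by (intro ennreal_leI) (simp add: algebra_simps)
  also have "\<dots> = 2 * ennreal (w * (norm (c - a))\<^sup>2) + 2 * ennreal (w * (norm (c - b))\<^sup>2)"
    using assms by (simp add: ennreal_mult)
  finally show ?thesis .
qed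

lemma cylinder_sqnorm_triangle:
  fixes F G K :: "(real^'n::finite) \<times> real \<Rightarrow> complex"
  assumes [measurable]: "F \<in> borel_measurable (sphere_measure \<Otimes>\<^sub>M lborel)"
    "G \<in> borel_measurable (sphere_measure \<Otimes>\<^sub>M lborel)" "K \<in> borel_measurable (sphere_measure \<Otimes>\<^sub>M lborel)"
  shows "cylinder_sqnorm s t (\<lambda>x. F x - G x) \<le> 2 * cylinder_sqnorm s t (\<lambda>x. K x - F x) + 2 * cylinder_sqnorm s t (\<lambda>x. K x - G x)"
proof -
  let ?M = "sphere_measure \<Otimes>\<^sub>M lborel :: ((real^'n) \<times> real) measure"
  let ?N = "\<lambda>F. \<integral>\<^sup>+x. ennreal (\<bar>snd x\<bar> powr (2 * t) * (1 + \<bar>snd x\<bar>\<^sup>2) powr (s - t) * (cmod (F x))\<^sup>2) \<partial>?M"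
  have "?N (\<lambda>x. F x - G x) \<le> (\<integral>\<^sup>+x. 2 * ennreal (\<bar>snd x\<bar> powr (2 * t) * (1 + \<bar>snd x\<bar>\<^sup>2) powr (s - t) * (cmod (K x - F x))\<^sup>2)
      + 2 * ennreal (\<bar>snd x\<bar> powr (2 * t) * (1 + \<bar>snd x\<bar>\<^sup>2) powr (s - t) * (cmod (K x - G x))\<^sup>2) \<partial>?M)"
    by (intro nn_integral_mono ennreal_mult_norm_diff_sq_le) auto
  also have "\<dots> = 2 * ?N (\<lambda>x. K x - F x) + 2 * ?N (\<lambda>x. K x - G x)"
    by (simp add: nn_integral_add nn_integral_cmult)
  finally have "ennreal (1 / (2 * (2 * pi) ^ (CARD('n) - 1))) * ?N (\<lambda>x. F x - G x) \<le>
     ennreal (1 / (2 * (2 * pi) ^ (CARD('n) - 1))) * (2 * ?N (\<lambda>x. K x - F x) + 2 * ?N (\<lambda>x. K x - G x))"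
    by (rule mult_left_mono) simp
  then show ?thesis
    by (simp add: cylinder_sqnorm_def case_prod_unfold distrib_left mult.left_commute)
qed

text \<open>The isometry behind the shift by (n - 1)/2: s - t is unchanged, while |\<sigma>|^(2t)
  gains the Jacobian |\<sigma>|^(n-1) of polar coordinates. The square of the slice constant and the
  double covering cancel the prefactor of the norm.\<close>

lemma cylinder_sqnorm_slice:
  fixes G :: "real^'n::finite \<Rightarrow> complex"
  assumes n: "CARD('n) \<ge> 2" and [measurable]: "G \<in> borel_measurable borel"
  shows "cylinder_sqnorm (s + (real CARD('n) - 1) / 2) (t + (real CARD('n) - 1) / 2)
     (\<lambda>(\<omega>, \<sigma>). complex_of_real ((2 * pi) powr ((real CARD('n) - 1) / 2)) * G (\<sigma> *\<^sub>R \<omega>)) = sobolev_sqnorm s t G"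
proof -
  let ?k = "CARD('n) - 1"
  let ?h = "\<lambda>y. ennreal (norm y powr (2 * t) * (1 + (norm y)\<^sup>2) powr (s - t) * (cmod (G y))\<^sup>2)"
  have k: "real CARD('n) - 1 = real ?k" by (simp add: of_nat_diff)
  have c: "((2 * pi) powr (real ?k / 2))\<^sup>2 = (2 * pi) ^ ?k"
  proof -
    have "((2 * pi) powr (real ?k / 2))\<^sup>2 = (2 * pi) powr (real ?k / 2 + real ?k / 2)"
      unfolding powr_add power2_eq_square ..
    also have "\<dots> = (2 * pi) powr real ?k" by simp
    also have "\<dots> = (2 * pi) ^ ?k" by (rule powr_realpow) simp
    finally show ?thesis .
  qed
  have "(\<integral>\<^sup>+x. ennreal (\<bar>snd x\<bar> powr (2 * (t + real ?k / 2)) * (1 + \<bar>snd x\<bar>\<^sup>2) powr ((s + real ?k / 2) - (t + real ?k / 2)) *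
       (cmod (complex_of_real ((2 * pi) powr (real ?k / 2)) * G (snd x *\<^sub>R fst x)))\<^sup>2) \<partial>(sphere_measure \<Otimes>\<^sub>M lborel))
    = (\<integral>\<^sup>+x. ennreal ((2 * pi) ^ ?k) * (ennreal (\<bar>snd x\<bar> ^ ?k) * ?h (snd x *\<^sub>R fst x)) \<partial>(sphere_measure \<Otimes>\<^sub>M lborel))"
  proof (intro nn_integral_cong_AE, use AE_cylinder_norm in eventually_elim)
    case (elim x)
    have "\<bar>snd x\<bar> powr (2 * (t + real ?k / 2)) = \<bar>snd x\<bar> ^ ?k * \<bar>snd x\<bar> powr (2 * t)"
    proof (cases "snd x = 0")
      case False
      then show ?thesis by (simp add: powr_add distrib_left powr_realpow del: One_nat_def)
    qed (use n in simp)
    then have "\<bar>snd x\<bar> powr (2 * (t + real ?k / 2)) * (1 + \<bar>snd x\<bar>\<^sup>2) powr ((s + real ?k / 2) - (t + real ?k / 2)) *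
       (cmod (complex_of_real ((2 * pi) powr (real ?k / 2)) * G (snd x *\<^sub>R fst x)))\<^sup>2
      = (2 * pi) ^ ?k * (\<bar>snd x\<bar> ^ ?k * (norm (snd x *\<^sub>R fst x) powr (2 * t) * (1 + (norm (snd x *\<^sub>R fst x))\<^sup>2) powr (s - t) * (cmod (G (snd x *\<^sub>R fst x)))\<^sup>2))"
      using elim c by (simp add: norm_mult power_mult_distrib)
    then show ?case
      by (simp only:) (simp add: ennreal_mult mult.assoc)
  qed
  also have "\<dots> = ennreal ((2 * pi) ^ ?k) * (\<integral>\<^sup>+x. ennreal (\<bar>snd x\<bar> ^ ?k) * ?h (snd x *\<^sub>R fst x) \<partial>(sphere_measure \<Otimes>\<^sub>M lborel))"
    by (rule nn_integral_cmult) measurable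
  also have "\<dots> = ennreal ((2 * pi) ^ ?k) * (2 * sobolev_sqnorm s t G)"
    using nn_integral_polar_line[of ?h] by (simp add: case_prod_unfold sobolev_sqnorm_def)
  also have "ennreal (1 / (2 * (2 * pi) ^ ?k)) * \<dots> = sobolev_sqnorm s t G"
  proof -
    have "ennreal (1 / (2 * (2 * pi) ^ ?k)) * ennreal ((2 * pi) ^ ?k) = ennreal (1 / 2)"
      by (subst ennreal_mult[symmetric]) auto
    moreover have "ennreal (1 / 2) * ennreal 2 = ennreal (1 / 2 * 2)" by (rule ennreal_mult[symmetric]) auto
    ultimately have "ennreal (1 / (2 * (2 * pi) ^ ?k)) * ennreal ((2 * pi) ^ ?k) * 2 = 1" by simp
    then show ?thesis by (simp add: mult.assoc[symmetric])
  qed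
  finally show ?thesis
    unfolding cylinder_sqnorm_def k by (simp add: case_prod_unfold)
qed

text \<open>The slice formula provides a function with the limit property, so the one chosen by
  \<open>SOME\<close> has it too. Both are limits of the same approximating sequence, hence their
  difference has norm 0.\<close>

lemma radon_ext_eq:
  fixes g :: "real^'n::finite \<Rightarrow> complex"
  assumes n: "CARD('n) \<ge> 2" and g: "g \<in> sobolev s t"
  shows "AE (\<omega>, \<sigma>) in sphere_measure \<Otimes>\<^sub>M lborel. radon_ext s t g (\<omega>, \<sigma>) =
     complex_of_real ((2 * pi) powr ((real CARD('n) - 1) / 2)) * g (\<sigma> *\<^sub>R \<omega>)"
proof -
  let ?M = "sphere_measure \<Otimes>\<^sub>M lborel :: ((real^'n) \<times> real) measure"
  let ?c = "complex_of_real ((2 * pi) powr ((real CARD('n) - 1) / 2))"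
  let ?s = "s + (real CARD('n) - 1) / 2" and ?t = "t + (real CARD('n) - 1) / 2"
  define \<psi>0 where "\<psi>0 = (\<lambda>(\<omega>, \<sigma>). ?c * g (\<sigma> *\<^sub>R \<omega>))"
  have [measurable]: "g \<in> borel_measurable borel" using g by (simp add: sobolev_def)
  obtain \<phi> where \<phi>: "schwartz_approx s t \<phi> g" using g by (auto simp: sobolev_def)
  have [measurable]: "\<psi>0 \<in> borel_measurable ?M" unfolding \<psi>0_def by measurable
  have slice: "AE x in ?M. (case x of (\<omega>, \<sigma>) \<Rightarrow> fourier (radon \<phi> \<omega>) \<sigma> - \<psi> (\<omega>, \<sigma>))
       = ?c * fourier \<phi> (snd x *\<^sub>R fst x) - \<psi> x" if "schwartz \<phi>" for \<phi> \<psi>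
    using AE_cylinder_norm
    by eventually_elim (auto simp: fourier_slice schwartz_integrable[OF that])
  have lim: "(\<lambda>k. cylinder_sqnorm ?s ?t (\<lambda>(\<omega>, \<sigma>). fourier (radon (\<phi> k) \<omega>) \<sigma> - \<psi>0 (\<omega>, \<sigma>))) \<longlonglongrightarrow> 0"
    if \<phi>: "schwartz_approx s t \<phi> g" for \<phi>
  proof -
    have "cylinder_sqnorm ?s ?t (\<lambda>(\<omega>, \<sigma>). fourier (radon (\<phi> k) \<omega>) \<sigma> - \<psi>0 (\<omega>, \<sigma>))
       = sobolev_sqnorm s t (\<lambda>y. fourier (\<phi> k) y - g y)" for k
    proof -
      have sk: "schwartz (\<phi> k)" using \<phi> by (simp add: schwartz_approx_def)
      have [measurable]: "\<phi> k \<in> borel_measurable borel" using sk by (rule schwartz_measurable)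
      have "cylinder_sqnorm ?s ?t (\<lambda>(\<omega>, \<sigma>). fourier (radon (\<phi> k) \<omega>) \<sigma> - \<psi>0 (\<omega>, \<sigma>))
         = cylinder_sqnorm ?s ?t (\<lambda>x. ?c * fourier (\<phi> k) (snd x *\<^sub>R fst x) - \<psi>0 x)"
        by (rule cylinder_sqnorm_cong[OF slice[OF sk]])
      also have "(\<lambda>x. ?c * fourier (\<phi> k) (snd x *\<^sub>R fst x) - \<psi>0 x) =
          (\<lambda>(\<omega>, \<sigma>). ?c * (fourier (\<phi> k) (\<sigma> *\<^sub>R \<omega>) - g (\<sigma> *\<^sub>R \<omega>)))"
        by (auto simp: \<psi>0_def right_diff_distrib fun_eq_iff)
      also have "cylinder_sqnorm ?s ?t \<dots> = sobolev_sqnorm s t (\<lambda>y. fourier (\<phi> k) y - g y)"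
        using cylinder_sqnorm_slice[OF n, of "\<lambda>y. fourier (\<phi> k) y - g y" s t] by simp
      finally show ?thesis .
    qed
    then show ?thesis using \<phi> by (simp add: schwartz_approx_def)
  qed
  then have "is_radon_ext s t g \<psi>0" by (simp add: is_radon_ext_def)
  then have ext: "is_radon_ext s t g (radon_ext s t g)"
    unfolding radon_ext_def by (rule someI[where P = "is_radon_ext s t g"])
  define \<psi> where "\<psi> = radon_ext s t g"
  have [measurable]: "\<psi> \<in> borel_measurable ?M"
    and lim': "(\<lambda>k. cylinder_sqnorm ?s ?t (\<lambda>(\<omega>, \<sigma>). fourier (radon (\<phi> k) \<omega>) \<sigma> - \<psi> (\<omega>, \<sigma>))) \<longlonglongrightarrow> 0"
    using ext \<phi> by (simp_all add: is_radon_ext_def \<psi>_def)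
  let ?X = "\<lambda>k. cylinder_sqnorm ?s ?t (\<lambda>(\<omega>, \<sigma>). fourier (radon (\<phi> k) \<omega>) \<sigma> - \<psi> (\<omega>, \<sigma>))"
  let ?Y = "\<lambda>k. cylinder_sqnorm ?s ?t (\<lambda>(\<omega>, \<sigma>). fourier (radon (\<phi> k) \<omega>) \<sigma> - \<psi>0 (\<omega>, \<sigma>))"
  have le: "cylinder_sqnorm ?s ?t (\<lambda>x. \<psi> x - \<psi>0 x) \<le> 2 * ?X k + 2 * ?Y k" for k
  proof -
    have sk: "schwartz (\<phi> k)" using \<phi> by (simp add: schwartz_approx_def)
    have [measurable]: "\<phi> k \<in> borel_measurable borel" using sk by (rule schwartz_measurable)
    show ?thesis
      unfolding cylinder_sqnorm_cong[OF slice[OF sk]] by (rule cylinder_sqnorm_triangle) measurable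
  qed
  have "(\<lambda>k. 2 * ?X k + 2 * ?Y k) \<longlonglongrightarrow> 2 * 0 + 2 * 0"
    by (intro tendsto_add ennreal_tendsto_cmult lim' lim[OF \<phi>]) auto
  then have "cylinder_sqnorm ?s ?t (\<lambda>x. \<psi> x - \<psi>0 x) \<le> 2 * 0 + 2 * 0"
    by (rule LIMSEQ_le_const) (use le in auto)
  then have "(\<integral>\<^sup>+x. ennreal (\<bar>snd x\<bar> powr (2 * ?t) * (1 + \<bar>snd x\<bar>\<^sup>2) powr (?s - ?t) * (cmod (\<psi> x - \<psi>0 x))\<^sup>2) \<partial>?M) = 0"
    unfolding cylinder_sqnorm_def by (simp add: case_prod_unfold)
  then have "AE x in ?M. ennreal (\<bar>snd x\<bar> powr (2 * ?t) * (1 + \<bar>snd x\<bar>\<^sup>2) powr (?s - ?t) * (cmod (\<psi> x - \<psi>0 x))\<^sup>2) = 0"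
    by (subst (asm) nn_integral_0_iff_AE) auto
  \<comment> \<open>The weight is positive except at \<sigma> = 0, so norm 0 means equality almost
    everywhere.\<close>
  moreover have "AE (\<omega>, \<sigma>) in ?M. \<sigma> *\<^sub>R \<omega> \<noteq> 0"
    by (rule AE_cylinder_of_AE[OF n]) (rule AE_lborel_singleton)
  ultimately show ?thesis
  proof eventually_elim
    case (elim x)
    have "1 + \<bar>snd x\<bar>\<^sup>2 > 0" by (simp add: add_pos_nonneg)
    with elim have "\<psi> x = \<psi>0 x"
      by (auto simp: case_prod_unfold ennreal_eq_0_iff mult_le_0_iff not_le powr_def split: if_splits)
    then show ?case by (auto simp: \<psi>_def \<psi>0_def case_prod_unfold)
  qed
qed

section \<open>Density of the transforms of Schwartz functions\<close>

inductive gauss_span :: "(real^'n::finite \<Rightarrow> complex) \<Rightarrow> bool" where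
  gauss: "gauss_span (\<lambda>x. complex_of_real (exp (- ((x - b) \<bullet> (x - b)) / 2)))"
| coord: "gauss_span \<phi> \<Longrightarrow> gauss_span (\<lambda>x. complex_of_real (x $ j) * \<phi> x)"
| add: "gauss_span \<phi> \<Longrightarrow> gauss_span \<eta> \<Longrightarrow> gauss_span (\<lambda>x. \<phi> x + \<eta> x)"
| scale: "gauss_span \<phi> \<Longrightarrow> gauss_span (\<lambda>x. c * \<phi> x)"

lemma partial_eq:
  assumes "(\<phi> has_derivative D) (at x)"
  shows "\<phi> differentiable (at x)" "partial j \<phi> x = D (axis j 1)"
  using assms by (auto simp: partial_def frechet_derivative_at[symmetric] differentiable_def)

lemma has_derivative_partial:
  assumes "\<phi> differentiable (at x)"
  shows "\<exists>D. (\<phi> has_derivative D) (at x) \<and> (\<forall>j. D (axis j 1) = partial j \<phi> x)"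
  using assms unfolding partial_def by (auto simp: frechet_derivative_works)

lemma gauss_span_partial:
  assumes "gauss_span \<phi>"
  shows "(\<forall>x. \<phi> differentiable (at x)) \<and> (\<forall>j. gauss_span (partial j \<phi>))"
  using assms
proof induction
  case (gauss b)
  let ?g = "\<lambda>x. complex_of_real (exp (- ((x - b) \<bullet> (x - b)) / 2))"
  have D: "(?g has_derivative (\<lambda>h. complex_of_real (exp (- ((x - b) \<bullet> (x - b)) / 2) * - ((x - b) \<bullet> h)))) (at x)" for x
    by (auto intro!: derivative_eq_intros simp: inner_commute)
  have "partial j ?g = (\<lambda>x. (- 1) * (complex_of_real (x $ j) * ?g x) + complex_of_real (b $ j) * ?g x)" for j
    using partial_eq(2)[OF D, of j] by (auto simp: inner_axis algebra_simps fun_eq_iff)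
  then have "gauss_span (partial j ?g)" for j
    by (simp only:) (intro gauss_span.intros)
  with partial_eq(1)[OF D] show ?case by blast
next
  case (coord \<phi> k)
  have "(\<lambda>x. complex_of_real (x $ k) * \<phi> x) differentiable (at x) \<and>
     partial j (\<lambda>x. complex_of_real (x $ k) * \<phi> x) x = complex_of_real (x $ k) * partial j \<phi> x + (if j = k then 1 else 0) * \<phi> x" for x j
  proof -
    obtain D where D: "(\<phi> has_derivative D) (at x)" "\<And>j. D (axis j 1) = partial j \<phi> x"
      using has_derivative_partial[of \<phi> x] coord by blast
    have ax: "axis j (1::real) $ k = (if j = k then 1 else 0)" by (simp add: axis_def)
    have "((\<lambda>x. complex_of_real (x $ k)) has_derivative (\<lambda>h. complex_of_real (h $ k))) (at x)"
      by (intro bounded_linear_imp_has_derivative bounded_linear_compose[OF bounded_linear_of_real bounded_linear_vec_nth])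
    note d = has_derivative_mult[OF this D(1)]
    from partial_eq(1)[OF d] partial_eq(2)[OF d, of j] show ?thesis
      by (auto simp: D(2) ax)
  qed
  then have d: "(\<lambda>x. complex_of_real (x $ k) * \<phi> x) differentiable (at x)"
    and p: "partial j (\<lambda>x. complex_of_real (x $ k) * \<phi> x) = (\<lambda>x. complex_of_real (x $ k) * partial j \<phi> x + (if j = k then 1 else 0) * \<phi> x)" for x j
    by (auto simp: fun_eq_iff)
  show ?case
    unfolding p using d coord by (auto intro!: gauss_span.intros(2,3,4))
next
  case (add \<phi> \<eta>)
  have "(\<lambda>x. \<phi> x + \<eta> x) differentiable (at x) \<and>
     partial j (\<lambda>x. \<phi> x + \<eta> x) x = partial j \<phi> x + partial j \<eta> x" for x j
  proof -
    obtain D E where D: "(\<phi> has_derivative D) (at x)" "\<And>j. D (axis j 1) = partial j \<phi> x"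
        "(\<eta> has_derivative E) (at x)" "\<And>j. E (axis j 1) = partial j \<eta> x"
      using has_derivative_partial[of \<phi> x] has_derivative_partial[of \<eta> x] add by blast
    note d = has_derivative_add[OF D(1,3)]
    from partial_eq(1)[OF d] partial_eq(2)[OF d, of j] show ?thesis
      by (auto simp: D(2,4))
  qed
  then have d: "(\<lambda>x. \<phi> x + \<eta> x) differentiable (at x)"
    and p: "partial j (\<lambda>x. \<phi> x + \<eta> x) = (\<lambda>x. partial j \<phi> x + partial j \<eta> x)" for x j
    by (auto simp: fun_eq_iff)
  show ?case
    unfolding p using d add by (auto intro!: gauss_span.intros(3))
next
  case (scale \<phi> c)
  have "(\<lambda>x. c * \<phi> x) differentiable (at x) \<and>
     partial j (\<lambda>x. c * \<phi> x) x = c * partial j \<phi> x" for x j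
  proof -
    obtain D where D: "(\<phi> has_derivative D) (at x)" "\<And>j. D (axis j 1) = partial j \<phi> x"
      using has_derivative_partial[of \<phi> x] scale by blast
    note d = has_derivative_mult_right[OF D(1), of c]
    from partial_eq(1)[OF d] partial_eq(2)[OF d, of j] show ?thesis
      by (auto simp: D(2))
  qed
  then have d: "(\<lambda>x. c * \<phi> x) differentiable (at x)"
    and p: "partial j (\<lambda>x. c * \<phi> x) = (\<lambda>x. c * partial j \<phi> x)" for x j
    by (auto simp: fun_eq_iff)
  show ?case
    unfolding p using d scale by (auto intro!: gauss_span.intros(4))
qed

text \<open>Follows from (1 + x/k)^k <= exp x; it reduces the decay of Gaussians to a comparison of
  exponentials.\<close>

lemma power_le_exp:
  assumes "0 \<le> (x::real)"
  shows "x ^ k \<le> real k ^ k * exp x"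
proof (cases "k = 0")
  case False
  have "(x / real k) ^ k \<le> (1 + x / real k) ^ k"
    using assms by (intro power_mono) auto
  also have "\<dots> \<le> exp x"
    using exp_ge_one_plus_x_over_n_power_n[of k x] assms False by simp
  finally show ?thesis
    using False by (simp add: power_divide field_simps)
qed (use assms in simp)

lemma gauss_span_bound:
  assumes "gauss_span \<phi>"
  shows "\<exists>C. \<forall>x. norm x ^ k * norm (\<phi> x) \<le> C"
  using assms
proof (induction arbitrary: k)
  case (gauss b)
  have "norm x ^ k * exp (- ((x - b) \<bullet> (x - b)) / 2) \<le> real k ^ k * exp (norm b + 1 / 2)" for x
  proof -
    let ?r = "norm (x - b)"
    have "norm x \<le> ?r + norm b" using norm_triangle_ineq[of "x - b" b] by simp
    then have "norm x ^ k \<le> (?r + norm b) ^ k" by (intro power_mono) auto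
    also have "\<dots> \<le> real k ^ k * exp (?r + norm b)" by (rule power_le_exp) simp
    finally have 1: "norm x ^ k \<le> real k ^ k * exp (?r + norm b)" .
    \<comment> \<open>Completing the square bounds the Gaussian by exp (1/2 - r), which absorbs the
      growth exp r from the power.\<close>
    have "0 \<le> (?r - 1)\<^sup>2" by simp
    then have "- ((x - b) \<bullet> (x - b)) / 2 \<le> 1 / 2 - ?r"
      by (simp add: power2_norm_eq_inner[symmetric] power2_eq_square algebra_simps)
    then have "exp (- ((x - b) \<bullet> (x - b)) / 2) \<le> exp (1 / 2 - ?r)" by simp
    with 1 have "norm x ^ k * exp (- ((x - b) \<bullet> (x - b)) / 2) \<le> (real k ^ k * exp (?r + norm b)) * exp (1 / 2 - ?r)"
      by (intro mult_mono) auto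
    also have "\<dots> = real k ^ k * exp (norm b + 1 / 2)"
      by (simp add: mult.assoc flip: exp_add)
    finally show ?thesis .
  qed
  then show ?case by (auto simp: norm_of_real simp del: of_real_exp)
next
  case (coord \<phi> j)
  \<comment> \<open>One more power of |x| pays for the coordinate factor.\<close>
  then obtain C where C: "\<And>x. norm x ^ Suc k * norm (\<phi> x) \<le> C" by blast
  have "norm x ^ k * norm (complex_of_real (x $ j) * \<phi> x) \<le> C" for x
  proof -
    have "norm x ^ k * norm (complex_of_real (x $ j) * \<phi> x) = \<bar>x $ j\<bar> * (norm x ^ k * norm (\<phi> x))"
      by (simp add: norm_mult)
    also have "\<dots> \<le> norm x * (norm x ^ k * norm (\<phi> x))"
      by (intro mult_right_mono component_le_norm_cart) auto
    finally show ?thesis using C[of x] by (simp add: mult.assoc)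
  qed
  then show ?case by blast
next
  case (add \<phi> \<eta>)
  then obtain C D where C: "\<And>x. norm x ^ k * norm (\<phi> x) \<le> C" and D: "\<And>x. norm x ^ k * norm (\<eta> x) \<le> D" by metis
  have "norm x ^ k * norm (\<phi> x + \<eta> x) \<le> C + D" for x
  proof -
    have "norm x ^ k * norm (\<phi> x + \<eta> x) \<le> norm x ^ k * (norm (\<phi> x) + norm (\<eta> x))"
      by (intro mult_left_mono norm_triangle_ineq) auto
    then show ?thesis using C[of x] D[of x] by (simp add: distrib_left)
  qed
  then show ?case by blast
next
  case (scale \<phi> c)
  then obtain C where C: "\<And>x. norm x ^ k * norm (\<phi> x) \<le> C" by blast
  have "norm x ^ k * norm (c * \<phi> x) \<le> norm c * C" for x
    using mult_left_mono[OF C[of x], of "norm c"] by (simp add: norm_mult mult_ac)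
  then show ?case by blast
qed

lemma gauss_span_schwartz:
  assumes "gauss_span \<phi>"
  shows "schwartz \<phi>"
proof -
  have g: "gauss_span (foldr partial js \<phi>)" for js
    by (induction js) (use assms gauss_span_partial in auto)
  show ?thesis
    unfolding schwartz_def
  proof (intro allI conjI)
    fix js :: "'a list" and x and k :: nat
    show "foldr partial js \<phi> differentiable (at x)" using gauss_span_partial[OF g] by blast
    show "bounded (range (\<lambda>x. norm x ^ k *\<^sub>R foldr partial js \<phi> x))"
      using gauss_span_bound[OF g[of js], of k] by (auto simp: bounded_iff)
  qed
qed

lemma gauss_span_translate:
  assumes "gauss_span \<phi>"
  shows "gauss_span (\<lambda>x. \<phi> (x - c))"
  using assms
proof induction
  case (gauss b)
  show ?case using gauss_span.gauss[of "c + b"] by (simp add: algebra_simps)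
next
  case (coord \<phi> j)
  have "gauss_span (\<lambda>x. complex_of_real (x $ j) * \<phi> (x - c) + (- complex_of_real (c $ j)) * \<phi> (x - c))"
    by (intro gauss_span.add gauss_span.coord gauss_span.scale coord)
  then show ?case by (simp add: algebra_simps)
qed (auto intro: gauss_span.intros)

section \<open>Transforms of sums, translates and Gaussians\<close>

lemma fourier_add:
  assumes "integrable lborel \<phi>" "integrable lborel \<eta>"
  shows "fourier (\<lambda>x. \<phi> x + \<eta> x) y = fourier \<phi> y + fourier \<eta> y"
  using fourier_integrable[OF assms(1)] fourier_integrable[OF assms(2)]
  by (simp add: fourier_def distrib_left)

lemma fourier_scale: "fourier (\<lambda>x. c * \<phi> x) y = c * fourier \<phi> y"
  by (simp add: fourier_def mult.left_commute)

lemma fourier_translate: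
  fixes \<phi> :: "real^'n::finite \<Rightarrow> complex"
  assumes \<phi>: "integrable lborel \<phi>"
  shows "fourier (\<lambda>x. \<phi> (x - b)) y = cis (- (b \<bullet> y)) * fourier \<phi> y"
proof -
  have m: "(\<lambda>x. cis (- (x \<bullet> y)) * \<phi> (x - b)) \<in> borel_measurable borel"
  proof -
    have "continuous_on UNIV (\<lambda>x. cis (- (x \<bullet> y)))" by (intro continuous_intros)
    then have [measurable]: "(\<lambda>x. cis (- (x \<bullet> y))) \<in> borel_measurable borel"
      by (rule borel_measurable_continuous_onI)
    have [measurable]: "\<phi> \<in> borel_measurable borel" using \<phi> by simp
    show ?thesis by measurable
  qed
  have "(LINT x|lborel. cis (- (x \<bullet> y)) * \<phi> (x - b)) = (LINT x|lborel. cis (- ((b + x) \<bullet> y)) * \<phi> (b + x - b))"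
    by (subst lborel_distr_plus[of b, symmetric], subst integral_distr) (use m in auto)
  also have "\<dots> = (LINT x|lborel. cis (- (b \<bullet> y)) * (cis (- (x \<bullet> y)) * \<phi> x))"
  proof -
    have "cis (- ((b + x) \<bullet> y)) = cis (- (b \<bullet> y)) * cis (- (x \<bullet> y))" for x
      by (simp add: inner_add_left cis_mult)
    then show ?thesis by (simp only: mult.assoc) simp
  qed
  also have "\<dots> = cis (- (b \<bullet> y)) * (LINT x|lborel. cis (- (x \<bullet> y)) * \<phi> x)"
    by (rule integral_mult_right_zero)
  finally show ?thesis by (simp add: fourier_def)
qed

text \<open>Up to the factor sqrt (2 pi), this is the characteristic function of the standard normal
  distribution at -r.\<close>

lemma integral_cis_gauss:
  "(LINT x|lborel. cis (- (x * r)) * complex_of_real (exp (- (x * x) / 2))) = complex_of_real (sqrt (2 * pi) * exp (- (r * r) / 2))"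
  "integrable lborel (\<lambda>x. cis (- (x * r)) * complex_of_real (exp (- (x * x) / 2)))"
proof -
  have e: "cis (- (x * r)) * complex_of_real (exp (- (x * x) / 2)) = 
      complex_of_real (sqrt (2 * pi)) * (std_normal_density x *\<^sub>R iexp (- r * x))" for x
    by (simp add: std_normal_density_def cis_conv_exp scaleR_conv_of_real power2_eq_square mult_ac del: of_real_exp)
  have m: "(\<lambda>x. iexp (- r * x)) \<in> borel_measurable borel"
    by (intro borel_measurable_continuous_onI continuous_intros)
  have "char std_normal_distribution (- r) = (LINT x|lborel. std_normal_density x *\<^sub>R iexp (- r * x))"
    unfolding char_def by (subst integral_density) (use m in auto)
  then have i: "(LINT x|lborel. std_normal_density x *\<^sub>R iexp (- r * x)) = complex_of_real (exp (- (r * r) / 2))"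
    by (simp add: char_std_normal_distribution power2_eq_square)
  show "(LINT x|lborel. cis (- (x * r)) * complex_of_real (exp (- (x * x) / 2))) = complex_of_real (sqrt (2 * pi) * exp (- (r * r) / 2))"
    unfolding e integral_mult_right_zero i by simp
  have "integrable lborel std_normal_density" by (rule integrable_normal_density) simp
  then have "integrable lborel (\<lambda>x. std_normal_density x *\<^sub>R iexp (- r * x))"
    by (rule Bochner_Integration.integrable_bound) (use m in \<open>auto simp: norm_mult\<close>)
  then show "integrable lborel (\<lambda>x. cis (- (x * r)) * complex_of_real (exp (- (x * x) / 2)))"
    unfolding e by (rule integrable_mult_right)
qed

text \<open>The integrand is a product over the coordinates, so Fubini reduces it to dimension one.
  The resulting (2 pi)^(n/2) cancels the unitary normalization, which makes this Gaussian its own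
  transform.\<close>

lemma fourier_gauss:
  "fourier (\<lambda>x :: real^'n::finite. complex_of_real (exp (- (x \<bullet> x) / 2))) y = complex_of_real (exp (- (y \<bullet> y) / 2))"
proof -
  interpret product_sigma_finite "\<lambda>_ :: real^'n. lborel :: real measure" by standard
  let ?f = "\<lambda>b r. cis (- (r * (y \<bullet> b))) * complex_of_real (exp (- (r * r) / 2))"
  have prod: "cis (- (x \<bullet> y)) * complex_of_real (exp (- (x \<bullet> x) / 2)) = (\<Prod>b\<in>Basis. ?f b (x \<bullet> b))" for x :: "real^'n"
  proof -
    have "(\<Prod>b\<in>Basis. ?f b (x \<bullet> b)) = exp (\<Sum>b\<in>Basis. \<i> * complex_of_real (- (x \<bullet> b * (y \<bullet> b))) + complex_of_real (- (x \<bullet> b * (x \<bullet> b)) / 2))"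
      by (simp only: exp_sum finite_Basis cis_conv_exp exp_add exp_of_real)
    also have "(\<Sum>b\<in>Basis. \<i> * complex_of_real (- (x \<bullet> b * (y \<bullet> b))) + complex_of_real (- (x \<bullet> b * (x \<bullet> b)) / 2))
       = \<i> * complex_of_real (- (x \<bullet> y)) + complex_of_real (- (x \<bullet> x) / 2)"
      by (simp only: euclidean_inner[of x y] euclidean_inner[of x x] sum.distrib of_real_minus of_real_divide of_real_sum
          sum_negf sum_distrib_left sum_divide_distrib mult_minus_right minus_divide_left[symmetric])
    finally show ?thesis
      by (simp only: cis_conv_exp exp_add exp_of_real)
  qed
  have m: "(\<lambda>x :: real^'n. \<Prod>b\<in>Basis. ?f b (x \<bullet> b)) \<in> borel_measurable borel"
    unfolding prod[symmetric] by (intro borel_measurable_continuous_onI continuous_intros) simp_all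
  have "(LINT x|lborel. cis (- (x \<bullet> y)) * complex_of_real (exp (- (x \<bullet> x) / 2))) = (LINT x|lborel. (\<Prod>b\<in>Basis. ?f b ((x :: real^'n) \<bullet> b)))"
    unfolding prod ..
  also have "\<dots> = (LINT f|(\<Pi>\<^sub>M b\<in>Basis. lborel). (\<Prod>b\<in>Basis. ?f b ((\<Sum>c\<in>Basis. f c *\<^sub>R (c :: real^'n)) \<bullet> b)))"
    unfolding lborel_eq[where 'a="real^'n"] by (subst integral_distr) (use m in auto)
  also have "\<dots> = (LINT f|(\<Pi>\<^sub>M b\<in>Basis. lborel). (\<Prod>b\<in>Basis. ?f b (f b)))"
    by (intro Bochner_Integration.integral_cong refl prod.cong) simp
  also have "\<dots> = (\<Prod>b\<in>Basis. (LINT r|lborel. ?f b r))"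
    by (intro product_integral_prod finite_Basis integral_cis_gauss(2))
  also have "\<dots> = (\<Prod>b\<in>Basis. complex_of_real (sqrt (2 * pi) * exp (- ((y \<bullet> b) * (y \<bullet> b)) / 2)))"
    by (simp only: integral_cis_gauss(1))
  also have "\<dots> = complex_of_real (sqrt (2 * pi) ^ CARD('n) * exp (- (y \<bullet> y) / 2))"
  proof -
    have "(\<Prod>b\<in>Basis. sqrt (2 * pi) * exp (- ((y \<bullet> b) * (y \<bullet> b)) / 2)) =
        sqrt (2 * pi) ^ CARD('n) * exp (\<Sum>b\<in>Basis. - ((y \<bullet> b) * (y \<bullet> b)) / 2)"
      by (simp only: prod.distrib exp_sum finite_Basis prod_constant) simp
    also have "(\<Sum>b\<in>Basis. - ((y \<bullet> b) * (y \<bullet> b)) / 2) = - (y \<bullet> y) / 2"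
      by (simp only: euclidean_inner[of y y] sum_negf sum_divide_distrib[symmetric])
    finally show ?thesis by (simp only: of_real_prod[symmetric])
  qed
  finally have i: "(LINT x|lborel. cis (- (x \<bullet> y)) * complex_of_real (exp (- (x \<bullet> x) / 2)))
     = complex_of_real (sqrt (2 * pi) ^ CARD('n) * exp (- (y \<bullet> y) / 2))" .
  have "sqrt (2 * pi) ^ CARD('n) = (2 * pi) powr (1 / 2 * real CARD('n))"
    by (subst powr_powr[symmetric], subst powr_realpow) (auto simp: powr_half_sqrt)
  then have "(2 * pi) powr (- real CARD('n) / 2) * sqrt (2 * pi) ^ CARD('n) = 1"
    by (simp flip: powr_add)
  then show ?thesis
    unfolding fourier_def i by (simp add: mult.assoc[symmetric] flip: of_real_mult of_real_power)
qed

section \<open>The weighted norm and the closure of the transforms of Gaussians\<close>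

lemma sobolev_sqnorm_triangle:
  assumes [measurable]: "u \<in> borel_measurable borel" "v \<in> borel_measurable borel" "w \<in> borel_measurable borel"
  shows "sobolev_sqnorm s t (\<lambda>y. u y - v y) \<le> 2 * sobolev_sqnorm s t (\<lambda>y. w y - u y) + 2 * sobolev_sqnorm s t (\<lambda>y. w y - v y)"
proof -
  let ?w = "\<lambda>y. norm y powr (2 * t) * (1 + (norm y)\<^sup>2) powr (s - t)"
  have "sobolev_sqnorm s t (\<lambda>y. u y - v y) \<le> (\<integral>\<^sup>+y. 2 * ennreal (?w y * (cmod (w y - u y))\<^sup>2) + 2 * ennreal (?w y * (cmod (w y - v y))\<^sup>2) \<partial>lborel)"
    unfolding sobolev_sqnorm_def by (intro nn_integral_mono ennreal_mult_norm_diff_sq_le) auto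
  also have "\<dots> = 2 * sobolev_sqnorm s t (\<lambda>y. w y - u y) + 2 * sobolev_sqnorm s t (\<lambda>y. w y - v y)"
    by (simp add: sobolev_sqnorm_def nn_integral_add nn_integral_cmult)
  finally show ?thesis .
qed

lemma sobolev_sqnorm_minus_commute:
  "sobolev_sqnorm s t (\<lambda>y. u y - v y) = sobolev_sqnorm s t (\<lambda>y. v y - u y)"
  by (simp add: sobolev_sqnorm_def norm_minus_commute)

lemma sobolev_sqnorm_mono:
  assumes "\<And>y. norm (u y) \<le> norm (v y)"
  shows "sobolev_sqnorm s t u \<le> sobolev_sqnorm s t v"
  unfolding sobolev_sqnorm_def
  by (intro nn_integral_mono ennreal_leI mult_left_mono power_mono assms) auto

lemma sobolev_sqnorm_scale:
  assumes [measurable]: "u \<in> borel_measurable borel"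
  shows "sobolev_sqnorm s t (\<lambda>y. c * u y) = ennreal ((norm c)\<^sup>2) * sobolev_sqnorm s t u"
proof -
  have "ennreal (norm y powr (2 * t) * (1 + (norm y)\<^sup>2) powr (s - t) * (norm (c * u y))\<^sup>2) =
     ennreal ((norm c)\<^sup>2) * ennreal (norm y powr (2 * t) * (1 + (norm y)\<^sup>2) powr (s - t) * (norm (u y))\<^sup>2)" for y
    by (subst ennreal_mult[symmetric]) (auto simp: norm_mult power_mult_distrib mult_ac)
  then show ?thesis
    unfolding sobolev_sqnorm_def by (simp only:) (rule nn_integral_cmult, measurable)
qed

lemma sobolev_sqnorm_dominated_convergence:
  fixes u :: "nat \<Rightarrow> real^'n::finite \<Rightarrow> complex"
  assumes [measurable]: "\<And>k. u k \<in> borel_measurable borel" "U \<in> borel_measurable borel" "V \<in> borel_measurable borel"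
    and V: "sobolev_sqnorm s t V < \<infinity>" and bound: "\<And>k y. norm (u k y - U y) \<le> norm (V y)"
    and lim: "\<And>y. (\<lambda>k. u k y) \<longlonglongrightarrow> U y"
  shows "(\<lambda>k. sobolev_sqnorm s t (\<lambda>y. u k y - U y)) \<longlonglongrightarrow> 0"
proof -
  let ?w = "\<lambda>y :: real^'n. norm y powr (2 * t) * (1 + (norm y)\<^sup>2) powr (s - t)"
  have "(\<lambda>k. \<integral>\<^sup>+y. ennreal (?w y * (cmod (u k y - U y))\<^sup>2) \<partial>lborel) \<longlonglongrightarrow> (\<integral>\<^sup>+y. 0 \<partial>(lborel :: (real^'n) measure))"
  proof (rule nn_integral_dominated_convergence)
    show "AE y in lborel. ennreal (?w y * (cmod (u k y - U y))\<^sup>2) \<le> ennreal (?w y * (cmod (V y))\<^sup>2)" for k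
      by (intro AE_I2 ennreal_leI mult_left_mono power_mono bound) auto
    show "(\<integral>\<^sup>+y. ennreal (?w y * (cmod (V y))\<^sup>2) \<partial>lborel) < \<infinity>"
      using V by (simp add: sobolev_sqnorm_def)
    have "(\<lambda>k. ennreal (?w y * (cmod (u k y - U y))\<^sup>2)) \<longlonglongrightarrow> ennreal (?w y * (cmod (U y - U y))\<^sup>2)" for y
      by (intro tendsto_ennrealI tendsto_intros lim)
    then show "AE y in lborel. (\<lambda>k. ennreal (?w y * (cmod (u k y - U y))\<^sup>2)) \<longlonglongrightarrow> 0"
      by simp
  qed measurable
  then show ?thesis by (simp add: sobolev_sqnorm_def)
qed

text \<open>The closure of the transforms of \<open>gauss_span\<close> in the weighted norm. The aim
  is that it contains every measurable function of finite norm.\<close>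

definition gauss_approx :: "real \<Rightarrow> real \<Rightarrow> (real^'n::finite \<Rightarrow> complex) \<Rightarrow> bool" where
  "gauss_approx s t u \<longleftrightarrow> u \<in> borel_measurable borel \<and>
     (\<forall>\<epsilon>>0. \<exists>\<phi>. gauss_span \<phi> \<and> sobolev_sqnorm s t (\<lambda>y. fourier \<phi> y - u y) \<le> ennreal \<epsilon>)"

lemma gauss_span_measurable [measurable_dest]: "gauss_span \<phi> \<Longrightarrow> \<phi> \<in> borel_measurable borel"
  by (rule schwartz_measurable[OF gauss_span_schwartz])

lemma gauss_span_integrable: "gauss_span \<phi> \<Longrightarrow> integrable lborel \<phi>"
  by (rule schwartz_integrable[OF gauss_span_schwartz])

lemma gauss_approxD:
  assumes "gauss_approx s t u" "\<epsilon> > 0"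
  obtains \<phi> where "gauss_span \<phi>" "sobolev_sqnorm s t (\<lambda>y. fourier \<phi> y - u y) \<le> ennreal \<epsilon>"
  using assms unfolding gauss_approx_def by blast

lemma ennreal_quarters:
  assumes "a \<le> ennreal (\<epsilon> / 4)" "b \<le> ennreal (\<epsilon> / 4)" "\<epsilon> > 0"
  shows "2 * a + 2 * b \<le> ennreal \<epsilon>"
proof -
  have "2 * a + 2 * b \<le> 2 * ennreal (\<epsilon> / 4) + 2 * ennreal (\<epsilon> / 4)"
    using assms by (intro add_mono mult_left_mono) auto
  also have "\<dots> = ennreal \<epsilon>"
  proof -
    have "2 * ennreal (\<epsilon> / 4) = ennreal (2 * (\<epsilon> / 4))"
      using assms(3) by (subst ennreal_mult) auto
    then show ?thesis
      using assms(3) by (simp flip: ennreal_plus)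
  qed
  finally show ?thesis .
qed

lemma gauss_approx_limit:
  assumes u: "\<And>k. gauss_approx s t (u k)" and [measurable]: "U \<in> borel_measurable borel"
    and lim: "(\<lambda>k. sobolev_sqnorm s t (\<lambda>y. u k y - U y)) \<longlonglongrightarrow> 0"
  shows "gauss_approx s t U"
  unfolding gauss_approx_def
proof (intro conjI allI impI)
  fix \<epsilon> :: real assume \<epsilon>: "\<epsilon> > 0"
  then have "eventually (\<lambda>k. sobolev_sqnorm s t (\<lambda>y. u k y - U y) < ennreal (\<epsilon> / 4)) sequentially"
    using lim by (intro order_tendstoD(2)) auto
  then obtain k where k: "sobolev_sqnorm s t (\<lambda>y. u k y - U y) < ennreal (\<epsilon> / 4)"
    by (auto simp: eventually_sequentially)
  obtain \<phi> where \<phi>: "gauss_span \<phi>" "sobolev_sqnorm s t (\<lambda>y. fourier \<phi> y - u k y) \<le> ennreal (\<epsilon> / 4)"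
    using gauss_approxD[OF u[of k], of "\<epsilon> / 4"] \<epsilon> by auto
  have [measurable]: "\<phi> \<in> borel_measurable borel" "u k \<in> borel_measurable borel"
    using \<phi>(1) u[of k] by (auto simp: gauss_approx_def gauss_span_measurable)
  have "sobolev_sqnorm s t (\<lambda>y. fourier \<phi> y - U y) \<le> 2 * sobolev_sqnorm s t (\<lambda>y. u k y - fourier \<phi> y) + 2 * sobolev_sqnorm s t (\<lambda>y. u k y - U y)"
    by (rule sobolev_sqnorm_triangle) measurable
  also have "\<dots> \<le> ennreal \<epsilon>"
    using \<phi>(2) k \<epsilon> by (intro ennreal_quarters) (auto simp: sobolev_sqnorm_minus_commute[of s t "u k"])
  finally show "\<exists>\<phi>. gauss_span \<phi> \<and> sobolev_sqnorm s t (\<lambda>y. fourier \<phi> y - U y) \<le> ennreal \<epsilon>"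
    using \<phi>(1) by blast
qed measurable

lemma gauss_approx_add:
  assumes u: "gauss_approx s t u" and v: "gauss_approx s t v"
  shows "gauss_approx s t (\<lambda>y. u y + v y)"
  unfolding gauss_approx_def
proof (intro conjI allI impI)
  have [measurable]: "u \<in> borel_measurable borel" "v \<in> borel_measurable borel"
    using u v by (auto simp: gauss_approx_def)
  show "(\<lambda>y. u y + v y) \<in> borel_measurable borel" by measurable
  fix \<epsilon> :: real assume \<epsilon>: "\<epsilon> > 0"
  obtain \<phi> where \<phi>: "gauss_span \<phi>" "sobolev_sqnorm s t (\<lambda>y. fourier \<phi> y - u y) \<le> ennreal (\<epsilon> / 4)"
    using gauss_approxD[OF u, of "\<epsilon> / 4"] \<epsilon> by auto
  obtain \<eta> where \<eta>: "gauss_span \<eta>" "sobolev_sqnorm s t (\<lambda>y. fourier \<eta> y - v y) \<le> ennreal (\<epsilon> / 4)"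
    using gauss_approxD[OF v, of "\<epsilon> / 4"] \<epsilon> by auto
  have [measurable]: "\<phi> \<in> borel_measurable borel" "\<eta> \<in> borel_measurable borel"
    using \<phi>(1) \<eta>(1) by (auto simp: gauss_span_measurable)
  \<comment> \<open>The middle function differs from each of the two ends by one of the
    approximation errors.\<close>
  have "sobolev_sqnorm s t (\<lambda>y. (fourier \<phi> y + fourier \<eta> y) - (u y + v y)) \<le>
      2 * sobolev_sqnorm s t (\<lambda>y. (u y + fourier \<eta> y) - (fourier \<phi> y + fourier \<eta> y)) +
      2 * sobolev_sqnorm s t (\<lambda>y. (u y + fourier \<eta> y) - (u y + v y))"
    by (rule sobolev_sqnorm_triangle) measurable
  also have "\<dots> \<le> ennreal \<epsilon>"
    using \<phi>(2) \<eta>(2) \<epsilon> by (intro ennreal_quarters) (auto simp: sobolev_sqnorm_minus_commute[of s t u])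
  finally show "\<exists>\<phi>. gauss_span \<phi> \<and> sobolev_sqnorm s t (\<lambda>y. fourier \<phi> y - (u y + v y)) \<le> ennreal \<epsilon>"
    using \<phi>(1) \<eta>(1)
    by (intro exI[of _ "\<lambda>x. \<phi> x + \<eta> x"]) (auto intro: gauss_span.intros simp: fourier_add gauss_span_integrable)
qed

lemma gauss_approx_scale:
  assumes u: "gauss_approx s t u"
  shows "gauss_approx s t (\<lambda>y. c * u y)"
  unfolding gauss_approx_def
proof (intro conjI allI impI)
  have [measurable]: "u \<in> borel_measurable borel"
    using u by (auto simp: gauss_approx_def)
  show "(\<lambda>y. c * u y) \<in> borel_measurable borel" by measurable
  fix \<epsilon> :: real assume \<epsilon>: "\<epsilon> > 0"
  \<comment> \<open>The added 1 in the denominator covers c = 0.\<close>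
  let ?\<delta> = "\<epsilon> / (1 + (norm c)\<^sup>2)"
  have p: "1 + (norm c)\<^sup>2 > 0" by (simp add: add_pos_nonneg)
  then have \<delta>: "?\<delta> > 0" using \<epsilon> by simp
  obtain \<phi> where \<phi>: "gauss_span \<phi>" "sobolev_sqnorm s t (\<lambda>y. fourier \<phi> y - u y) \<le> ennreal ?\<delta>"
    using gauss_approxD[OF u \<delta>] by blast
  have [measurable]: "\<phi> \<in> borel_measurable borel" using \<phi>(1) by (rule gauss_span_measurable)
  have "sobolev_sqnorm s t (\<lambda>y. c * (fourier \<phi> y - u y)) = ennreal ((norm c)\<^sup>2) * sobolev_sqnorm s t (\<lambda>y. fourier \<phi> y - u y)"
    by (rule sobolev_sqnorm_scale) measurable
  also have "\<dots> \<le> ennreal ((norm c)\<^sup>2) * ennreal ?\<delta>"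
    by (intro mult_left_mono \<phi>) simp
  also have "\<dots> = ennreal ((norm c)\<^sup>2 * ?\<delta>)"
    using \<delta> by (intro ennreal_mult[symmetric]) auto
  also have "\<dots> \<le> ennreal \<epsilon>"
    using p \<epsilon> by (intro ennreal_leI) (simp add: divide_le_eq)
  finally show "\<exists>\<phi>. gauss_span \<phi> \<and> sobolev_sqnorm s t (\<lambda>y. fourier \<phi> y - c * u y) \<le> ennreal \<epsilon>"
    using \<phi>(1) by (intro exI[of _ "\<lambda>x. c * \<phi> x"]) (auto intro: gauss_span.intros simp: fourier_scale right_diff_distrib)
qed

section \<open>Trigonometric polynomials times the Gaussian\<close>

abbreviation gauss0 :: "real^'n::finite \<Rightarrow> complex" where
  "gauss0 y \<equiv> complex_of_real (exp (- (y \<bullet> y) / 2))"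

lemma gauss_span_gauss0: "gauss_span gauss0"
  using gauss_span.gauss[of 0] by simp

definition gauss_exact :: "(real^'n::finite \<Rightarrow> complex) \<Rightarrow> bool" where
  "gauss_exact h \<longleftrightarrow> (\<exists>\<phi>. gauss_span \<phi> \<and> (\<forall>y. fourier \<phi> y = h y * gauss0 y))"

text \<open>Stated for multipliers, the property is closed under products by composition, whereas
  for \<open>gauss_exact\<close> only sums and scalar multiples are immediate. Applying a multiplier
  to the constant 1 leads back to \<open>gauss_exact\<close>.\<close>

definition gauss_multiplier :: "(real^'n::finite \<Rightarrow> complex) \<Rightarrow> bool" where
  "gauss_multiplier h \<longleftrightarrow> (\<forall>u. gauss_exact u \<longrightarrow> gauss_exact (\<lambda>y. h y * u y))"

lemma gauss_exact_1: "gauss_exact (\<lambda>y. 1)"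
  unfolding gauss_exact_def using gauss_span_gauss0 fourier_gauss by (intro exI[of _ gauss0]) auto

lemma gauss_exact_add:
  assumes "gauss_exact u" "gauss_exact v"
  shows "gauss_exact (\<lambda>y. u y + v y)"
proof -
  obtain \<phi> \<eta> where "gauss_span \<phi>" "\<forall>y. fourier \<phi> y = u y * gauss0 y" "gauss_span \<eta>" "\<forall>y. fourier \<eta> y = v y * gauss0 y"
    using assms unfolding gauss_exact_def by blast
  then show ?thesis
    unfolding gauss_exact_def
    by (intro exI[of _ "\<lambda>x. \<phi> x + \<eta> x"]) (simp add: gauss_span.add fourier_add gauss_span_integrable distrib_right)
qed

lemma gauss_exact_scale:
  assumes "gauss_exact u"
  shows "gauss_exact (\<lambda>y. c * u y)"
proof -
  obtain \<phi> where "gauss_span \<phi>" "\<forall>y. fourier \<phi> y = u y * gauss0 y"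
    using assms unfolding gauss_exact_def by blast
  then show ?thesis
    unfolding gauss_exact_def
    by (intro exI[of _ "\<lambda>x. c * \<phi> x"]) (simp add: gauss_span.scale fourier_scale)
qed

lemma gauss_multiplier_const: "gauss_multiplier (\<lambda>y. c)"
  unfolding gauss_multiplier_def using gauss_exact_scale by blast

lemma gauss_multiplier_add:
  "gauss_multiplier h \<Longrightarrow> gauss_multiplier k \<Longrightarrow> gauss_multiplier (\<lambda>y. h y + k y)"
  unfolding gauss_multiplier_def by (simp add: distrib_right gauss_exact_add)

lemma gauss_multiplier_mult:
  "gauss_multiplier h \<Longrightarrow> gauss_multiplier k \<Longrightarrow> gauss_multiplier (\<lambda>y. h y * k y)"
  unfolding gauss_multiplier_def by (simp add: mult.assoc)

lemma gauss_multiplier_sum: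
  "(\<And>i. i \<in> I \<Longrightarrow> gauss_multiplier (h i)) \<Longrightarrow> gauss_multiplier (\<lambda>y. \<Sum>i\<in>I. h i y)"
  by (induction I rule: infinite_finite_induct) (auto intro: gauss_multiplier_const gauss_multiplier_add)

text \<open>Multiplying by a character corresponds to a translation before the transform, and
  \<open>gauss_span\<close> is closed under translation.\<close>

lemma gauss_multiplier_cis: "gauss_multiplier (\<lambda>y. cis (b \<bullet> y))"
  unfolding gauss_multiplier_def
proof (intro allI impI)
  fix u :: "real^'a \<Rightarrow> complex" assume "gauss_exact u"
  then obtain \<phi> where "gauss_span \<phi>" "\<forall>y. fourier \<phi> y = u y * gauss0 y"
    unfolding gauss_exact_def by blast
  then show "gauss_exact (\<lambda>y. cis (b \<bullet> y) * u y)"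
    unfolding gauss_exact_def
    using fourier_translate[of \<phi> "- b"] gauss_span_translate[of \<phi> "- b"]
    by (intro exI[of _ "\<lambda>x. \<phi> (x - (- b))"]) (simp add: gauss_span_integrable)
qed

lemma gauss_multiplier_sin: "gauss_multiplier (\<lambda>y. complex_of_real (sin (b \<bullet> y)))"
proof -
  have "complex_of_real (sin (b \<bullet> y)) = (- \<i> / 2) * cis (b \<bullet> y) + (\<i> / 2) * cis ((- b) \<bullet> y)" for y
    by (simp add: complex_eq_iff)
  then show ?thesis
    by (simp only:) (intro gauss_multiplier_add gauss_multiplier_mult gauss_multiplier_const gauss_multiplier_cis)
qed

text \<open>Substituting N sin (y_j / N) for the variables makes a trigonometric polynomial out of p
  and maps the whole space into a compact cube. Thus polynomial approximation on the cube becomes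
  uniform approximation on the whole space.\<close>

lemma gauss_multiplier_polynomial:
  fixes p :: "real^'n::finite \<Rightarrow> real"
  assumes "real_polynomial_function p"
  shows "gauss_multiplier (\<lambda>y :: real^'n. complex_of_real (p (vec_lambda (\<lambda>j. N * sin (y $ j / N)))))"
  using assms
proof induction
  case (linear f)
  have "f (vec_lambda (\<lambda>j. N * sin (y $ j / N))) = (\<Sum>j\<in>UNIV. (N * f (axis j 1)) * sin (axis j (1 / N) \<bullet> y))" for y :: "real^'n"
  proof -
    have "vec_lambda (\<lambda>j. N * sin (y $ j / N)) = (\<Sum>j\<in>UNIV. (N * sin (y $ j / N)) *\<^sub>R axis j 1)"
      using basis_expansion[of "vec_lambda (\<lambda>j. N * sin (y $ j / N))"] by (simp add: scalar_mult_eq_scaleR)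
    then have "f (vec_lambda (\<lambda>j. N * sin (y $ j / N))) = (\<Sum>j\<in>UNIV. (N * sin (y $ j / N)) * f (axis j 1))"
      using linear bounded_linear.linear[OF linear] by (simp add: linear_sum linear_scale)
    then show ?thesis by (simp add: inner_axis' mult_ac)
  qed
  then have e: "complex_of_real (f (vec_lambda (\<lambda>j. N * sin (y $ j / N)))) =
     (\<Sum>j\<in>UNIV. complex_of_real (N * f (axis j 1)) * complex_of_real (sin (axis j (1 / N) \<bullet> y)))" for y :: "real^'n"
    by simp
  show ?case
    unfolding e by (intro gauss_multiplier_sum gauss_multiplier_mult gauss_multiplier_const gauss_multiplier_sin)
qed (auto simp only: of_real_add of_real_mult intro: gauss_multiplier_const gauss_multiplier_add gauss_multiplier_mult)

section \<open>Bounded measurable functions times the Gaussian\<close>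

definition dens :: "real \<Rightarrow> real \<Rightarrow> (real^'n::finite \<Rightarrow> complex) \<Rightarrow> bool" where
  "dens s t h \<longleftrightarrow> h \<in> borel_measurable borel \<and> gauss_approx s t (\<lambda>y. h y * gauss0 y)"

lemma dens_multiplier:
  assumes "gauss_multiplier h"
  shows "dens s t h"
proof -
  obtain \<phi> where \<phi>: "gauss_span \<phi>" "\<And>y. fourier \<phi> y = h y * gauss0 y"
  proof -
    have "gauss_exact (\<lambda>y. h y * 1)"
      using assms gauss_exact_1 unfolding gauss_multiplier_def by blast
    then show ?thesis using that unfolding gauss_exact_def by auto
  qed
  have [measurable]: "\<phi> \<in> borel_measurable borel" using \<phi>(1) by (rule gauss_span_measurable)
  have h: "h = (\<lambda>y. fourier \<phi> y / gauss0 y)" using \<phi>(2) by (auto simp: fun_eq_iff)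
  have "h \<in> borel_measurable borel" unfolding h by measurable
  moreover have "gauss_approx s t (\<lambda>y. h y * gauss0 y)"
    unfolding gauss_approx_def using \<phi> \<open>h \<in> _\<close>
    by (auto intro!: exI[of _ \<phi>] simp: sobolev_sqnorm_def)
  ultimately show ?thesis by (simp add: dens_def)
qed

lemma dens_add: "dens s t h \<Longrightarrow> dens s t k \<Longrightarrow> dens s t (\<lambda>y. h y + k y)"
  unfolding dens_def by (auto simp: distrib_right intro: gauss_approx_add)

lemma dens_scale: "dens s t h \<Longrightarrow> dens s t (\<lambda>y. c * h y)"
  unfolding dens_def by (auto simp: mult.assoc intro: gauss_approx_scale)

lemma dens_sum:
  "(\<And>i. i \<in> I \<Longrightarrow> dens s t (h i)) \<Longrightarrow> dens s t (\<lambda>y. \<Sum>i\<in>I. h i y)"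
  by (induction I rule: infinite_finite_induct)
     (auto intro: dens_multiplier[OF gauss_multiplier_const] dens_add)

text \<open>Dominated convergence with 2B times the Gaussian as majorant. The passages to continuous
  functions, to indicators and to bounded measurable functions all rest on it.\<close>

lemma dens_limit:
  fixes h :: "nat \<Rightarrow> real^'n::finite \<Rightarrow> complex"
  assumes t: "t > - real CARD('n) / 2" and h: "\<And>k. dens s t (h k)"
    and bound: "\<And>k y. norm (h k y) \<le> B" and lim: "\<And>y. (\<lambda>k. h k y) \<longlonglongrightarrow> H y"
  shows "dens s t H"
proof -
  have [measurable]: "h k \<in> borel_measurable borel" for k using h by (simp add: dens_def)
  have [measurable]: "H \<in> borel_measurable borel"
    by (rule borel_measurable_LIMSEQ_metric[of h]) (auto simp: lim)
  have B: "norm (H y) \<le> B" for y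
    by (rule tendsto_upperbound[OF tendsto_norm[OF lim]]) (auto simp: bound)
  have B0: "B \<ge> 0" using order_trans[OF norm_ge_zero B] .
  \<comment> \<open>The majorant is itself the transform of a Schwartz function, hence of finite
    norm.\<close>
  have V: "(\<lambda>y :: real^'n. complex_of_real (2 * B) * gauss0 y) = fourier (\<lambda>y. complex_of_real (2 * B) * gauss0 y)"
    by (rule ext) (simp only: fourier_scale fourier_gauss)
  have "gauss_approx s t (\<lambda>y. H y * gauss0 y)"
  proof (rule gauss_approx_limit)
    show "gauss_approx s t (\<lambda>y. h k y * gauss0 y)" for k using h by (simp add: dens_def)
    show "(\<lambda>k. sobolev_sqnorm s t (\<lambda>y. h k y * gauss0 y - H y * gauss0 y)) \<longlonglongrightarrow> 0"
    proof (rule sobolev_sqnorm_dominated_convergence)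
      show "sobolev_sqnorm s t (\<lambda>y :: real^'n. complex_of_real (2 * B) * gauss0 y) < \<infinity>"
        by (subst V) (intro sobolev_sqnorm_fourier_finite[OF t] gauss_span_schwartz gauss_span.scale gauss_span_gauss0)
      show "norm (h k y * gauss0 y - H y * gauss0 y) \<le> norm (complex_of_real (2 * B) * gauss0 y)" for k y
      proof -
        have "norm (h k y - H y) \<le> 2 * B"
          using norm_triangle_ineq4[of "h k y" "H y"] bound[of k y] B[of y] by simp
        then have "norm (h k y - H y) * norm (gauss0 y) \<le> 2 * B * norm (gauss0 y)"
          by (rule mult_right_mono) simp
        then show ?thesis using B0 by (simp add: norm_mult flip: left_diff_distrib)
      qed
      show "(\<lambda>k. h k y * gauss0 y) \<longlonglongrightarrow> H y * gauss0 y" for y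
        by (intro tendsto_intros lim)
    qed measurable
  qed measurable
  then show ?thesis by (simp add: dens_def)
qed

lemma tendsto_scaled_sin: "(\<lambda>k. real (Suc k) * sin (r / real (Suc k))) \<longlonglongrightarrow> r"
proof (cases "r = 0")
  case False
  have "(\<lambda>k. r / real (Suc k)) \<longlonglongrightarrow> 0"
    using tendsto_mult[OF tendsto_const[of r] LIMSEQ_inverse_real_of_nat] by (simp add: divide_inverse)
  then have "filterlim (\<lambda>k. r / real (Suc k)) (at 0) sequentially"
    using False by (simp add: filterlim_at del: of_nat_Suc)
  moreover have "((\<lambda>x::real. sin x / x) \<longlongrightarrow> 1) (at 0)"
    using DERIV_sin[of 0] by (simp add: DERIV_def)
  ultimately have "(\<lambda>k. sin (r / real (Suc k)) / (r / real (Suc k))) \<longlonglongrightarrow> 1"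
    by (rule filterlim_compose[rotated])
  then have "(\<lambda>k. r * (sin (r / real (Suc k)) / (r / real (Suc k)))) \<longlonglongrightarrow> r * 1"
    by (intro tendsto_mult[OF tendsto_const])
  moreover have "r * (sin (r / real (Suc k)) / (r / real (Suc k))) = real (Suc k) * sin (r / real (Suc k))" for k
    using False by (simp del: of_nat_Suc)
  ultimately show ?thesis by (simp only: mult_1_right)
qed simp

text \<open>Two limits: for fixed k, polynomials approximate f uniformly on the cube containing the
  range of \<open>q k\<close>; then k grows and \<open>q k y\<close> tends to y. The bound on f
  keeps both limits bounded.\<close>

lemma dens_continuous:
  fixes f :: "real^'n::finite \<Rightarrow> real"
  assumes t: "t > - real CARD('n) / 2" and cont: "continuous_on UNIV f" and bound: "\<And>y. \<bar>f y\<bar> \<le> B"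
  shows "dens s t (\<lambda>y. complex_of_real (f y))"
proof -
  define q where "q k y = (vec_lambda (\<lambda>j. real (Suc k) * sin (y $ j / real (Suc k))) :: real^'n)" for k and y :: "real^'n"
  have "dens s t (\<lambda>y. complex_of_real (f (q k y)))" for k
  proof -
    let ?S = "{x :: real^'n. \<forall>j. x $ j \<in> {- real (Suc k) .. real (Suc k)}}"
    have S: "?S = cbox (vec_lambda (\<lambda>_. - real (Suc k))) (vec_lambda (\<lambda>_. real (Suc k)))"
      by (auto simp: mem_box_cart)
    have q: "q k y \<in> ?S" for y
    proof -
      have "\<bar>real (Suc k) * sin r\<bar> \<le> real (Suc k)" for r
        using abs_sin_le_one[of r] by (simp add: abs_mult mult_left_le del: of_nat_Suc)
      then show ?thesis by (simp add: q_def abs_le_iff minus_le_iff del: of_nat_Suc)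
    qed
    have "\<exists>p. real_polynomial_function p \<and> (\<forall>x\<in>?S. \<bar>f x - p x\<bar> < inverse (real (Suc i)))" for i
    proof -
      have "compact ?S" unfolding S by (rule compact_cbox)
      moreover have "continuous_on ?S f" using cont continuous_on_subset by blast
      ultimately show ?thesis
        by (rule Stone_Weierstrass_real_polynomial_function[of ?S f "inverse (real (Suc i))"]) auto
    qed
    then obtain p where p: "\<And>i. real_polynomial_function (p i)" "\<And>i x. x \<in> ?S \<Longrightarrow> \<bar>f x - p i x\<bar> < inverse (real (Suc i))"
      by metis
    show ?thesis
    proof (rule dens_limit[OF t])
      show "dens s t (\<lambda>y. complex_of_real (p i (q k y)))" for i
        unfolding q_def by (rule dens_multiplier[OF gauss_multiplier_polynomial[OF p(1)]])
      show "norm (complex_of_real (p i (q k y))) \<le> B + 1" for i y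
      proof -
        have "inverse (real (Suc i)) \<le> 1" by (simp add: inverse_le_1_iff)
        then show ?thesis using p(2)[OF q[of y], of i] bound[of "q k y"] by simp
      qed
      show "(\<lambda>i. complex_of_real (p i (q k y))) \<longlonglongrightarrow> complex_of_real (f (q k y))" for y
      proof (intro tendsto_of_real)
        have "(\<lambda>i. f (q k y) - p i (q k y)) \<longlonglongrightarrow> 0"
          by (rule Lim_null_comparison[OF _ LIMSEQ_inverse_real_of_nat])
             (use p(2)[OF q[of y]] in \<open>auto intro!: always_eventually less_imp_le\<close>)
        then show "(\<lambda>i. p i (q k y)) \<longlonglongrightarrow> f (q k y)"
          using tendsto_diff[OF tendsto_const[of "f (q k y)"], of "\<lambda>i. f (q k y) - p i (q k y)" 0] by simp
      qed
    qed
  qed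
  then show ?thesis
  proof (rule dens_limit[OF t])
    show "norm (complex_of_real (f (q k y))) \<le> B" for k y using bound by simp
    show "(\<lambda>k. complex_of_real (f (q k y))) \<longlonglongrightarrow> complex_of_real (f y)" for y
    proof (intro tendsto_of_real)
      have "(\<lambda>k. q k y) \<longlonglongrightarrow> y"
        unfolding q_def by (rule vec_tendstoI) (simp add: tendsto_scaled_sin del: of_nat_Suc)
      then show "(\<lambda>k. f (q k y)) \<longlonglongrightarrow> f y"
        using cont by (intro continuous_on_tendsto_compose[of UNIV f]) auto
    qed
  qed
qed

text \<open>The induction over disjoint unions and complements starts from closed sets, whose
  indicators are the limits of 1 / (1 + k d(y, A)) for growing k.\<close>

lemma dens_indicator:
  fixes A :: "(real^'n::finite) set"
  assumes t: "t > - real CARD('n) / 2" and A: "A \<in> sets borel"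
  shows "dens s t (indicator A)"
proof -
  have one: "dens s t (\<lambda>y :: real^'n. 1)"
    by (rule dens_multiplier[OF gauss_multiplier_const])
  have zero: "dens s t (\<lambda>y :: real^'n. 0)"
    by (rule dens_multiplier[OF gauss_multiplier_const])
  have "Int_stable (Collect closed :: (real^'n) set set)"
    by (auto simp: Int_stable_def)
  moreover have "Collect closed \<subseteq> Pow (UNIV :: (real^'n) set)" by simp
  moreover have "A \<in> sigma_sets UNIV (Collect closed)"
    using A by (simp add: borel_eq_closed)
  ultimately show ?thesis
  proof (induction rule: sigma_sets_induct_disjoint)
    case (basic A)
    then have A: "closed A" by simp
    \<comment> \<open>\<open>infdist\<close> to the empty set is 0, so the approximating functions
      would be constantly 1 there; this case is separate.\<close>
    show ?case
    proof (cases "A = {}")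
      case False
      let ?f = "\<lambda>k y. inverse (1 + real k * infdist y A)"
      have p: "1 + real k * infdist y A \<ge> 1" for k y by (simp add: infdist_nonneg)
      have p': "1 + real k * infdist y A > 0" for k y using p[of k y] by linarith
      show ?thesis
      proof (rule dens_limit[OF t])
        show "dens s t (\<lambda>y. complex_of_real (?f k y))" for k
        proof (rule dens_continuous[OF t])
          show "continuous_on UNIV (?f k)"
            using p' by (intro continuous_intros) (auto simp: less_imp_neq[THEN not_sym])
          show "\<bar>?f k y\<bar> \<le> 1" for y
            using p[of k y] p'[of k y] by (simp add: inverse_le_1_iff)
        qed
        show "norm (complex_of_real (?f k y)) \<le> 1" for k y
          using p[of k y] p'[of k y] by (simp add: inverse_le_1_iff del: of_real_inverse)
        show "(\<lambda>k. complex_of_real (?f k y)) \<longlonglongrightarrow> indicator A y" for y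
        proof (cases "y \<in> A")
          case True
          then show ?thesis by simp
        next
          case y: False
          then have "infdist y A > 0"
            using A False in_closed_iff_infdist_zero[of A y] infdist_nonneg[of y A] by auto
          then have "filterlim (\<lambda>k. 1 + real k * infdist y A) at_top sequentially"
            by (intro filterlim_tendsto_add_at_top[OF tendsto_const] filterlim_at_top_mult_tendsto_pos[OF tendsto_const _ filterlim_real_sequentially])
          then have "(\<lambda>k. ?f k y) \<longlonglongrightarrow> 0"
            by (intro filterlim_compose[OF tendsto_inverse_0] filterlim_mono[OF _ at_top_le_at_infinity order_refl])
          then have "(\<lambda>k. complex_of_real (?f k y)) \<longlonglongrightarrow> complex_of_real 0"
            by (rule tendsto_of_real)
          moreover have "indicator A y = complex_of_real 0" using y by simp
          ultimately show ?thesis by (simp only:)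
        qed
      qed
    qed (use zero in \<open>simp add: indicator_def[abs_def]\<close>)
  next
    case empty
    show ?case using zero by (simp add: indicator_def[abs_def])
  next
    case (compl A)
    have "dens s t (\<lambda>y. 1 + (- 1) * indicator A y)"
      by (intro dens_add dens_scale one compl)
    also have "(\<lambda>y. 1 + (- 1) * indicator A y) = (indicator (UNIV - A) :: _ \<Rightarrow> complex)"
      by (auto simp: indicator_def)
    finally show ?case .
  next
    case (union A)
    show ?case
    proof (rule dens_limit[OF t])
      show "dens s t (\<lambda>y. \<Sum>i<k. indicator (A i) y)" for k
        by (intro dens_sum union)
      have "(\<Sum>i<k. indicator (A i) y) = (indicator (\<Union>i<k. A i) y :: complex)" for k y
        using union(1) by (intro indicator_UN_disjoint[symmetric]) (auto simp: disjoint_family_on_def)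
      then show "norm (\<Sum>i<k. indicator (A i) y :: complex) \<le> 1" for k y
        by (simp add: indicator_def)
      show "(\<lambda>k. \<Sum>i<k. indicator (A i) y) \<longlonglongrightarrow> (indicator (\<Union>i. A i) y :: complex)" for y
        using \<open>\<And>k y. (\<Sum>i<k. indicator (A i) y) = (indicator (\<Union>i<k. A i) y :: complex)\<close>
        by (simp add: LIMSEQ_indicator_UN)
    qed
  qed
qed

lemma dens_bounded:
  fixes h :: "real^'n::finite \<Rightarrow> complex"
  assumes t: "t > - real CARD('n) / 2" and h: "h \<in> borel_measurable borel" and bound: "\<And>y. norm (h y) \<le> B"
  shows "dens s t h"
proof -
  obtain F where F: "\<And>i. simple_function borel (F i)" "\<And>y. (\<lambda>i. F i y) \<longlonglongrightarrow> h y" "\<And>i y. norm (F i y) \<le> 2 * norm (h y)"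
    using borel_measurable_implies_sequence_metric[OF h, of 0] by auto
  show ?thesis
  proof (rule dens_limit[OF t])
    show "dens s t (F i)" for i
    proof -
      have "F i = (\<lambda>y. \<Sum>v\<in>range (F i). v * indicator (F i -` {v}) y)"
      proof
        fix y :: "real^'n"
        have "indicator S y *\<^sub>R v = v * indicator S y" for v :: complex and S
          by (simp add: indicator_def)
        then show "F i y = (\<Sum>v\<in>range (F i). v * indicator (F i -` {v}) y)"
          using simple_function_indicator_representation_banach[OF F(1)[of i], of y, unfolded space_borel Int_UNIV_right, OF UNIV_I]
          by (simp only:)
      qed
      moreover have "dens s t (\<lambda>y. \<Sum>v\<in>range (F i). v * indicator (F i -` {v}) y)"
        using simple_functionD(2)[OF F(1)[of i]] by (intro dens_sum dens_scale dens_indicator[OF t]) auto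
      ultimately show ?thesis by simp
    qed
    show "norm (F i y) \<le> 2 * B" for i y
      using F(3)[of i y] bound[of y] by linarith
  qed (rule F)
qed

text \<open>Truncation in both |y| and |g y| makes the quotient by the Gaussian bounded, so
  \<open>dens_bounded\<close> applies. The truncations converge to g with g itself as majorant,
  since its norm is finite.\<close>

lemma sobolevI:
  fixes g :: "real^'n::finite \<Rightarrow> complex"
  assumes t: "t > - real CARD('n) / 2" and [measurable]: "g \<in> borel_measurable borel"
    and fin: "sobolev_sqnorm s t g < \<infinity>"
  shows "g \<in> sobolev s t"
proof -
  define G where "G k y = (if norm y \<le> real k \<and> norm (g y) \<le> real k then g y else 0)" for k y
  have [measurable]: "G k \<in> borel_measurable borel" for k unfolding G_def by measurable
  have "gauss_approx s t (G k)" for k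
  proof -
    have "dens s t (\<lambda>y. G k y * complex_of_real (exp ((y \<bullet> y) / 2)))"
    proof (rule dens_bounded[OF t])
      show "norm (G k y * complex_of_real (exp ((y \<bullet> y) / 2))) \<le> real k * exp ((real k)\<^sup>2 / 2)" for y
      proof (cases "norm y \<le> real k \<and> norm (g y) \<le> real k")
        case True
        then have "exp ((y \<bullet> y) / 2) \<le> exp ((real k)\<^sup>2 / 2)"
          by (simp add: power_mono flip: power2_norm_eq_inner)
        with True show ?thesis
          by (auto simp: G_def norm_mult norm_of_real simp del: of_real_exp intro!: mult_mono)
      qed (auto simp: G_def)
    qed measurable
    moreover have "complex_of_real (exp ((y \<bullet> y) / 2)) * gauss0 y = 1" for y :: "real^'n"
      unfolding of_real_mult[symmetric] exp_add[symmetric] by simp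
    then have "(\<lambda>y. G k y * complex_of_real (exp ((y \<bullet> y) / 2)) * gauss0 y) = G k"
      by (simp only: mult.assoc mult_1_right)
    ultimately show ?thesis by (simp only: dens_def)
  qed
  then have "gauss_approx s t g"
  proof (rule gauss_approx_limit)
    show "(\<lambda>k. sobolev_sqnorm s t (\<lambda>y. G k y - g y)) \<longlonglongrightarrow> 0"
    proof (rule sobolev_sqnorm_dominated_convergence[OF _ _ _ fin])
      show "norm (G k y - g y) \<le> norm (g y)" for k y by (simp add: G_def)
      show "(\<lambda>k. G k y) \<longlonglongrightarrow> g y" for y
      proof (rule tendsto_eventually)
        obtain K where K: "max (norm y) (norm (g y)) \<le> real K" using real_arch_simple by blast
        show "\<forall>\<^sub>F k in sequentially. G k y = g y"
          using eventually_ge_at_top[of K] by eventually_elim (use K in \<open>auto simp: G_def\<close>)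
      qed
    qed measurable
  qed measurable
  then have "\<exists>\<phi>. gauss_span \<phi> \<and> sobolev_sqnorm s t (\<lambda>y. fourier \<phi> y - g y) \<le> ennreal (inverse (real (Suc k)))" for k
    unfolding gauss_approx_def by simp
  then obtain \<phi> where \<phi>: "\<And>k. gauss_span (\<phi> k)" "\<And>k. sobolev_sqnorm s t (\<lambda>y. fourier (\<phi> k) y - g y) \<le> ennreal (inverse (real (Suc k)))"
    by metis
  have "(\<lambda>k. sobolev_sqnorm s t (\<lambda>y. fourier (\<phi> k) y - g y)) \<longlonglongrightarrow> 0"
  proof (rule tendsto_sandwich[OF _ _ tendsto_const])
    show "(\<lambda>k. ennreal (inverse (real (Suc k)))) \<longlonglongrightarrow> 0"
      using tendsto_ennrealI[OF LIMSEQ_inverse_real_of_nat] by simp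
  qed (use \<phi>(2) in \<open>simp_all del: of_nat_Suc\<close>)
  then have "schwartz_approx s t \<phi> g"
    using \<phi>(1) by (simp add: schwartz_approx_def gauss_span_schwartz)
  then show ?thesis by (auto simp: sobolev_def)
qed

text \<open>Some transform of a Schwartz function is at squared distance less than 1 from g, and its
  own norm is finite.\<close>

lemma sobolev_sqnorm_finite:
  fixes g :: "real^'n::finite \<Rightarrow> complex"
  assumes t: "t > - real CARD('n) / 2" and g: "g \<in> sobolev s t"
  shows "sobolev_sqnorm s t g < \<infinity>"
proof -
  have [measurable]: "g \<in> borel_measurable borel" using g by (simp add: sobolev_def)
  obtain \<phi> where \<phi>: "\<And>k. schwartz (\<phi> k)" "(\<lambda>k. sobolev_sqnorm s t (\<lambda>y. fourier (\<phi> k) y - g y)) \<longlonglongrightarrow> 0"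
    using g by (auto simp: sobolev_def schwartz_approx_def)
  have "eventually (\<lambda>k. sobolev_sqnorm s t (\<lambda>y. fourier (\<phi> k) y - g y) < 1) sequentially"
    using \<phi>(2) by (rule order_tendstoD(2)) simp
  then obtain k where k: "sobolev_sqnorm s t (\<lambda>y. fourier (\<phi> k) y - g y) < 1"
    by (auto simp: eventually_sequentially)
  have [measurable]: "\<phi> k \<in> borel_measurable borel" using \<phi>(1) by (rule schwartz_measurable)
  have "sobolev_sqnorm s t (\<lambda>y. g y - 0) \<le> 2 * sobolev_sqnorm s t (\<lambda>y. fourier (\<phi> k) y - g y) + 2 * sobolev_sqnorm s t (\<lambda>y. fourier (\<phi> k) y - 0)"
    by (rule sobolev_sqnorm_triangle) measurable
  also have "\<dots> < \<infinity>"
    using order.strict_trans[OF k ennreal_one_less_top] sobolev_sqnorm_fourier_finite[OF t \<phi>(1)[of k], of s]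
    by (simp add: ennreal_mult_less_top)
  finally show ?thesis by simp
qed

section \<open>Kernels of the two transforms\<close>

lemma sobolev_iff:
  fixes g :: "real^'n::finite \<Rightarrow> complex"
  assumes "t > - real CARD('n) / 2"
  shows "g \<in> sobolev s t \<longleftrightarrow> g \<in> borel_measurable borel \<and> sobolev_sqnorm s t g < \<infinity>"
  using sobolevI[OF assms, of g s] sobolev_sqnorm_finite[OF assms, of g s] by (auto simp: sobolev_def)

lemma sobolev_zero: "t > - real CARD('n::finite) / 2 \<Longrightarrow> (\<lambda>y :: real^'n. 0) \<in> sobolev s t"
  by (simp add: sobolev_iff sobolev_sqnorm_def)

lemma sobolev_add:
  fixes u v :: "real^'n::finite \<Rightarrow> complex"
  assumes t: "t > - real CARD('n) / 2" and u: "u \<in> sobolev s t" and v: "v \<in> sobolev s t"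
  shows "(\<lambda>y. u y + v y) \<in> sobolev s t"
proof -
  have [measurable]: "u \<in> borel_measurable borel" "v \<in> borel_measurable borel"
    using u v by (auto simp: sobolev_def)
  have "sobolev_sqnorm s t (\<lambda>y. u y - (- v y)) \<le> 2 * sobolev_sqnorm s t (\<lambda>y. 0 - u y) + 2 * sobolev_sqnorm s t (\<lambda>y. 0 - (- v y))"
    by (rule sobolev_sqnorm_triangle) measurable
  also have "\<dots> = 2 * sobolev_sqnorm s t u + 2 * sobolev_sqnorm s t v"
    by (simp add: sobolev_sqnorm_def)
  also have "\<dots> < \<infinity>"
    using u v by (simp add: sobolev_iff[OF t] ennreal_mult_less_top)
  finally show ?thesis by (simp add: sobolev_iff[OF t])
qed

lemma sobolev_sum:
  fixes u :: "'i \<Rightarrow> real^'n::finite \<Rightarrow> complex"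
  assumes t: "t > - real CARD('n) / 2" and u: "\<And>i. i \<in> I \<Longrightarrow> u i \<in> sobolev s t"
  shows "(\<lambda>y. \<Sum>i\<in>I. u i y) \<in> sobolev s t"
  using u
  by (induction I rule: infinite_finite_induct) (auto intro: sobolev_zero[OF t] sobolev_add[OF t])

lemma sobolev_mult_bounded:
  fixes u c :: "real^'n::finite \<Rightarrow> complex"
  assumes t: "t > - real CARD('n) / 2" and u: "u \<in> sobolev s t"
    and c[measurable]: "c \<in> borel_measurable borel" and K: "\<And>y. norm (c y) \<le> K"
  shows "(\<lambda>y. c y * u y) \<in> sobolev s t"
proof -
  have [measurable]: "u \<in> borel_measurable borel" using u by (auto simp: sobolev_def)
  have "sobolev_sqnorm s t (\<lambda>y. c y * u y) \<le> sobolev_sqnorm s t (\<lambda>y. complex_of_real K * u y)"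
  proof (rule sobolev_sqnorm_mono)
    fix y
    have "0 \<le> K" using order_trans[OF norm_ge_zero K] .
    then show "norm (c y * u y) \<le> norm (complex_of_real K * u y)"
      using mult_right_mono[OF K norm_ge_zero] by (simp add: norm_mult)
  qed
  also have "\<dots> = ennreal (K\<^sup>2) * sobolev_sqnorm s t u"
    by (subst sobolev_sqnorm_scale) auto
  also have "\<dots> < \<infinity>"
    using u by (simp add: sobolev_iff[OF t] ennreal_mult_less_top)
  finally show ?thesis by (simp add: sobolev_iff[OF t])
qed

text \<open>Raising t by 1 multiplies the weight by |y|^2, which cancels the square of the factor
  1/|y|; raising s as well keeps s - t fixed. At y = 0 both integrands are 0, since
  \<open>0 powr a = 0\<close>.\<close>

lemma sobolev_inverse_norm:
  fixes u :: "real^'n::finite \<Rightarrow> complex"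
  assumes t: "t > - real CARD('n) / 2" and u: "u \<in> sobolev s t"
  shows "(\<lambda>y. complex_of_real (inverse (norm y)) * u y) \<in> sobolev (s + 1) (t + 1)"
proof -
  have [measurable]: "u \<in> borel_measurable borel" using u by (auto simp: sobolev_def)
  have t': "t + 1 > - real CARD('n) / 2" using t by simp
  have "norm y powr (2 * (t + 1)) * (1 + (norm y)\<^sup>2) powr (s + 1 - (t + 1)) * (norm (complex_of_real (inverse (norm y)) * u y))\<^sup>2
     = norm y powr (2 * t) * (1 + (norm y)\<^sup>2) powr (s - t) * (norm (u y))\<^sup>2" for y :: "real^'n"
  proof (cases "y = 0")
    case False
    then have "norm y powr (2 * (t + 1)) = norm y powr (2 * t) * (norm y)\<^sup>2"
      by (simp add: distrib_left powr_add)
    with False show ?thesis by (simp add: norm_mult power_mult_distrib norm_inverse power_inverse)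
  qed simp
  then have "sobolev_sqnorm (s + 1) (t + 1) (\<lambda>y. complex_of_real (inverse (norm y)) * u y) = sobolev_sqnorm s t u"
    unfolding sobolev_sqnorm_def by (simp only:)
  then show ?thesis using u by (simp add: sobolev_iff[OF t] sobolev_iff[OF t'])
qed

lemma sobolev_mform:
  fixes u :: "'n::finite tensor_field"
  assumes t: "t > - real CARD('n) / 2"
    and ws: "\<And>w. w \<in> set ws \<Longrightarrow> w \<in> borel_measurable borel" "\<And>w y. w \<in> set ws \<Longrightarrow> norm (w y) \<le> K"
    and u: "\<And>is. length is = length ws \<Longrightarrow> u is \<in> sobolev s t"
  shows "(\<lambda>y. mform (map (\<lambda>w. w y) ws) (\<lambda>is. u is y)) \<in> sobolev s t"
  using ws u
proof (induction ws arbitrary: u)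
  case (Cons w ws)
  have [measurable]: "w \<in> borel_measurable borel" using Cons.prems by simp
  have "(\<lambda>y. complex_of_real (w y $ j) * mform (map (\<lambda>w. w y) ws) (\<lambda>js. u (j # js) y)) \<in> sobolev s t" for j
  proof (rule sobolev_mult_bounded[OF t])
    show "(\<lambda>y. mform (map (\<lambda>w. w y) ws) (\<lambda>js. u (j # js) y)) \<in> sobolev s t"
      by (rule Cons.IH) (auto intro: Cons.prems)
    show "norm (complex_of_real (w y $ j)) \<le> K" for y
      using component_le_norm_cart[of "w y" j] Cons.prems(2)[of w y] by simp
  qed measurable
  then show ?case by (simp add: sobolev_sum[OF t])
qed simp

lemma sobolev_symmetrize:
  fixes u :: "'n::finite tensor_field"
  assumes t: "t > - real CARD('n) / 2" and u: "\<And>is. length is = m \<Longrightarrow> u is \<in> sobolev s t" and l: "length js = m"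
  shows "(\<lambda>y. symmetrize (\<lambda>is. u is y) js) \<in> sobolev s t"
proof -
  have "(\<lambda>y. complex_of_real (1 / fact (length js)) * (\<Sum>\<pi> | \<pi> permutes {..<length js}. u (permute_list \<pi> js) y)) \<in> sobolev s t"
    by (intro sobolev_mult_bounded[OF t sobolev_sum[OF t]] u order_refl) (use l in auto)
  then show ?thesis by (simp only: symmetrize_def scaleR_conv_of_real)
qed

text \<open>Each index list and permutation comes with its own null set; there are finitely many of
  them, so their union is still a null set.\<close>

lemma AE_symmetric_tensor:
  assumes "u \<in> sobolev_tensor m s t"
  shows "AE y in lborel. symmetric_tensor m (\<lambda>is. u is y)"
proof -
  have f: "finite {is :: 'a list. length is = m}"
    using finite_lists_length_eq[of "UNIV :: 'a set" m] by simp
  have g: "finite {\<pi>. \<pi> permutes {..<m}}"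
    by (rule finite_permutations) simp
  have "AE y in lborel. \<forall>is\<in>{is. length is = m}. \<forall>\<pi>\<in>{\<pi>. \<pi> permutes {..<m}}. u (permute_list \<pi> is) y = u is y"
    using assms by (intro AE_finite_allI f g) (auto simp: sobolev_tensor_def)
  then show ?thesis by eventually_elim (auto simp: symmetric_tensor_def)
qed

lemma sobolev_tensorI:
  assumes "\<And>is. length is = m \<Longrightarrow> u is \<in> sobolev s t" "AE y in lborel. symmetric_tensor m (\<lambda>is. u is y)"
  shows "u \<in> sobolev_tensor m s t"
proof -
  have "AE y in lborel. u (permute_list \<pi> is) y = u is y" if "length is = m" "\<pi> permutes {..<m}" for \<pi> "is"
    using assms(2) by eventually_elim (rule symmetric_tensorD[OF _ that])
  then show ?thesis using assms(1) by (auto simp: sobolev_tensor_def)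
qed

lemma AE_tensor_field_eq:
  assumes "tensor_field_eq m u v"
  shows "AE y in lborel. \<forall>is. length is = m \<longrightarrow> u is y = v is y"
proof -
  have f: "finite {is :: 'a list. length is = m}"
    using finite_lists_length_eq[of "UNIV :: 'a set" m] by simp
  have "AE y in lborel. \<forall>is\<in>{is. length is = m}. u is y = v is y"
    using assms by (intro AE_finite_allI f) (auto simp: tensor_field_eq_def)
  then show ?thesis by simp
qed

lemma tensor_field_eqI:
  assumes "AE y in lborel. \<forall>is. length is = m \<longrightarrow> u is y = v is y"
  shows "tensor_field_eq m u v"
  unfolding tensor_field_eq_def using assms by (auto elim: eventually_mono)

section \<open>The splitting for tensor fields\<close>

definition proj_field :: "'n::finite tensor_field \<Rightarrow> 'n tensor_field" where
  "proj_field u is y = proj_perp y (\<lambda>js. u js y) is"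

definition pot_field :: "'n::finite tensor_field \<Rightarrow> 'n tensor_field" where
  "pot_field u is y = potential y (\<lambda>js. u js y) is"

lemma borel_measurable_perp_axis [measurable]: "(\<lambda>y :: real^'n::finite. perp_axis y i) \<in> borel_measurable borel"
  unfolding perp_axis_def by measurable

lemma proj_field_sobolev:
  fixes u :: "'n::finite tensor_field"
  assumes t: "t > - real CARD('n) / 2" and u: "u \<in> sobolev_tensor m s t"
  shows "proj_field u \<in> sobolev_tensor m s t"
proof (rule sobolev_tensorI)
  fix "is" :: "'n list" assume l: "length is = m"
  have "(\<lambda>y. mform (map (\<lambda>w. w y) (map (\<lambda>i y. perp_axis y i) is)) (\<lambda>js. u js y)) \<in> sobolev s t"
    by (rule sobolev_mform[OF t, where K = 2]) (use u l norm_perp_axis_le in \<open>auto simp: sobolev_tensor_def\<close>)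
  then show "proj_field u is \<in> sobolev s t"
    by (simp add: proj_field_def[abs_def] proj_perp_def o_def)
next
  show "AE y in lborel. symmetric_tensor m (\<lambda>is. proj_field u is y)"
    using AE_symmetric_tensor[OF u] by eventually_elim (simp add: proj_field_def symmetric_proj_perp)
qed

lemma pot_field_sobolev:
  fixes u :: "'n::finite tensor_field"
  assumes t: "t > - real CARD('n) / 2" and u: "u \<in> sobolev_tensor (Suc m) s t"
  shows "pot_field u \<in> sobolev_tensor m (s + 1) (t + 1)"
proof (rule sobolev_tensorI)
  fix "is" :: "'n list" assume l: "length is = m"
  have t': "t + 1 > - real CARD('n) / 2" using t by simp
  have "(\<lambda>y. symmetrize (\<lambda>js. \<Sum>k\<le>length js. - \<i> * complex_of_real (inverse (norm y)) *
     mform (map (perp_axis y) (take k js) @ sgn y # map (\<lambda>i. axis i 1) (drop k js)) (\<lambda>ks. u ks y)) is) \<in> sobolev (s + 1) (t + 1)"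
  proof (rule sobolev_symmetrize[OF t' sobolev_sum[OF t'] l])
    fix js :: "'n list" and k :: nat assume js: "length js = m" and k: "k \<in> {..length js}"
    \<comment> \<open>The arguments as functions of y, all bounded by 2 as
      \<open>sobolev_mform\<close> asks; the factor 1/|y| is applied afterwards.\<close>
    define ws where "ws = map (\<lambda>i y. perp_axis y i) (take k js) @ sgn # map (\<lambda>i y. axis i 1 :: real^'n) (drop k js)"
    have "(\<lambda>y. mform (map (\<lambda>w. w y) ws) (\<lambda>ks. u ks y)) \<in> sobolev s t"
    proof (rule sobolev_mform[OF t, where K = 2])
      show "w \<in> borel_measurable borel" if "w \<in> set ws" for w
        using that by (auto simp: ws_def)
      show "norm (w y) \<le> 2" if "w \<in> set ws" for w y
        using that norm_perp_axis_le by (auto simp: ws_def norm_sgn)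
      show "u ks \<in> sobolev s t" if "length ks = length ws" for ks
        using that js k u by (auto simp: ws_def sobolev_tensor_def)
    qed
    then have "(\<lambda>y. - \<i> * (complex_of_real (inverse (norm y)) * mform (map (\<lambda>w. w y) ws) (\<lambda>ks. u ks y))) \<in> sobolev (s + 1) (t + 1)"
      by (intro sobolev_mult_bounded[OF t' sobolev_inverse_norm[OF t], where K = 1]) auto
    then show "(\<lambda>y. - \<i> * complex_of_real (inverse (norm y)) *
       mform (map (perp_axis y) (take k js) @ sgn y # map (\<lambda>i. axis i 1) (drop k js)) (\<lambda>ks. u ks y)) \<in> sobolev (s + 1) (t + 1)"
      by (simp add: ws_def o_def mult.assoc)
  qed
  then show "pot_field u is \<in> sobolev (s + 1) (t + 1)"
    by (simp add: pot_field_def[abs_def] potential_def)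
qed (simp add: pot_field_def symmetric_potential)

lemma inner_diff_eq_sym_mult: "inner_diff u is y = sym_mult y (\<lambda>js. u js y) is"
  by (simp add: inner_diff_def sym_mult_def)

lemma pot_field_decomposition:
  assumes "symmetric_tensor (Suc m) (\<lambda>is. u is y)" "y \<noteq> 0" "length is = Suc m"
  shows "u is y = proj_field u is y + inner_diff (pot_field u) is y"
  using decomposition[OF assms] by (simp add: proj_field_def pot_field_def inner_diff_eq_sym_mult)

section \<open>Powers of inner differentiation and solenoidal fields\<close>

lemma inner_diff_cong:
  assumes "\<And>js. length js = r \<Longrightarrow> u js y = w js y" "length is = Suc r"
  shows "inner_diff u is y = inner_diff w is y"
  unfolding inner_diff_def by (rule symmetrize_cong) (use assms in simp)

text \<open>On the Fourier side d acts at each y separately, so equalities that hold only at almost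
  every y can be inserted under its powers.\<close>

lemma inner_diff_funpow_cong:
  assumes "\<And>js. length js = r \<Longrightarrow> u js y = w js y" "length is = k + r"
  shows "(inner_diff ^^ k) u is y = (inner_diff ^^ k) w is y"
  using assms(2)
proof (induction k arbitrary: "is")
  case (Suc k)
  show ?case
    unfolding funpow.simps o_apply by (rule inner_diff_cong[where r = "k + r"]) (use Suc in auto)
qed (use assms(1) in simp)

lemma inner_diff_funpow_add:
  "(inner_diff ^^ k) (\<lambda>is y. u is y + w is y) is y = (inner_diff ^^ k) u is y + (inner_diff ^^ k) w is y"
proof -
  have "(inner_diff ^^ k) (\<lambda>is y. u is y + w is y) = (\<lambda>is y. (inner_diff ^^ k) u is y + (inner_diff ^^ k) w is y)"
    by (induction k) (simp_all add: inner_diff_def fun_eq_iff distrib_left symmetrize_add)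
  then show ?thesis by simp
qed

lemma inner_diff_funpow_zero: "(inner_diff ^^ k) (\<lambda>is y. 0) = (\<lambda>is y. 0)"
  by (induction k) (simp_all add: inner_diff_def fun_eq_iff symmetrize_def)

lemma mform_inner_diff_funpow:
  "mform (replicate (k + r) \<omega>) (\<lambda>is. (inner_diff ^^ k) u is y) =
     (\<i> * complex_of_real (y \<bullet> \<omega>)) ^ k * mform (replicate r \<omega>) (\<lambda>is. u is y)"
proof (induction k)
  case (Suc k)
  have "mform (replicate (Suc (k + r)) \<omega>) (\<lambda>is. inner_diff ((inner_diff ^^ k) u) is y) =
     \<i> * complex_of_real (y \<bullet> \<omega>) * mform (replicate (k + r) \<omega>) (\<lambda>is. (inner_diff ^^ k) u is y)"
    unfolding inner_diff_eq_sym_mult by (rule mform_sym_mult_replicate)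
  then show ?case by (simp add: Suc.IH mult.assoc del: replicate_Suc)
qed simp

text \<open>At y = \<sigma>\<omega> the last argument \<omega> is a multiple of y, so it produces
  the divergence.\<close>

lemma mform_replicate_solenoidal:
  assumes "\<And>is. length is = r \<Longrightarrow> divergence u is (\<sigma> *\<^sub>R \<omega>) = 0" and "\<sigma> \<noteq> 0"
  shows "mform (replicate (Suc r) \<omega>) (\<lambda>is. u is (\<sigma> *\<^sub>R \<omega>)) = 0"
proof -
  let ?y = "\<sigma> *\<^sub>R \<omega>"
  have "(\<Sum>j\<in>UNIV. complex_of_real (\<omega> $ j) * u (is @ [j]) ?y) = 0" if "length is = r" for "is"
  proof -
    have "\<i> * complex_of_real \<sigma> * (\<Sum>j\<in>UNIV. complex_of_real (\<omega> $ j) * u (is @ [j]) ?y) = divergence u is ?y"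
      by (simp add: divergence_def sum_distrib_left mult_ac)
    then show ?thesis using assms that by simp
  qed
  then have "mform (replicate r \<omega>) (\<lambda>is. \<Sum>j\<in>UNIV. complex_of_real (\<omega> $ j) * u (is @ [j]) ?y) = mform (replicate r \<omega>) (\<lambda>is. 0)"
    by (intro mform_cong) simp
  moreover have "mform (replicate (Suc r) \<omega>) (\<lambda>is. u is ?y) = mform (replicate r \<omega> @ [\<omega>]) (\<lambda>is. u is ?y)"
    by (simp only: replicate_append_same replicate_Suc)
  ultimately show ?thesis by (simp add: mform_append del: replicate_Suc)
qed

lemma proj_field_solenoidal: "y \<noteq> 0 \<Longrightarrow> divergence (proj_field u) is y = 0"
  unfolding divergence_def proj_field_def by (rule proj_perp_solenoidal)

section \<open>The two transforms as multilinear forms and their kernels\<close>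

lemma AE_contract_radon_ext:
  fixes f :: "'n::finite tensor_field"
  assumes n: "CARD('n) \<ge> 2" and f: "f \<in> sobolev_tensor m s t"
  shows "AE (\<omega>, \<sigma>) in sphere_measure \<Otimes>\<^sub>M lborel. norm \<omega> = 1 \<and> \<sigma> \<noteq> 0 \<and>
     symmetric_tensor m (\<lambda>is. f is (\<sigma> *\<^sub>R \<omega>)) \<and>
     (\<forall>vs. length vs = m \<longrightarrow> contract m (\<lambda>is. radon_ext s t (f is) (\<omega>, \<sigma>)) (sym_product vs) =
        complex_of_real ((2 * pi) powr ((real CARD('n) - 1) / 2)) * mform vs (\<lambda>is. f is (\<sigma> *\<^sub>R \<omega>)))"
proof -
  let ?c = "complex_of_real ((2 * pi) powr ((real CARD('n) - 1) / 2))"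
  have fin: "finite {is :: 'n list. length is = m}"
    using finite_lists_length_eq[of "UNIV :: 'n set" m] by simp
  have "AE x in sphere_measure \<Otimes>\<^sub>M lborel. \<forall>is\<in>{is. length is = m}. radon_ext s t (f is) x = ?c * f is (snd x *\<^sub>R fst x)"
  proof (intro AE_finite_allI fin)
    fix "is" :: "'n list" assume "is \<in> {is. length is = m}"
    then have "f is \<in> sobolev s t" using f by (simp add: sobolev_tensor_def)
    from radon_ext_eq[OF n this]
    show "AE x in sphere_measure \<Otimes>\<^sub>M lborel. radon_ext s t (f is) x = ?c * f is (snd x *\<^sub>R fst x)"
      by (simp add: case_prod_unfold)
  qed
  moreover have "AE (\<omega>, \<sigma>) in sphere_measure \<Otimes>\<^sub>M lborel. symmetric_tensor m (\<lambda>is. f is (\<sigma> *\<^sub>R \<omega>))"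
    by (rule AE_cylinder_of_AE[OF n AE_symmetric_tensor[OF f]])
  moreover have "AE (\<omega>, \<sigma>) in sphere_measure \<Otimes>\<^sub>M lborel. \<sigma> *\<^sub>R \<omega> \<noteq> (0 :: real^'n)"
    by (rule AE_cylinder_of_AE[OF n]) (rule AE_lborel_singleton)
  ultimately show ?thesis
    using AE_cylinder_norm
  proof eventually_elim
    case (elim x)
    obtain \<omega> \<sigma> where x: "x = (\<omega>, \<sigma>)" by (cases x)
    have "contract m (\<lambda>is. radon_ext s t (f is) x) (sym_product vs) = ?c * mform vs (\<lambda>is. f is (\<sigma> *\<^sub>R \<omega>))" if "length vs = m" for vs
    proof -
      have "contract m (\<lambda>is. radon_ext s t (f is) x) (sym_product vs) = ?c * contract m (\<lambda>is. f is (\<sigma> *\<^sub>R \<omega>)) (sym_product vs)"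
        unfolding contract_def sum_distrib_left
        by (intro sum.cong refl) (use elim(1) x in \<open>simp add: mult.assoc\<close>)
      then show ?thesis
        using contract_sym_product_symmetric[OF that] elim(2) x by simp
    qed
    with elim x show ?case by simp
  qed
qed

lemma concat_replicate_map:
  "concat (map (\<lambda>i. replicate (l i) (g i)) xs) = map g (concat (map (\<lambda>i. replicate (l i) i) xs))"
  by (induction xs) simp_all

text \<open>\<open>longitudinal\<close> lists each frame vector with its multiplicity. A list of
  frame indices and the list rebuilt from its counts differ by a permutation only, to which a
  symmetric form is insensitive.\<close>

lemma mset_concat_replicate_count:
  assumes "set ks \<subseteq> set xs" "distinct xs"
  shows "mset (concat (map (\<lambda>i. replicate (count_list ks i) i) xs)) = mset ks"
proof (rule multiset_eqI)
  fix j
  have "count (mset (concat (map (\<lambda>i. replicate (l i) i) xs))) j = (if j \<in> set xs then l j else 0)" for l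
    using assms(2) by (induction xs) auto
  then show "count (mset (concat (map (\<lambda>i. replicate (count_list ks i) i) xs))) j = count (mset ks) j"
    using assms(1) by (auto simp: count_mset count_list_0_iff)
qed

text \<open>Necessity: vanishing on all lists of frame vectors extends to the columns of P by
  multilinearity, so the projected part of f is 0 and \<open>pot_field f\<close> serves as v.
  Sufficiency: frame vectors are orthogonal to y, and an inner derivative pairs y with one of
  them.\<close>

lemma longitudinal_kernel:
  fixes f :: "'n::finite tensor_field"
  assumes n: "CARD('n) \<ge> 2" and m: "m \<ge> 1" and t: "t > - real CARD('n) / 2"
    and e: "\<And>\<omega>. norm \<omega> = 1 \<Longrightarrow> orthonormal_basis_perp \<omega> (e \<omega>)"
    and f: "f \<in> sobolev_tensor m s t"
  shows "(\<forall>l. (\<Sum>i\<in>{1..<CARD('n)}. l i) = m \<longrightarrow> zero_on_cylinder (longitudinal e m l s t f)) \<longleftrightarrow>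
          (\<exists>v \<in> sobolev_tensor (m - 1) (s + 1) (t + 1). tensor_field_eq m f (inner_diff v))"
    (is "?L \<longleftrightarrow> ?R")
proof
  let ?I = "{1..<CARD('n)}"
  define vs where "vs l \<omega> = concat (map (\<lambda>i. replicate (l i) (e \<omega> i)) [1..<CARD('n)])" for l \<omega>
  have len: "length (vs l \<omega>) = (\<Sum>i\<in>?I. l i)" for l \<omega>
    by (simp add: vs_def length_concat o_def sum_list_distinct_conv_sum_set)
  {
    assume L: ?L
    \<comment> \<open>There are infinitely many l, as their values outside the index range are free.
      The finitely many lists ks reach all multiplicities through \<open>count_list\<close>, so a
      single null set suffices.\<close>
    let ?K = "{ks. set ks \<subseteq> ?I \<and> length ks = m}"
    have "AE (\<omega>, \<sigma>) in sphere_measure \<Otimes>\<^sub>M lborel. longitudinal e m (count_list ks) s t f \<omega> \<sigma> = 0" if "ks \<in> ?K" for ks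
    proof -
      have "(\<Sum>i\<in>?I. count_list ks i) = m"
        using sum_count_set[of ks ?I] that by simp
      then show ?thesis using L unfolding zero_on_cylinder_def by blast
    qed
    then have "AE x in sphere_measure \<Otimes>\<^sub>M lborel. \<forall>ks\<in>?K. longitudinal e m (count_list ks) s t f (fst x) (snd x) = 0"
      by (intro AE_finite_allI finite_lists_length_eq) (auto simp: case_prod_unfold)
    then have "AE (\<omega>, \<sigma>) in sphere_measure \<Otimes>\<^sub>M lborel. \<forall>is. length is = m \<longrightarrow>
        proj_field f is (\<sigma> *\<^sub>R \<omega>) = 0"
      using AE_contract_radon_ext[OF n f]
    proof eventually_elim
      case (elim x)
      obtain \<omega> \<sigma> where x: "x = (\<omega>, \<sigma>)" by (cases x)
      let ?F = "\<lambda>is. f is (\<sigma> *\<^sub>R \<omega>)"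
      have \<omega>: "norm \<omega> = 1" and \<sigma>: "\<sigma> \<noteq> 0" and sym: "symmetric_tensor m ?F"
        using elim(2) x by auto
      have basis: "mform ws ?F = 0" if ws: "set ws \<subseteq> e \<omega> ` ?I" "length ws = m" for ws
      proof -
        have "ws \<in> lists (e \<omega> ` ?I)" using ws(1) by (simp add: lists_eq_set)
        then have "ws \<in> map (e \<omega>) ` lists ?I" by (simp only: lists_image)
        then obtain ks where ks: "ws = map (e \<omega>) ks" "set ks \<subseteq> ?I" by (auto simp: lists_eq_set)
        then have K: "ks \<in> ?K" using ws(2) by simp
        have l: "length (vs (count_list ks) \<omega>) = m"
          using len sum_count_set[of ks ?I] K by simp
        have "mset (vs (count_list ks) \<omega>) = mset ws"
          unfolding vs_def concat_replicate_map[of _ "e \<omega>"] mset_map ks(1)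
          using mset_concat_replicate_count[of ks "[1..<CARD('n)]"] ks(2) by simp
        then obtain \<pi> where "\<pi> permutes {..<length ws}" "permute_list \<pi> ws = vs (count_list ks) \<omega>"
          using mset_eq_permutation by metis
        then have "mform ws ?F = mform (vs (count_list ks) \<omega>) ?F"
          using mform_permute_symmetric[of ws ?F \<pi>] sym ws(2) by simp
        moreover have "longitudinal e m (count_list ks) s t f \<omega> \<sigma> = 0"
          using elim(1) K x by auto
        then have "mform (vs (count_list ks) \<omega>) ?F = 0"
          using elim(2) x l unfolding longitudinal_def vs_def[symmetric] by simp
        ultimately show ?thesis by simp
      qed
      have "proj_field f is (\<sigma> *\<^sub>R \<omega>) = 0" if l: "length is = m" for "is"
      proof -
        have "set (map (perp_axis (\<sigma> *\<^sub>R \<omega>)) is) \<subseteq> span (e \<omega> ` ?I)"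
        proof -
          have "span (e \<omega> ` ?I) = {x. x \<bullet> \<omega> = 0}"
            using e[OF \<omega>] by (simp add: orthonormal_basis_perp_def)
          moreover have "perp_axis (\<sigma> *\<^sub>R \<omega>) i \<bullet> \<omega> = 0" for i
            using perp_axis_orthogonal[of "\<sigma> *\<^sub>R \<omega>" i] \<omega> \<sigma> by (cases "\<omega> = 0") auto
          ultimately show ?thesis by auto
        qed
        then show ?thesis
          using mform_span[of "e \<omega> ` ?I" m ?F "[]" "map (perp_axis (\<sigma> *\<^sub>R \<omega>)) is"] basis l
          by (simp add: proj_field_def proj_perp_def)
      qed
      then show ?case using x by simp
    qed
    then have "AE y in lborel. \<forall>is. length is = m \<longrightarrow> proj_field f is y = 0"
      by (rule AE_of_AE_cylinder)
    then have "AE y in lborel. \<forall>is. length is = m \<longrightarrow> f is y = inner_diff (pot_field f) is y"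
      using AE_symmetric_tensor[OF f] AE_lborel_singleton[of 0]
    proof eventually_elim
      case (elim y)
      then show ?case
        using pot_field_decomposition[of "m - 1" f y] m by auto
    qed
    then show ?R
      using pot_field_sobolev[OF t, of f "m - 1" s] f m by (intro bexI[of _ "pot_field f"] tensor_field_eqI) auto
  }
  {
    assume ?R
    then obtain v where "tensor_field_eq m f (inner_diff v)" by blast
    from AE_cylinder_of_AE[OF n AE_tensor_field_eq[OF this]]
    have ae: "AE (\<omega>, \<sigma>) in sphere_measure \<Otimes>\<^sub>M lborel. \<forall>is. length is = m \<longrightarrow> f is (\<sigma> *\<^sub>R \<omega>) = inner_diff v is (\<sigma> *\<^sub>R \<omega>)" .
    show ?L
    proof (intro allI impI)
      fix l :: "nat \<Rightarrow> nat" assume l: "(\<Sum>i\<in>?I. l i) = m"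
      show "zero_on_cylinder (longitudinal e m l s t f)"
        unfolding zero_on_cylinder_def using ae AE_contract_radon_ext[OF n f]
      proof eventually_elim
        case (elim x)
        obtain \<omega> \<sigma> where x: "x = (\<omega>, \<sigma>)" by (cases x)
        have \<omega>: "norm \<omega> = 1" using elim(2) x by auto
        have perp: "(\<sigma> *\<^sub>R \<omega>) \<bullet> w = 0" if "w \<in> set (vs l \<omega>)" for w
        proof -
          have "w \<in> e \<omega> ` ?I" using that by (auto simp: vs_def)
          then have "w \<in> span (e \<omega> ` ?I)" by (rule span_base)
          then show ?thesis
            using e[OF \<omega>] by (simp add: orthonormal_basis_perp_def inner_commute)
        qed
        have "mform (vs l \<omega>) (\<lambda>is. f is (\<sigma> *\<^sub>R \<omega>)) = mform (vs l \<omega>) (sym_mult (\<sigma> *\<^sub>R \<omega>) (\<lambda>js. v js (\<sigma> *\<^sub>R \<omega>)))"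
          using elim(1) x len[of l \<omega>] l by (intro mform_cong) (simp add: inner_diff_eq_sym_mult)
        also have "\<dots> = 0"
          using perp len[of l \<omega>] l m by (intro mform_sym_mult_perp) auto
        finally show ?case
          using elim(2) x len[of l \<omega>] l unfolding longitudinal_def vs_def[symmetric] by simp
      qed
    qed
  }
qed

text \<open>Evaluated at (\<omega>, ..., \<omega>), each d^i v_i with i < m vanishes because v_i has
  a free index and is solenoidal. This is the sufficiency; for the necessity it isolates the scalar
  remainder of the iterated splitting.\<close>

lemma transversal_kernel:
  fixes f :: "'n::finite tensor_field"
  assumes n: "CARD('n) \<ge> 2" and t: "t > - real CARD('n) / 2"
    and f: "f \<in> sobolev_tensor m s t"
  shows "zero_on_cylinder (transversal m s t f) \<longleftrightarrow>
          (\<exists>v. (\<forall>i<m. v i \<in> sobolev_tensor (m - i) (s + real i) (t + real i) \<and>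
                      tensor_field_eq (m - i - 1) (divergence (v i)) (\<lambda>is y. 0)) \<and>
               tensor_field_eq m f (\<lambda>is y. \<Sum>i<m. (inner_diff ^^ i) (v i) is y))"
    (is "?L \<longleftrightarrow> ?R")
proof
  assume L: ?L
  \<comment> \<open>\<open>V i\<close> is the potential left after i splittings and
    \<open>v i\<close> its solenoidal part. \<open>V m\<close> is a scalar, which has to be shown to
    vanish.\<close>
  define V where "V i = (pot_field ^^ i) f" for i
  define v where "v i = proj_field (V i)" for i
  have V: "V i \<in> sobolev_tensor (m - i) (s + real i) (t + real i)" if "i \<le> m" for i
    using that
  proof (induction i)
    case 0
    then show ?case using f by (simp add: V_def)
  next
    case (Suc i)
    then have "Suc (m - Suc i) = m - i" by simp
    then show ?case
      using pot_field_sobolev[of "t + real i" "V i" "m - Suc i" "s + real i"] Suc t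
      by (simp add: V_def add_ac)
  qed
  have v: "v i \<in> sobolev_tensor (m - i) (s + real i) (t + real i)" if "i < m" for i
    unfolding v_def using V[of i] that t by (intro proj_field_sobolev) auto
  have expand: "AE y in lborel. \<forall>is. length is = m \<longrightarrow>
     f is y = (\<Sum>i<m. (inner_diff ^^ i) (v i) is y) + (inner_diff ^^ m) (V m) is y"
  proof -
    have "AE y in lborel. \<forall>i\<in>{..m}. symmetric_tensor (m - i) (\<lambda>is. V i is y)"
      by (intro AE_finite_allI AE_symmetric_tensor[OF V]) auto
    then show ?thesis
      using AE_lborel_singleton[of 0]
    proof eventually_elim
      case (elim y)
      have "f is y = (\<Sum>i<k. (inner_diff ^^ i) (v i) is y) + (inner_diff ^^ k) (V k) is y" if l: "length is = m" and "k \<le> m" for "is" k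
        using that(2)
      proof (induction k)
        case 0
        then show ?case by (simp add: V_def)
      next
        case (Suc k)
        have "(inner_diff ^^ k) (V k) is y = (inner_diff ^^ k) (\<lambda>is y. v k is y + inner_diff (V (Suc k)) is y) is y"
        proof (rule inner_diff_funpow_cong)
          show "length is = k + (m - k)" using l Suc.prems by simp
          fix js :: "'n list" assume js: "length js = m - k"
          have "Suc (m - Suc k) = m - k" using Suc.prems by simp
          then show "V k js y = v k js y + inner_diff (V (Suc k)) js y"
            using pot_field_decomposition[of "m - Suc k" "V k" y js] elim js Suc.prems by (simp add: v_def V_def)
        qed
        also have "\<dots> = (inner_diff ^^ k) (v k) is y + (inner_diff ^^ Suc k) (V (Suc k)) is y"
          by (simp add: inner_diff_funpow_add funpow_swap1)
        finally show ?case using Suc by simp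
      qed
      then show ?case by blast
    qed
  qed
  have "AE (\<omega>, \<sigma>) in sphere_measure \<Otimes>\<^sub>M lborel. V m [] (\<sigma> *\<^sub>R \<omega>) = 0"
    using L[unfolded zero_on_cylinder_def] AE_contract_radon_ext[OF n f] AE_cylinder_of_AE[OF n expand]
  proof eventually_elim
    case (elim x)
    obtain \<omega> \<sigma> where x: "x = (\<omega>, \<sigma>)" by (cases x)
    let ?y = "\<sigma> *\<^sub>R \<omega>"
    have \<omega>: "norm \<omega> = 1" and \<sigma>: "\<sigma> \<noteq> 0" using elim(2) x by auto
    then have y: "?y \<noteq> 0" by auto
    have vanish: "mform (replicate m \<omega>) (\<lambda>is. (inner_diff ^^ i) (v i) is ?y) = 0" if "i < m" for i
    proof -
      have "mform (replicate (Suc (m - Suc i)) \<omega>) (\<lambda>is. v i is ?y) = 0"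
        using \<sigma> y by (intro mform_replicate_solenoidal) (simp_all add: v_def proj_field_solenoidal)
      moreover have "Suc (m - Suc i) = m - i" using that by simp
      ultimately show ?thesis
        using mform_inner_diff_funpow[of i "m - i" \<omega> "v i" ?y] that by simp
    qed
    have "0 = mform (replicate m \<omega>) (\<lambda>is. f is ?y)"
      using elim(1,2) x by (simp add: transversal_def)
    also have "\<dots> = mform (replicate m \<omega>) (\<lambda>is. (\<Sum>i<m. (inner_diff ^^ i) (v i) is ?y) + (inner_diff ^^ m) (V m) is ?y)"
      using elim(3) x by (intro mform_cong) simp
    also have "\<dots> = mform (replicate m \<omega>) (\<lambda>is. (inner_diff ^^ m) (V m) is ?y)"
      by (simp add: mform_add mform_sum vanish)
    \<comment> \<open>In rank 0 the form is the single component \<open>V m []\<close>, and its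
      factor (i \<sigma>)^m is nonzero.\<close>
    also have "\<dots> = (\<i> * complex_of_real (?y \<bullet> \<omega>)) ^ m * V m [] ?y"
      using mform_inner_diff_funpow[of m 0 \<omega> "V m" ?y] by simp
    also have "?y \<bullet> \<omega> = \<sigma>" using \<omega> by (simp add: norm_eq_1)
    finally show ?case using \<sigma> x by simp
  qed
  then have "AE y in lborel. V m [] y = 0"
    by (rule AE_of_AE_cylinder)
  with expand have "AE y in lborel. \<forall>is. length is = m \<longrightarrow> f is y = (\<Sum>i<m. (inner_diff ^^ i) (v i) is y)"
  proof eventually_elim
    case (elim y)
    have "(inner_diff ^^ m) (V m) is y = (inner_diff ^^ m) (\<lambda>is y. 0) is y" if "length is = m" for "is"
      using elim(2) that by (intro inner_diff_funpow_cong[of 0]) auto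
    then show ?case using elim(1) by (simp add: inner_diff_funpow_zero)
  qed
  then have "tensor_field_eq m f (\<lambda>is y. \<Sum>i<m. (inner_diff ^^ i) (v i) is y)"
    by (rule tensor_field_eqI)
  moreover have "tensor_field_eq r (divergence (v i)) (\<lambda>is y. 0)" for i r
  proof (rule tensor_field_eqI)
    show "AE y in lborel. \<forall>is. length is = r \<longrightarrow> divergence (v i) is y = 0"
      using AE_lborel_singleton[of 0] by eventually_elim (simp add: v_def proj_field_solenoidal)
  qed
  ultimately show ?R using v by blast
next
  assume ?R
  then obtain v where v: "\<And>i. i < m \<Longrightarrow> tensor_field_eq (m - i - 1) (divergence (v i)) (\<lambda>is y. 0)"
    and eq: "tensor_field_eq m f (\<lambda>is y. \<Sum>i<m. (inner_diff ^^ i) (v i) is y)"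
    by blast
  have "AE y in lborel. \<forall>i\<in>{..<m}. \<forall>is. length is = m - i - 1 \<longrightarrow> divergence (v i) is y = 0"
    using AE_tensor_field_eq[OF v] by (intro AE_finite_allI) auto
  note div = AE_cylinder_of_AE[OF n this]
  show ?L
    unfolding zero_on_cylinder_def
    using div AE_cylinder_of_AE[OF n AE_tensor_field_eq[OF eq]] AE_contract_radon_ext[OF n f]
  proof eventually_elim
    case (elim x)
    obtain \<omega> \<sigma> where x: "x = (\<omega>, \<sigma>)" by (cases x)
    let ?y = "\<sigma> *\<^sub>R \<omega>"
    have \<sigma>: "\<sigma> \<noteq> 0" using elim(3) x by auto
    have vanish: "mform (replicate m \<omega>) (\<lambda>is. (inner_diff ^^ i) (v i) is ?y) = 0" if "i < m" for i
    proof -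
      have "mform (replicate (Suc (m - Suc i)) \<omega>) (\<lambda>is. v i is ?y) = 0"
        using \<sigma> elim(1) x that by (intro mform_replicate_solenoidal) auto
      moreover have "Suc (m - Suc i) = m - i" using that by simp
      ultimately show ?thesis
        using mform_inner_diff_funpow[of i "m - i" \<omega> "v i" ?y] that by simp
    qed
    have "mform (replicate m \<omega>) (\<lambda>is. f is ?y) = mform (replicate m \<omega>) (\<lambda>is. \<Sum>i<m. (inner_diff ^^ i) (v i) is ?y)"
      using elim(2) x by (intro mform_cong) simp
    also have "\<dots> = 0" by (simp add: mform_sum vanish)
    finally show ?case using elim(3) x by (simp add: transversal_def)
  qed
qed

theorem theorem3:
  fixes f :: "'n::finite tensor_field"
    and e :: "real^'n \<Rightarrow> nat \<Rightarrow> real^'n"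
    and m :: nat and s t :: real
  assumes "CARD('n) \<ge> 2" and "m \<ge> 1" and "t > - real CARD('n) / 2"
    and "\<And>\<omega>. norm \<omega> = 1 \<Longrightarrow> orthonormal_basis_perp \<omega> (e \<omega>)"
    and "f \<in> sobolev_tensor m s t"
  shows "((\<forall>l. (\<Sum>i\<in>{1..<CARD('n)}. l i) = m \<longrightarrow> zero_on_cylinder (longitudinal e m l s t f)) \<longleftrightarrow>
          (\<exists>v \<in> sobolev_tensor (m - 1) (s + 1) (t + 1). tensor_field_eq m f (inner_diff v)))
       \<and> (zero_on_cylinder (transversal m s t f) \<longleftrightarrow>
          (\<exists>v. (\<forall>i<m. v i \<in> sobolev_tensor (m - i) (s + real i) (t + real i) \<and>
                      tensor_field_eq (m - i - 1) (divergence (v i)) (\<lambda>is y. 0)) \<and>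
               tensor_field_eq m f (\<lambda>is y. \<Sum>i<m. (inner_diff ^^ i) (v i) is y)))"
  using longitudinal_kernel[OF assms] transversal_kernel[OF assms(1,3,5)] by blast

end
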